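(* Let $f\in C^1_b(\mathbb{R})\cap C^2(\mathbb{R})$, $0<\gamma<\beta<\alpha$, and let $(u,m)\in C^{2,\alpha}(\mathbb{T}^d)\times C^{2,\alpha}(\mathbb{T}^d)$ be a stable solution of the MFG system. Then there exists a neighborhood $\mathcal{O}$ of $(u,m)$ in $C^{2,\beta}(\mathbb{T}^d)\times C^{2,\gamma}(\mathbb{T}^d)$ such that, if $(u^0,m^0)\in\mathcal{O}$, the sequence $(u^k,m^k)$ generated by Newton's method $(u^{k+1},m^{k+1}) + T\big(G(u^k,m^k)+dG[u^k,m^k](u^{k+1}-u^k,m^{k+1}-m^k)\big)=0$ converges superlinearly to $(u,m)$ in $C^{2,\beta}(\mathbb{T}^d)\times C^{2,\gamma}(\mathbb{T}^d)$. If moreover $f\in C^{2,1}_{\mathrm{loc}}(\mathbb{R})$, the convergence is quadratic.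
   Context: $\mathbb{T}^d$ is the flat torus, $\lambda>0$, $\alpha\in(0,1)$, $m_0\in C^{0,\alpha}(\mathbb{T}^d)$ a probability density. $C^1_b(\mathbb{R})$: $C^1$ functions with $f,f'$ bounded; $C^{2,1}_{\mathrm{loc}}(\mathbb{R})$: $C^2$ functions with $f''$ Lipschitz on bounded sets. The MFG system is $-\Delta u + \tfrac12|Du|^2 + \lambda u = f(m)$, $-\Delta m - \operatorname{div}(m Du) + \lambda m = \lambda m_0$ in $\mathbb{T}^d$ (classical solution: $C^2$ pair satisfying it pointwise). A classical solution $(u,m)$ is stable if $(0,0)$ is the unique classical solution of $-\Delta v + Du\cdot Dv + \lambda v = f'(m)\rho$, $-\Delta\rho - \operatorname{div}(\rho Du) + \lambda\rho = \operatorname{div}(m Dv)$. $T$ maps $(\xi,\zeta)\in C^{0,\alpha}\times C^{0,\beta}(\mathbb{T}^d)$ to the solution $(v,\rho)$ of $-\Delta v+\lambda v=\xi$, $-\Delta\rho+\lambda\rho=\zeta$. $G(v,\rho)=(\tfrac12|Dv|^2-f(\rho),-\operatorname{div}(\rho Dv)-\lambda m_0)$, $dG[v,\rho](w,\mu)=(Dv\cdot Dw-f'(\rho)\mu,-\operatorname{div}(\mu Dv)-\operatorname{div}(\rho Dw))$. (The Newton initial guess is denoted $(u^0,m^0)$, distinct from the datum $m_0$.) *)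

theory Defs
  imports "HOL-Analysis.Analysis" "HOL-Library.Function_Algebras"
begin

text \<open>The flat torus T^d is modelled by Z^d-periodic functions on real^'n,
 d = CARD('n).\<close>

definition periodic :: "(real^'n \<Rightarrow> 'a) \<Rightarrow> bool" where
  "periodic u \<longleftrightarrow> (\<forall>x i. u (x + axis i 1) = u x)"

definition pd :: "'n::finite \<Rightarrow> (real^'n \<Rightarrow> real) \<Rightarrow> real^'n \<Rightarrow> real" where
  "pd i u x = frechet_derivative u (at x) (axis i 1)"

definition grad :: "(real^'n::finite \<Rightarrow> real) \<Rightarrow> real^'n \<Rightarrow> real^'n" where
  "grad u x = (\<chi> i. pd i u x)"

definition lap :: "(real^'n::finite \<Rightarrow> real) \<Rightarrow> real^'n \<Rightarrow> real" where
  "lap u x = (\<Sum>i\<in>UNIV. pd i (pd i u) x)"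

definition dvg :: "(real^'n::finite \<Rightarrow> real^'n) \<Rightarrow> real^'n \<Rightarrow> real" where
  "dvg V x = (\<Sum>i\<in>UNIV. pd i (\<lambda>y. V y $ i) x)"

definition C2 :: "(real^'n::finite \<Rightarrow> real) \<Rightarrow> bool" where
  "C2 u \<longleftrightarrow> (\<forall>x. u differentiable (at x)) \<and>
     (\<forall>i x. pd i u differentiable (at x)) \<and>
     (\<forall>i j. continuous_on UNIV (pd j (pd i u)))"

definition holder_bdd :: "real \<Rightarrow> (real^'n \<Rightarrow> real) \<Rightarrow> bool" where
  "holder_bdd a u \<longleftrightarrow> (\<exists>C. \<forall>x y. \<bar>u x - u y\<bar> \<le> C * dist x y powr a)"

definition holder_semi :: "real \<Rightarrow> (real^'n \<Rightarrow> real) \<Rightarrow> real" where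
  "holder_semi a u = Sup {\<bar>u x - u y\<bar> / dist x y powr a | x y. x \<noteq> y}"

definition supn :: "(real^'n \<Rightarrow> real) \<Rightarrow> real" where
  "supn u = Sup (range (\<lambda>x. \<bar>u x\<bar>))"

definition C0a :: "real \<Rightarrow> (real^'n \<Rightarrow> real) \<Rightarrow> bool" where
  "C0a a u \<longleftrightarrow> periodic u \<and> continuous_on UNIV u \<and> holder_bdd a u"

definition C2a :: "real \<Rightarrow> (real^'n::finite \<Rightarrow> real) \<Rightarrow> bool" where
  "C2a a u \<longleftrightarrow> periodic u \<and> C2 u \<and> (\<forall>i j. holder_bdd a (pd j (pd i u)))"

definition norm2a :: "real \<Rightarrow> (real^'n::finite \<Rightarrow> real) \<Rightarrow> real" where
  "norm2a a u = supn u + (\<Sum>i\<in>UNIV. supn (pd i u))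
      + (\<Sum>i\<in>UNIV. \<Sum>j\<in>UNIV. supn (pd j (pd i u)))
      + (\<Sum>i\<in>UNIV. \<Sum>j\<in>UNIV. holder_semi a (pd j (pd i u)))"

definition C1b :: "(real \<Rightarrow> real) \<Rightarrow> bool" where
  "C1b f \<longleftrightarrow> (\<forall>x. f differentiable (at x)) \<and> continuous_on UNIV (deriv f)
     \<and> bounded (range f) \<and> bounded (range (deriv f))"

definition C2R :: "(real \<Rightarrow> real) \<Rightarrow> bool" where
  "C2R f \<longleftrightarrow> (\<forall>x. f differentiable (at x)) \<and> (\<forall>x. deriv f differentiable (at x))
     \<and> continuous_on UNIV (deriv (deriv f))"

definition C21loc :: "(real \<Rightarrow> real) \<Rightarrow> bool" where
  "C21loc f \<longleftrightarrow> C2R f \<and> (\<forall>R. \<exists>L. \<forall>x y. \<bar>x\<bar> \<le> R \<longrightarrow> \<bar>y\<bar> \<le> R \<longrightarrow>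
      \<bar>deriv (deriv f) x - deriv (deriv f) y\<bar> \<le> L * \<bar>x - y\<bar>)"

definition prob_density :: "(real^'n::finite \<Rightarrow> real) \<Rightarrow> bool" where
  "prob_density m0 \<longleftrightarrow> (\<forall>x. 0 \<le> m0 x) \<and>
     (m0 has_integral 1) (cbox 0 (\<chi> i. 1))"

definition MFG_sol :: "real \<Rightarrow> (real \<Rightarrow> real) \<Rightarrow> (real^'n::finite \<Rightarrow> real)
    \<Rightarrow> (real^'n \<Rightarrow> real) \<Rightarrow> (real^'n \<Rightarrow> real) \<Rightarrow> bool" where
  "MFG_sol lam f m0 u m \<longleftrightarrow> periodic u \<and> periodic m \<and> C2 u \<and> C2 m \<and>
     (\<forall>x. - lap u x + (1/2) * (norm (grad u x))\<^sup>2 + lam * u x = f (m x)) \<and>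
     (\<forall>x. - lap m x - dvg (\<lambda>y. m y *\<^sub>R grad u y) x + lam * m x = lam * m0 x)"

definition stable :: "real \<Rightarrow> (real \<Rightarrow> real) \<Rightarrow> (real^'n::finite \<Rightarrow> real)
    \<Rightarrow> (real^'n \<Rightarrow> real) \<Rightarrow> (real^'n \<Rightarrow> real) \<Rightarrow> bool" where
  "stable lam f m0 u m \<longleftrightarrow> MFG_sol lam f m0 u m \<and>
     (\<forall>v \<rho>. periodic v \<and> periodic \<rho> \<and> C2 v \<and> C2 \<rho> \<and>
        (\<forall>x. - lap v x + grad u x \<bullet> grad v x + lam * v x = deriv f (m x) * \<rho> x) \<and>
        (\<forall>x. - lap \<rho> x - dvg (\<lambda>y. \<rho> y *\<^sub>R grad u y) x + lam * \<rho> x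
              = dvg (\<lambda>y. m y *\<^sub>R grad v y) x)
      \<longrightarrow> v = (\<lambda>x. 0) \<and> \<rho> = (\<lambda>x. 0))"

definition Tres :: "real \<Rightarrow> (real^'n::finite \<Rightarrow> real) \<Rightarrow> (real^'n \<Rightarrow> real)" where
  "Tres lam \<xi> = (THE v. periodic v \<and> C2 v \<and> (\<forall>x. - lap v x + lam * v x = \<xi> x))"

definition T :: "real \<Rightarrow> (real^'n::finite \<Rightarrow> real) \<times> (real^'n \<Rightarrow> real)
    \<Rightarrow> (real^'n \<Rightarrow> real) \<times> (real^'n \<Rightarrow> real)" where
  "T lam p = (Tres lam (fst p), Tres lam (snd p))"

definition G :: "real \<Rightarrow> (real \<Rightarrow> real) \<Rightarrow> (real^'n::finite \<Rightarrow> real)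
    \<Rightarrow> (real^'n \<Rightarrow> real) \<times> (real^'n \<Rightarrow> real) \<Rightarrow> (real^'n \<Rightarrow> real) \<times> (real^'n \<Rightarrow> real)" where
  "G lam f m0 p = (\<lambda>x. (1/2) * (norm (grad (fst p) x))\<^sup>2 - f (snd p x),
                   \<lambda>x. - dvg (\<lambda>y. snd p y *\<^sub>R grad (fst p) y) x - lam * m0 x)"

definition dG :: "(real \<Rightarrow> real) \<Rightarrow> (real^'n::finite \<Rightarrow> real) \<times> (real^'n \<Rightarrow> real)
    \<Rightarrow> (real^'n \<Rightarrow> real) \<times> (real^'n \<Rightarrow> real) \<Rightarrow> (real^'n \<Rightarrow> real) \<times> (real^'n \<Rightarrow> real)" where
  "dG f p q = (\<lambda>x. grad (fst p) x \<bullet> grad (fst q) x - deriv f (snd p x) * snd q x,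
               \<lambda>x. - dvg (\<lambda>y. snd q y *\<^sub>R grad (fst p) y) x
                   - dvg (\<lambda>y. snd p y *\<^sub>R grad (fst q) y) x)"

definition newton_seq :: "real \<Rightarrow> (real \<Rightarrow> real) \<Rightarrow> (real^'n::finite \<Rightarrow> real)
    \<Rightarrow> (nat \<Rightarrow> (real^'n \<Rightarrow> real) \<times> (real^'n \<Rightarrow> real)) \<Rightarrow> bool" where
  "newton_seq lam f m0 s \<longleftrightarrow> (\<forall>k. s (Suc k) + T lam (G lam f m0 (s k) + dG f (s k) (s (Suc k) - s k)) = 0)"

definition superlinear :: "(nat \<Rightarrow> real) \<Rightarrow> bool" where
  "superlinear e \<longleftrightarrow> e \<longlonglongrightarrow> 0 \<and> (\<exists>\<epsilon>. \<epsilon> \<longlonglongrightarrow> 0 \<and> (\<forall>k. e (Suc k) \<le> \<epsilon> k * e k))"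

definition quadratic :: "(nat \<Rightarrow> real) \<Rightarrow> bool" where
  "quadratic e \<longleftrightarrow> e \<longlonglongrightarrow> 0 \<and> (\<exists>C. \<forall>k. e (Suc k) \<le> C * (e k)\<^sup>2)"

end

theory Submission
  imports Defs "HOL-Probability.Probability" "HOL-Real_Asymp.Real_Asymp"
    "HOL-Complex_Analysis.Great_Picard"
begin

text \<open>The resolvent of the Laplacian gains two derivatives in Hoelder spaces: for a trigonometric
  sum the solution is the Laplace transform in time of the heat flow, whose derivatives are bounded
  by Gaussian integration by parts, and general right-hand sides are limits of trigonometric sums.
  Since dG maps into spaces of strictly better Hoelder exponent than the ones that T needs,
  T dG[p] is compact for every p, so by Riesz theory I + T dG[p] is invertible as soon as it is
  injective. At the stable solution injectivity is the stability assumption, and it persists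
  nearby because dG depends continuously on p. Finally the error e = s - (u,m) of a Newton step
  from p solves (I + T dG[p]) e = T Q with Q the second-order Taylor remainder of G. With f only
  C^2 the remainder of f is quadratic in the sup norm but merely linear in the Lipschitz norm;
  interpolation gives order 2 - \<beta> in the Hoelder norm.\<close>

section \<open>Partial derivatives and periodic functions\<close>

text \<open>The unequal exponents carry the compactness. The first component of \<open>dG\<close>
  contains only first derivatives and is Lipschitz, but the divergence terms contain second
  derivatives of class \<beta>; the second component must therefore be read in an exponent \<gamma>
  < \<beta> to leave room for Arzela-Ascoli. A second obstacle is that trigonometric sums are not
  dense in a Hoelder space, so a Schauder bound cannot be extended by density in its own norm. It is
  extended in two moves: resolvents and their derivatives converge by the bound at exponent a/2,
  where interpolation makes the right-hand sides converge, and the bound at exponent a then passes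
  to the pointwise limit. Lower-order terms cost little: each derivative of a periodic function has
  a zero within distance 1 of any point, so the Hoelder seminorm of the second derivatives controls
  all derivatives, and only the function itself needs the maximum principle.\<close>

lemma pd_has_derivative:
  "(u has_derivative D) (at x) \<Longrightarrow> pd i u x = D (axis i 1)"
  unfolding pd_def using frechet_derivative_at by metis

lemma has_derivative_pd:
  fixes u :: "real^'n::finite \<Rightarrow> real"
  assumes "u differentiable (at x)"
  shows "(u has_derivative (\<lambda>h. \<Sum>i\<in>UNIV. h $ i * pd i u x)) (at x)"
proof -
  let ?D = "frechet_derivative u (at x)"
  have D: "(u has_derivative ?D) (at x)"
    using assms by (simp add: frechet_derivative_works)
  interpret bounded_linear ?D using D by (rule has_derivative_bounded_linear)
  have "?D h = (\<Sum>i\<in>UNIV. h $ i * pd i u x)" for h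
  proof -
    have "h = (\<Sum>i\<in>UNIV. h $ i *\<^sub>R axis i 1)"
      using basis_expansion[of h] by (simp add: scalar_mult_eq_scaleR)
    then have "?D h = ?D (\<Sum>i\<in>UNIV. h $ i *\<^sub>R axis i 1)" by simp
    also have "\<dots> = (\<Sum>i\<in>UNIV. h $ i * pd i u x)"
      by (simp add: sum scaleR pd_def)
    finally show ?thesis .
  qed
  then show ?thesis using D by (metis (no_types, lifting) ext)
qed

lemma pd_add:
  assumes "u differentiable (at x)" "v differentiable (at x)"
  shows "pd i (\<lambda>y. u y + v y) x = pd i u x + pd i v x"
  using has_derivative_add[OF assms[unfolded frechet_derivative_works]]
  by (simp add: pd_has_derivative) (simp add: pd_def)

lemma pd_diff:
  assumes "u differentiable (at x)" "v differentiable (at x)"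
  shows "pd i (\<lambda>y. u y - v y) x = pd i u x - pd i v x"
  using has_derivative_diff[OF assms[unfolded frechet_derivative_works]]
  by (simp add: pd_has_derivative) (simp add: pd_def)

lemma pd_mult:
  assumes "u differentiable (at x)" "v differentiable (at x)"
  shows "pd i (\<lambda>y. u y * v y) x = u x * pd i v x + pd i u x * v x"
  using has_derivative_mult[OF assms[unfolded frechet_derivative_works]]
  by (simp add: pd_has_derivative) (simp add: pd_def)

lemma pd_cmult:
  assumes "u differentiable (at x)"
  shows "pd i (\<lambda>y. c * u y) x = c * pd i u x"
  using has_derivative_mult_right[OF assms[unfolded frechet_derivative_works], of c]
  by (simp add: pd_has_derivative) (simp add: pd_def)

lemma pd_compose_real:
  assumes "u differentiable (at x)" "(g has_real_derivative g') (at (u x))"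
  shows "((\<lambda>y. g (u y)) differentiable (at x)) \<and> pd i (\<lambda>y. g (u y)) x = g' * pd i u x"
proof -
  have D: "((\<lambda>y. g (u y)) has_derivative (\<lambda>h. frechet_derivative u (at x) h * g')) (at x)"
    using has_derivative_compose[OF assms(1)[unfolded frechet_derivative_works]
        assms(2)[unfolded has_field_derivative_def]]
    by (simp add: mult.commute)
  from pd_has_derivative[OF this, of i] D show ?thesis
    by (auto simp: pd_def differentiable_def)
qed

lemma has_real_derivative_along_axis:
  fixes u :: "real^'n::finite \<Rightarrow> real"
  assumes "u differentiable (at (x + s *\<^sub>R axis i 1))"
  shows "((\<lambda>s. u (x + s *\<^sub>R axis i 1)) has_real_derivative pd i u (x + s *\<^sub>R axis i 1)) (at s)"
proof -
  let ?D = "frechet_derivative u (at (x + s *\<^sub>R axis i 1))"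
  have D: "(u has_derivative ?D) (at (x + s *\<^sub>R axis i 1))"
    using assms by (simp add: frechet_derivative_works)
  interpret bounded_linear ?D using D by (rule has_derivative_bounded_linear)
  have "((\<lambda>s. x + s *\<^sub>R axis i 1) has_derivative (\<lambda>h. h *\<^sub>R axis i 1)) (at s)"
    by (auto intro!: derivative_eq_intros)
  from has_derivative_compose[OF this D]
  show ?thesis by (simp add: has_field_derivative_def scaleR pd_def mult_commute_abs)
qed

text \<open>Each coordinate of the direction is bounded by its norm, which costs the factor d in
  place of sqrt d; only constants are affected.\<close>

lemma lipschitz_of_pd_bound:
  fixes u :: "real^'n::finite \<Rightarrow> real"
  assumes "\<And>x. u differentiable (at x)" and "\<And>i x. \<bar>pd i u x\<bar> \<le> L"
  shows "\<bar>u x - u y\<bar> \<le> real CARD('n) * L * dist x y"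
proof -
  have "norm (u x - u y) \<le> (real CARD('n) * L) * norm (x - y)"
  proof (rule differentiable_bound[of UNIV u "\<lambda>x h. \<Sum>i\<in>UNIV. h $ i * pd i u x"])
    fix x show "(u has_derivative (\<lambda>h. \<Sum>i\<in>UNIV. h $ i * pd i u x)) (at x within UNIV)"
      using has_derivative_pd[OF assms(1)] by simp
    show "onorm (\<lambda>h. \<Sum>i\<in>UNIV. h $ i * pd i u x) \<le> real CARD('n) * L"
    proof (rule onorm_le)
      fix h :: "real^'n"
      have "norm (\<Sum>i\<in>UNIV. h $ i * pd i u x) \<le> (\<Sum>i::'n\<in>UNIV. norm h * L)"
        using component_le_norm_cart[of h] assms(2)
        by (intro sum_norm_le) (auto simp: abs_mult intro!: mult_mono)
      then show "norm (\<Sum>i\<in>UNIV. h $ i * pd i u x) \<le> real CARD('n) * L * norm h"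
        by (simp add: ac_simps)
    qed
  qed auto
  then show ?thesis by (simp add: dist_norm)
qed

text \<open>\<open>periodic\<close> speaks of single unit steps, so a lattice shift is assembled
  from natural multiples, then integer multiples (a negative one by starting at the shifted point),
  then one coordinate after another.\<close>

lemma periodic_shift_set:
  fixes u :: "real^'n::finite \<Rightarrow> 'a"
  assumes "periodic u"
  shows "u (x + (\<Sum>i\<in>J. real_of_int (k i) *\<^sub>R axis i 1)) = u x"
proof (induction J rule: infinite_finite_induct)
  case (insert j J)
  have nat: "u (y + real n *\<^sub>R axis j 1) = u y" for y n
  proof (induction n)
    case (Suc n)
    have eq: "y + real (Suc n) *\<^sub>R axis j 1 = (y + real n *\<^sub>R axis j 1) + axis j 1"
      by (simp add: algebra_simps)
    have "u ((y + real n *\<^sub>R axis j 1) + axis j 1) = u (y + real n *\<^sub>R axis j 1)"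
      using assms unfolding periodic_def by blast
    then show ?case unfolding eq using Suc by simp
  qed simp
  have int: "u (y + real_of_int l *\<^sub>R axis j 1) = u y" for y l
  proof (cases l rule: int_cases2)
    case (nonneg n) then show ?thesis using nat by simp
  next
    case (nonpos n)
    then show ?thesis using nat[of "y + real_of_int l *\<^sub>R axis j 1" n] by simp
  qed
  have eq: "x + (\<Sum>i\<in>insert j J. real_of_int (k i) *\<^sub>R axis i 1) =
     (x + (\<Sum>i\<in>J. real_of_int (k i) *\<^sub>R axis i 1)) + real_of_int (k j) *\<^sub>R axis j 1"
    using insert by (simp add: algebra_simps)
  show ?case unfolding eq int by (rule insert.IH)
qed auto

lemma periodic_int_shift:
  fixes u :: "real^'n::finite \<Rightarrow> 'a"
  assumes "periodic u" and "\<And>i. y $ i - x $ i \<in> \<int>"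
  shows "u y = u x"
proof -
  have "\<forall>i. \<exists>l. y $ i - x $ i = real_of_int l"
    using assms(2) by (auto elim: Ints_cases)
  then obtain k where k: "\<And>i. y $ i - x $ i = real_of_int (k i)"
    by (auto simp: choice_iff)
  have "y = x + (\<Sum>i\<in>UNIV. real_of_int (k i) *\<^sub>R axis i 1)"
  proof (subst vec_eq_iff, rule allI)
    fix j
    have "(\<Sum>i\<in>UNIV. real_of_int (k i) *\<^sub>R axis i 1 $ j) = (\<Sum>i\<in>UNIV. if i = j then real_of_int (k i) else 0)"
      by (intro sum.cong) (auto simp: axis_def)
    then show "y $ j = (x + (\<Sum>i\<in>UNIV. real_of_int (k i) *\<^sub>R axis i 1)) $ j"
      using k[of j] by simp
  qed
  then show ?thesis using periodic_shift_set[OF assms(1)] by metis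
qed

text \<open>A compact set that meets every lattice orbit; through \<open>frac_vec\<close> it brings
  compactness arguments to periodic functions on the whole space.\<close>

definition unit_cube :: "(real^'n::finite) set" where
  "unit_cube = cbox 0 (\<chi> i. 1)"

definition frac_vec :: "real^'n::finite \<Rightarrow> real^'n" where
  "frac_vec x = (\<chi> i. frac (x $ i))"

lemma compact_unit_cube: "compact unit_cube"
  by (simp add: unit_cube_def)

lemma frac_vec_in_unit_cube: "frac_vec x \<in> unit_cube"
  by (auto simp: unit_cube_def frac_vec_def mem_box_cart frac_lt_1 less_imp_le)

lemma periodic_frac_vec:
  fixes u :: "real^'n::finite \<Rightarrow> 'a"
  assumes "periodic u" shows "u (frac_vec x) = u x"
  by (rule periodic_int_shift[OF assms]) (simp add: frac_vec_def frac_def)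

lemma periodic_bounded:
  fixes u :: "real^'n::finite \<Rightarrow> real"
  assumes "periodic u" "continuous_on UNIV u"
  obtains B where "\<And>x. \<bar>u x\<bar> \<le> B"
proof -
  have "compact (u ` unit_cube)"
    using assms(2) compact_unit_cube by (meson compact_continuous_image continuous_on_subset subset_UNIV)
  then obtain B where "\<And>y. y \<in> u ` unit_cube \<Longrightarrow> norm y \<le> B"
    using compact_imp_bounded bounded_iff by metis
  then have "\<bar>u x\<bar> \<le> B" for x
    using frac_vec_in_unit_cube[of x] periodic_frac_vec[OF assms(1), of x] by force
  then show ?thesis using that by blast
qed

lemma periodic_attains_sup:
  fixes u :: "real^'n::finite \<Rightarrow> real"
  assumes "periodic u" "continuous_on UNIV u"
  obtains x0 where "\<And>x. u x \<le> u x0"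
proof -
  have "unit_cube \<noteq> {}" using frac_vec_in_unit_cube by blast
  then obtain x0 where "\<And>y. y \<in> unit_cube \<Longrightarrow> u y \<le> u x0"
    using continuous_attains_sup[OF compact_unit_cube] continuous_on_subset[OF assms(2)]
    by (metis subset_UNIV)
  then have "u x \<le> u x0" for x
    using frac_vec_in_unit_cube[of x] periodic_frac_vec[OF assms(1), of x] by force
  then show ?thesis using that by blast
qed

lemma periodic_pd:
  fixes u :: "real^'n::finite \<Rightarrow> real"
  assumes "periodic u" "\<And>x. u differentiable (at x)"
  shows "periodic (pd i u)"
  unfolding periodic_def
proof (intro allI)
  fix x j
  let ?D = "frechet_derivative u (at (x + axis j 1))"
  have D: "(u has_derivative ?D) (at (x + axis j 1))"
    using assms by (simp add: frechet_derivative_works)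
  have "((\<lambda>x. x + axis j 1) has_derivative (\<lambda>h. h)) (at x)"
    by (auto intro!: derivative_eq_intros)
  from has_derivative_compose[OF this D]
  have "(u has_derivative ?D) (at x)" using assms(1) by (simp add: periodic_def)
  from pd_has_derivative[OF this, of i] show "pd i u (x + axis j 1) = pd i u x"
    by (simp add: pd_def)
qed

text \<open>Rolle's theorem along one period.\<close>

lemma periodic_pd_zero_nearby:
  fixes u :: "real^'n::finite \<Rightarrow> real"
  assumes "periodic u" "\<And>x. u differentiable (at x)"
  obtains y where "dist x y \<le> 1" "pd i u y = 0"
proof -
  let ?g = "\<lambda>s. u (x + s *\<^sub>R axis i 1)"
  have der: "(?g has_real_derivative pd i u (x + s *\<^sub>R axis i 1)) (at s)" for s
    using has_real_derivative_along_axis assms(2) by blast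
  have "?g 0 = ?g 1" using assms(1) by (simp add: periodic_def)
  moreover have "continuous_on {0..1} ?g"
    using der by (meson DERIV_isCont continuous_at_imp_continuous_on)
  ultimately obtain z where z: "0 < z" "z < 1" "(?g has_real_derivative 0) (at z)"
    using Rolle[of 0 1 ?g] der real_differentiable_def by (metis zero_less_one)
  then have "pd i u (x + z *\<^sub>R axis i 1) = 0"
    using DERIV_unique[OF der] by blast
  then show ?thesis using that[of "x + z *\<^sub>R axis i 1"] z by (simp add: dist_norm)
qed

text \<open>Otherwise the first derivative along the axis, which vanishes at the maximum, would be
  positive just to its right, and the mean value theorem would produce a larger value.\<close>

lemma pd_pd_nonpos_at_max:
  fixes v :: "real^'n::finite \<Rightarrow> real"
  assumes "C2 v" and max: "\<And>x. v x \<le> v x0"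
  shows "pd i (pd i v) x0 \<le> 0"
proof (rule ccontr)
  assume neg: "\<not> ?thesis"
  let ?g = "\<lambda>s. v (x0 + s *\<^sub>R axis i 1)" and ?g' = "\<lambda>s. pd i v (x0 + s *\<^sub>R axis i 1)"
  have der: "(?g has_real_derivative ?g' s) (at s)" for s
    using has_real_derivative_along_axis assms(1) unfolding C2_def by blast
  have "(?g' has_real_derivative pd i (pd i v) (x0 + 0 *\<^sub>R axis i 1)) (at 0)"
    using has_real_derivative_along_axis assms(1) unfolding C2_def by blast
  then have der': "(?g' has_real_derivative pd i (pd i v) x0) (at 0)" by simp
  have z: "?g' 0 = 0"
    by (rule DERIV_local_max[OF der[of 0], of 1]) (use max in auto)
  obtain d where d: "d > 0" "\<And>h. 0 < h \<Longrightarrow> h < d \<Longrightarrow> ?g' (0 + h) > ?g' 0"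
    using DERIV_pos_inc_right[OF der'] neg by auto
  obtain w where w: "0 < w" "w < d/2" "?g (d/2) - ?g 0 = (d/2 - 0) * ?g' w"
    using MVT2[of 0 "d/2" ?g ?g'] der d(1) by auto
  have "?g' w > 0" using d(2)[of w] w z by simp
  then have "0 < (d/2 - 0) * ?g' w" using d(1) by simp
  then have "?g (d/2) > ?g 0" using w(3) by linarith
  then show False using max[of "x0 + (d/2) *\<^sub>R axis i 1"] by simp
qed

lemma C2_continuous: "C2 v \<Longrightarrow> continuous_on UNIV v"
  unfolding C2_def by (meson continuous_at_imp_continuous_on differentiable_imp_continuous_within)

section \<open>Linear combinations of C2 functions and the maximum principle\<close>

lemma C2_uminus: "C2 v \<Longrightarrow> C2 (\<lambda>x. - v x)"
  and pd_uminus: "C2 v \<Longrightarrow> pd i (\<lambda>x. - v x) = (\<lambda>x. - pd i v x)"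
  and pd_pd_uminus: "C2 v \<Longrightarrow> pd j (pd i (\<lambda>x. - v x)) = (\<lambda>x. - pd j (pd i v) x)"
proof -
  assume v: "C2 v"
  show 1: "pd i (\<lambda>x. - v x) = (\<lambda>x. - pd i v x)" for i
    using v pd_cmult[of v _ i "-1"] unfolding C2_def by fastforce
  show 2: "pd j (pd i (\<lambda>x. - v x)) = (\<lambda>x. - pd j (pd i v) x)" for i j
    unfolding 1 using v pd_cmult[of "pd i v" _ j "-1"] unfolding C2_def by fastforce
  show "C2 (\<lambda>x. - v x)"
    unfolding C2_def 1 2[unfolded 1] using v unfolding C2_def by (auto intro!: continuous_intros)
qed

lemma
  assumes "C2 u" "C2 v"
  shows C2_add: "C2 (\<lambda>x. u x + v x)"
    and pd_C2_add: "pd i (\<lambda>x. u x + v x) = (\<lambda>x. pd i u x + pd i v x)"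
    and pd_pd_add: "pd j (pd i (\<lambda>x. u x + v x)) = (\<lambda>x. pd j (pd i u) x + pd j (pd i v) x)"
proof -
  have 1: "pd i (\<lambda>x. u x + v x) = (\<lambda>x. pd i u x + pd i v x)" for i
    using assms pd_add[of u _ v i] unfolding C2_def by fastforce
  have 2: "pd j (pd i (\<lambda>x. u x + v x)) = (\<lambda>x. pd j (pd i u) x + pd j (pd i v) x)" for i j
    unfolding 1 using assms pd_add[of "pd i u" _ "pd i v" j] unfolding C2_def by fastforce
  show "C2 (\<lambda>x. u x + v x)"
    unfolding C2_def 1 2[unfolded 1] using assms unfolding C2_def by (auto intro!: continuous_intros)
  show "pd i (\<lambda>x. u x + v x) = (\<lambda>x. pd i u x + pd i v x)"
    "pd j (pd i (\<lambda>x. u x + v x)) = (\<lambda>x. pd j (pd i u) x + pd j (pd i v) x)"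
    using 1 2 by auto
qed

lemma
  assumes "C2 u"
  shows C2_cmult: "C2 (\<lambda>x. c * u x)"
    and pd_C2_cmult: "pd i (\<lambda>x. c * u x) = (\<lambda>x. c * pd i u x)"
    and pd_pd_cmult: "pd j (pd i (\<lambda>x. c * u x)) = (\<lambda>x. c * pd j (pd i u) x)"
proof -
  have 1: "pd i (\<lambda>x. c * u x) = (\<lambda>x. c * pd i u x)" for i
    using assms pd_cmult[of u _ i c] unfolding C2_def by fastforce
  have 2: "pd j (pd i (\<lambda>x. c * u x)) = (\<lambda>x. c * pd j (pd i u) x)" for i j
    unfolding 1 using assms pd_cmult[of "pd i u" _ j c] unfolding C2_def by fastforce
  show "C2 (\<lambda>x. c * u x)"
    unfolding C2_def 1 2[unfolded 1] using assms unfolding C2_def by (auto intro!: continuous_intros)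
  show "pd i (\<lambda>x. c * u x) = (\<lambda>x. c * pd i u x)"
    "pd j (pd i (\<lambda>x. c * u x)) = (\<lambda>x. c * pd j (pd i u) x)"
    using 1 2 by auto
qed

text \<open>At a maximum the Laplacian is nonpositive, so the equation bounds \<open>lam\<close>
  times the maximum from above; the lower bound is the same statement for the negative. The case
  \<open>M = 0\<close> gives uniqueness for the resolvent equation.\<close>

lemma max_principle:
  fixes v :: "real^'n::finite \<Rightarrow> real"
  assumes "lam > 0" "periodic v" "C2 v" and M: "\<And>x. \<bar>- lap v x + lam * v x\<bar> \<le> M"
  shows "\<bar>v x\<bar> \<le> M / lam"
proof -
  have upper: "w x \<le> M / lam"
    if w: "periodic w" "C2 w" "\<And>x. - lap w x + lam * w x \<le> M" for w :: "real^'n \<Rightarrow> real" and x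
  proof -
    obtain x0 where x0: "\<And>x. w x \<le> w x0"
      using periodic_attains_sup w C2_continuous by metis
    have "lap w x0 \<le> 0" unfolding lap_def
      using pd_pd_nonpos_at_max[OF w(2) x0] by (simp add: sum_nonpos)
    then have "w x0 \<le> M / lam" using w(3)[of x0] assms(1) by (simp add: field_simps)
    then show ?thesis using x0[of x] by simp
  qed
  have "v x \<le> M / lam" using upper[of v x] assms(2,3) M by (simp add: abs_le_iff)
  moreover have "- v x \<le> M / lam"
  proof (rule upper)
    show "periodic (\<lambda>x. - v x)" using assms(2) by (simp add: periodic_def)
    show "C2 (\<lambda>x. - v x)" using C2_uminus assms(3) .
    show "- lap (\<lambda>x. - v x) x + lam * - v x \<le> M" for x
      using M[of x] by (simp add: lap_def pd_pd_uminus[OF assms(3)] sum_negf)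
  qed
  ultimately show ?thesis by (simp add: abs_le_iff)
qed

section \<open>Hoelder bounds\<close>

text \<open>A relation with one constant for supremum and seminorm: no supremum has to exist, and
  sums, products and limits are estimated by arithmetic on constants.\<close>

definition hb :: "real \<Rightarrow> real \<Rightarrow> (real^'n::finite \<Rightarrow> real) \<Rightarrow> bool" where
  "hb a M w \<longleftrightarrow> (\<forall>x. \<bar>w x\<bar> \<le> M) \<and> (\<forall>x y. \<bar>w x - w y\<bar> \<le> M * dist x y powr a)"

lemma hb_nonneg: "hb a M w \<Longrightarrow> 0 \<le> M"
  unfolding hb_def by (meson abs_ge_zero order_trans)

lemma hb_mono: "hb a M w \<Longrightarrow> M \<le> M' \<Longrightarrow> hb a M' w"
  unfolding hb_def by (meson mult_right_mono order_trans powr_ge_zero)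

lemma hb_uminus: "hb a M w \<Longrightarrow> hb a M (\<lambda>x. - w x)"
  unfolding hb_def by (simp add: abs_minus_commute)

lemma hb_add: "hb a M w \<Longrightarrow> hb a M' w' \<Longrightarrow> hb a (M + M') (\<lambda>x. w x + w' x)"
  unfolding hb_def distrib_right
proof (intro conjI allI)
  fix x y
  assume *: "(\<forall>x. \<bar>w x\<bar> \<le> M) \<and> (\<forall>x y. \<bar>w x - w y\<bar> \<le> M * dist x y powr a)"
    "(\<forall>x. \<bar>w' x\<bar> \<le> M') \<and> (\<forall>x y. \<bar>w' x - w' y\<bar> \<le> M' * dist x y powr a)"
  then have "\<bar>w x\<bar> \<le> M" "\<bar>w' x\<bar> \<le> M'" "\<bar>w x - w y\<bar> \<le> M * dist x y powr a"
    "\<bar>w' x - w' y\<bar> \<le> M' * dist x y powr a" by blast+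
  then show "\<bar>w x + w' x\<bar> \<le> M + M'"
    "\<bar>w x + w' x - (w y + w' y)\<bar> \<le> M * dist x y powr a + M' * dist x y powr a"
    by linarith+
qed

lemma hb_diff: "hb a M w \<Longrightarrow> hb a M' w' \<Longrightarrow> hb a (M + M') (\<lambda>x. w x - w' x)"
  using hb_add[of a M w M' "\<lambda>x. - w' x"] hb_uminus[of a M' w'] by simp

lemma hb_cmult: "hb a M w \<Longrightarrow> hb a (\<bar>c\<bar> * M) (\<lambda>x. c * w x)"
  unfolding hb_def
  by (auto simp: abs_mult mult_left_mono mult.assoc right_diff_distrib[symmetric])

lemma hb_sum: "(\<And>i. i \<in> I \<Longrightarrow> hb a M (w i)) \<Longrightarrow> hb a (real (card I) * M) (\<lambda>x. \<Sum>i\<in>I. w i x)"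
proof (induction I rule: infinite_finite_induct)
  case (insert i I)
  then have "hb a (M + real (card I) * M) (\<lambda>x. w i x + (\<Sum>i\<in>I. w i x))"
    by (intro hb_add) auto
  then show ?case using insert by (simp add: algebra_simps)
qed (auto simp: hb_def)

lemma hb_mult:
  assumes "hb a M w" "hb a M' w'"
  shows "hb a (2 * M * M') (\<lambda>x. w x * w' x)"
proof -
  have n: "0 \<le> M" "0 \<le> M'" using assms hb_nonneg by auto
  have "\<bar>w x * w' x\<bar> \<le> 2 * M * M'" for x
  proof -
    have "\<bar>w x * w' x\<bar> \<le> M * M'"
      using assms n by (auto simp: abs_mult hb_def intro!: mult_mono)
    also have "\<dots> \<le> 2 * M * M'" using n by simp
    finally show ?thesis .
  qed
  moreover have "\<bar>w x * w' x - w y * w' y\<bar> \<le> 2 * M * M' * dist x y powr a" for x y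
  proof -
    have "w x * w' x - w y * w' y = w x * (w' x - w' y) + w' y * (w x - w y)"
      by (simp add: algebra_simps)
    then have "\<bar>w x * w' x - w y * w' y\<bar> \<le> \<bar>w x\<bar> * \<bar>w' x - w' y\<bar> + \<bar>w' y\<bar> * \<bar>w x - w y\<bar>"
      by (metis abs_mult abs_triangle_ineq)
    also have "\<dots> \<le> M * (M' * dist x y powr a) + M' * (M * dist x y powr a)"
      using assms n unfolding hb_def by (intro add_mono mult_mono) auto
    finally show ?thesis by (simp add: algebra_simps)
  qed
  ultimately show ?thesis unfolding hb_def by blast
qed

text \<open>Up to distance 1 lowering the exponent only increases the power; beyond distance 1 the
  trivial bound 2M on an increment suffices. Hence the sum 2M + K.\<close>

lemma hoelder_of_bounded_lipschitz:
  assumes "\<And>x. \<bar>w x\<bar> \<le> M" "\<bar>w x - w y\<bar> \<le> K * dist x y powr b"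
    and "0 \<le> M" "0 \<le> K" "0 \<le> a" "a \<le> b"
  shows "\<bar>w x - w y\<bar> \<le> (2 * M + K) * dist x y powr a"
proof (cases "dist x y \<le> 1")
  case True
  have "K * dist x y powr b \<le> K * dist x y powr a"
    using True assms by (intro mult_left_mono powr_mono') auto
  also have "\<dots> \<le> (2 * M + K) * dist x y powr a" using assms by (intro mult_right_mono) auto
  finally show ?thesis using assms(2) by linarith
next
  case False
  have "\<bar>w x - w y\<bar> \<le> 2 * M" using assms(1)[of x] assms(1)[of y] by linarith
  also have "\<dots> \<le> (2 * M + K) * 1" using assms by simp
  also have "\<dots> \<le> (2 * M + K) * dist x y powr a"
    using False assms by (intro mult_left_mono ge_one_powr_ge_zero) auto
  finally show ?thesis .
qed

text \<open>The factor 3 is 2 for far points plus 1 for near ones; it returns wherever \<beta> is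
  lowered to \<gamma>.\<close>

lemma hb_exponent_mono:
  assumes "hb b M w" "0 \<le> a" "a \<le> b" shows "hb a (3 * M) w"
proof -
  have M: "0 \<le> M" using assms(1) hb_nonneg by auto
  have "\<bar>w x - w y\<bar> \<le> (2 * M + M) * dist x y powr a" for x y
    using assms M by (intro hoelder_of_bounded_lipschitz[of w M x y M b]) (auto simp: hb_def)
  moreover have "\<bar>w x\<bar> \<le> 3 * M" for x
    using assms(1) M unfolding hb_def by (metis dual_order.trans mult_le_cancel_right1 one_le_numeral not_less)
  ultimately show ?thesis unfolding hb_def by simp
qed

lemma hb_of_pd_bound:
  fixes w :: "real^'n::finite \<Rightarrow> real"
  assumes "\<And>x. \<bar>w x\<bar> \<le> M" "\<And>x. w differentiable (at x)" "\<And>i x. \<bar>pd i w x\<bar> \<le> M" "0 \<le> a" "a \<le> 1"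
  shows "hb a ((2 + real CARD('n)) * M) w"
proof -
  have M: "0 \<le> M" using assms(1) by (meson abs_ge_zero order_trans)
  have "\<bar>w x - w y\<bar> \<le> (2 * M + real CARD('n) * M) * dist x y powr a" for x y
    using M assms lipschitz_of_pd_bound[of w M x y]
    by (intro hoelder_of_bounded_lipschitz[of w M x y _ 1]) auto
  moreover have "M \<le> (2 + real CARD('n)) * M"
    using mult_right_mono[OF _ M, of 1 "2 + real CARD('n)"] by simp
  ultimately show ?thesis
    unfolding hb_def using order_trans[OF assms(1)] by (simp add: distrib_right)
qed

text \<open>The increment D is split as D^(1 - b/a) times D^(b/a); the supremum bounds the first
  factor, the stronger seminorm the second. Smallness in the supremum thus becomes smallness in
  every strictly weaker Hoelder seminorm.\<close>

lemma hoelder_interpolation: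
  fixes w :: "real^'n::finite \<Rightarrow> real"
  assumes "\<And>x. \<bar>w x\<bar> \<le> S" "\<And>x y. \<bar>w x - w y\<bar> \<le> K * dist x y powr a"
    and "0 < b" "b \<le> a" "0 \<le> K"
  shows "\<bar>w x - w y\<bar> \<le> ((2 * S) powr (1 - b/a) * K powr (b/a)) * dist x y powr b"
proof (cases "w x = w y")
  case True then show ?thesis by simp
next
  case False
  define D where "D = \<bar>w x - w y\<bar>"
  have D: "D > 0" using False D_def by simp
  have th: "0 \<le> b/a" "b/a \<le> 1" using assms by auto
  have "D \<le> 2 * S" unfolding D_def using assms(1)[of x] assms(1)[of y] by linarith
  moreover have "D \<le> K * dist x y powr a" using D_def assms by auto
  ultimately have "D powr (1 - b/a) * D powr (b/a) \<le> (2 * S) powr (1 - b/a) * (K * dist x y powr a) powr (b/a)"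
    using D th by (intro mult_mono powr_mono2) auto
  also have "(K * dist x y powr a) powr (b/a) = K powr (b/a) * dist x y powr b"
    using assms by (simp add: powr_mult powr_powr)
  also have "D powr (1 - b/a) * D powr (b/a) = D" using D by (simp add: powr_add[symmetric])
  finally show ?thesis unfolding D_def by (simp add: mult.assoc)
qed

section \<open>Gaussian averages\<close>

abbreviation "ND \<equiv> std_normal_distribution"

lemma prob_space_ND: "prob_space ND"
  by (rule prob_space_normal_density) simp

lemma integrable_ND_bounded:
  fixes f :: "real \<Rightarrow> real"
  assumes "f \<in> borel_measurable borel" "\<And>z. \<bar>f z\<bar> \<le> B"
  shows "integrable ND f"
proof -
  interpret prob_space ND by (rule prob_space_ND)
  show ?thesis
    by (rule integrable_const_bound[of _ B]) (use assms in auto)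
qed

lemma integrable_ND_id: "integrable ND (\<lambda>z. z)"
  using integrable_std_normal_distribution_moment[of 1] by simp

lemma integrable_ND_square: "integrable ND (\<lambda>z. z\<^sup>2)"
  using integrable_std_normal_distribution_moment[of 2] by simp

lemma integral_ND_id: "(LINT z|ND. z) = 0"
  using integral_std_normal_distribution_moment_odd[of 1] by simp

lemma integral_ND_square: "(LINT z|ND. z\<^sup>2) = 1"
  using std_normal_distribution_even_moments(1)[of 1] by simp

lemma integral_ND_const: "(LINT z|ND. c) = (c::real)"
proof -
  interpret prob_space ND by (rule prob_space_ND)
  show ?thesis by (simp add: prob_space del: space_density)
qed

lemma integrable_ND_const: "integrable ND (\<lambda>z. c::real)"
  by (rule integrable_ND_bounded[of _ "\<bar>c\<bar>"]) auto

lemma integral_ND_one_plus_square: "(LINT z|ND. c * (1 + z\<^sup>2)) = 2 * c"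
proof -
  have "(LINT z|ND. 1 + z\<^sup>2) = (LINT z|ND. 1) + (LINT z|ND. z\<^sup>2)"
    by (rule Bochner_Integration.integral_add[OF integrable_ND_const integrable_ND_square])
  then show ?thesis using integral_ND_const[of 1] by (simp add: integral_ND_square)
qed

text \<open>Real part of the characteristic function of the standard normal law, rotated by the
  phase \<open>A\<close>.\<close>

lemma integral_ND_cos: "(LINT z|ND. cos (A + s * z)) = exp (- s\<^sup>2 / 2) * cos A"
proof -
  interpret real_distribution ND by (rule real_dist_normal_dist)
  have "cos (A + s * z) = Re (cis A * iexp (s * z))" for z
    by (simp add: cis_conv_exp[symmetric] cos_add exp_eq_polar)
  then have "(LINT z|ND. cos (A + s * z)) = (LINT z|ND. Re (cis A * iexp (s * z)))" by simp
  also have "\<dots> = Re (LINT z|ND. cis A * iexp (s * z))"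
    by (rule integral_bounded_linear[OF bounded_linear_Re]) (auto intro!: integrable_iexp)
  also have "(LINT z|ND. cis A * iexp (s * z)) = cis A * char ND s"
    by (simp add: char_def)
  finally show ?thesis by (simp add: char_std_normal_distribution)
qed

lemma integrable_ND_mult_bounded:
  fixes f :: "real \<Rightarrow> real"
  assumes "f \<in> borel_measurable borel" "\<And>z. \<bar>f z\<bar> \<le> B"
  shows "integrable ND (\<lambda>z. z * f z)"
proof (rule Bochner_Integration.integrable_bound[of _ "\<lambda>z. B * z"])
  show "integrable ND (\<lambda>z. B * z)" using integrable_ND_id by simp
  show "AE z in ND. norm (z * f z) \<le> norm (B * z)"
  proof (rule AE_I2)
    fix z
    have "\<bar>z\<bar> * \<bar>f z\<bar> \<le> \<bar>z\<bar> * \<bar>B\<bar>" using assms(2)[of z] by (intro mult_left_mono) auto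
    then show "norm (z * f z) \<le> norm (B * z)" by (simp add: abs_mult mult.commute)
  qed
qed (use assms in auto)

text \<open>Gaussian integration by parts.\<close>

lemma integral_ND_mult_sin: "(LINT z|ND. z * sin (A + s * z)) = s * exp (- s\<^sup>2 / 2) * cos A"
proof -
  let ?g = "std_normal_density"
  let ?F = "\<lambda>z. ?g z * sin (A + s * z)"
  let ?f = "\<lambda>z. ?g z * (s * cos (A + s * z) - z * sin (A + s * z))"
  have int: "integrable ND (\<lambda>z. s * cos (A + s * z) - z * sin (A + s * z))"
    by (intro Bochner_Integration.integrable_diff integrable_mult_right
        integrable_ND_bounded[of _ 1] integrable_ND_mult_bounded[of _ 1]) auto
  then have intf: "integrable lborel ?f"
    by (subst (asm) integrable_density) (auto simp: normal_density_nonneg)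
  have lim: "(?F \<longlongrightarrow> 0) at_top" "(?F \<longlongrightarrow> 0) at_bot"
  proof -
    have g: "(?g \<longlongrightarrow> 0) at_top" "(?g \<longlongrightarrow> 0) at_bot"
      unfolding std_normal_density_def by real_asymp+
    have *: "\<bar>?F z\<bar> \<le> ?g z * 1" for z
      using abs_sin_le_one[of "A + s * z"] normal_density_nonneg[of 0 1 z]
      by (simp only: abs_mult abs_of_nonneg) (intro mult_left_mono, auto)
    show "(?F \<longlongrightarrow> 0) at_top" "(?F \<longlongrightarrow> 0) at_bot"
      by (rule Lim_null_comparison[OF _ g(1)], use * in auto)
        (rule Lim_null_comparison[OF _ g(2)], use * in auto)
  qed
  have der: "(?F has_vector_derivative ?f z) (at z)" for z
  proof -
    have "(?g has_real_derivative - z * ?g z) (at z)"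
      unfolding std_normal_density_def
      by (auto intro!: derivative_eq_intros simp: field_simps)
    note g = this
    show ?thesis unfolding has_real_derivative_iff_has_vector_derivative[symmetric]
      by (rule derivative_eq_intros g | simp add: algebra_simps)+
  qed
  have "(LBINT z=-\<infinity>..\<infinity>. ?f z) = 0 - 0"
  proof (rule interval_integral_FTC_integrable)
    show "isCont ?f z" for z unfolding std_normal_density_def by (intro continuous_intros) auto
    show "set_integrable lborel (einterval (- \<infinity>) \<infinity>) ?f"
      using intf by (simp add: set_integrable_def)
    show "((?F \<circ> real_of_ereal) \<longlongrightarrow> 0) (at_right (- \<infinity>))"
      "((?F \<circ> real_of_ereal) \<longlongrightarrow> 0) (at_left \<infinity>)"
      using lim by (simp_all add: ereal_tendsto_simps)
  qed (use der in auto)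
  then have "(LINT z|lborel. ?f z) = 0"
    by (simp add: interval_lebesgue_integral_def set_lebesgue_integral_def)
  then have "(LINT z|ND. s * cos (A + s * z) - z * sin (A + s * z)) = 0"
    by (subst integral_density) (auto simp: normal_density_nonneg)
  also have "(LINT z|ND. s * cos (A + s * z) - z * sin (A + s * z)) =
      s * (LINT z|ND. cos (A + s * z)) - (LINT z|ND. z * sin (A + s * z))"
    by (subst Bochner_Integration.integral_diff)
      (auto intro!: integrable_mult_right integrable_ND_bounded[of _ 1] integrable_ND_mult_bounded[of _ 1])
  finally show ?thesis by (simp add: integral_ND_cos)
qed

lemma integral_ND_mult_cos: "(LINT z|ND. z * cos (A + s * z)) = - s * exp (- s\<^sup>2 / 2) * sin A"
proof -
  have "cos (A + s * z) = sin ((A + pi/2) + s * z)" for z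
    using sin_add[of "A + s * z" "pi/2"] by (simp add: algebra_simps)
  then show ?thesis by (simp add: integral_ND_mult_sin cos_add)
qed

section \<open>Trigonometric sums and the heat semigroup\<close>

text \<open>The list entry (c, k, p) stands for the plane wave c * cos (k \<bullet> x + p); Fourier
  multipliers and derivatives then act on the entries.\<close>

definition wave :: "(real \<times> (real^'n::finite) \<times> real) list \<Rightarrow> real^'n \<Rightarrow> real" where
  "wave L x = (\<Sum>(c,k,p)\<leftarrow>L. c * cos (k \<bullet> x + p))"

definition multiplier :: "(real^'n::finite \<Rightarrow> real) \<Rightarrow> (real \<times> (real^'n) \<times> real) list
    \<Rightarrow> (real \<times> (real^'n) \<times> real) list" where
  "multiplier g L = map (\<lambda>(c,k,p). (c * g k, k, p)) L"

text \<open>The phase shift by pi/2 turns the cosine into minus the sine, so derivatives remain sums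
  of cosines.\<close>

definition dv :: "'n::finite \<Rightarrow> (real \<times> (real^'n) \<times> real) list
    \<Rightarrow> (real \<times> (real^'n) \<times> real) list" where
  "dv i L = map (\<lambda>(c,k,p). (c * k $ i, k, p + pi/2)) L"

text \<open>The flow acts in the coordinates of \<open>J\<close> only. Adding one coordinate at a
  time reduces the d-dimensional heat kernel to one-dimensional Gaussian averages.\<close>

definition heat :: "'n::finite set \<Rightarrow> real \<Rightarrow> (real \<times> (real^'n) \<times> real) list
    \<Rightarrow> (real \<times> (real^'n) \<times> real) list" where
  "heat J t = multiplier (\<lambda>k. exp (- t * (\<Sum>j\<in>J. (k $ j)\<^sup>2)))"

definition resolvent :: "real \<Rightarrow> (real \<times> (real^'n::finite) \<times> real) list
    \<Rightarrow> (real \<times> (real^'n) \<times> real) list" where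
  "resolvent lam = multiplier (\<lambda>k. 1 / (lam + k \<bullet> k))"

lemma wave_simps [simp]:
  "wave [] x = 0" "wave ((c,k,p) # L) x = c * cos (k \<bullet> x + p) + wave L x"
  by (simp_all add: wave_def)

lemma multiplier_simps [simp]:
  "multiplier g [] = []" "multiplier g ((c,k,p) # L) = (c * g k, k, p) # multiplier g L"
  by (simp_all add: multiplier_def)

lemma dv_simps [simp]:
  "dv i [] = []" "dv i ((c,k,p) # L) = (c * k $ i, k, p + pi/2) # dv i L"
  by (simp_all add: dv_def)

lemma wave_append: "wave (L @ L') x = wave L x + wave L' x"
  by (simp add: wave_def)

lemma dv_append: "dv i (L @ L') = dv i L @ dv i L'"
  by (simp add: dv_def)

lemma multiplier_append: "multiplier g (L @ L') = multiplier g L @ multiplier g L'"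
  by (simp add: multiplier_def)

lemma multiplier_multiplier: "multiplier g (multiplier g' L) = multiplier (\<lambda>k. g k * g' k) L"
  by (induction L) (auto simp: mult_ac)

lemma dv_multiplier: "dv i (multiplier g L) = multiplier g (dv i L)"
  by (induction L) (auto simp: mult_ac)

lemma heat_insert:
  "j \<notin> J \<Longrightarrow> heat (insert j J) t L = multiplier (\<lambda>k. exp (- t * (k $ j)\<^sup>2)) (heat J t L)"
  by (simp add: heat_def multiplier_multiplier distrib_left exp_add[symmetric])

lemma heat_empty [simp]: "heat {} t L = L"
  unfolding heat_def by (induction L) auto

lemma heat_heat: "heat J t (heat J s L) = heat J (t + s) L"
  by (simp add: heat_def multiplier_multiplier exp_add[symmetric] algebra_simps)

lemma dv_heat: "dv i (heat J t L) = heat J t (dv i L)"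
  by (simp add: heat_def dv_multiplier)

lemma wave_bounded: "\<exists>B. \<forall>x. \<bar>wave L x\<bar> \<le> B"
proof (induction L)
  case (Cons a L)
  obtain c k p where a: "a = (c,k,p)" by (cases a)
  obtain B where B: "\<And>x. \<bar>wave L x\<bar> \<le> B" using Cons by blast
  have "\<bar>wave (a # L) x\<bar> \<le> \<bar>c\<bar> + B" for x
  proof -
    have "\<bar>c * cos (k \<bullet> x + p)\<bar> \<le> \<bar>c\<bar>" by (simp add: abs_mult mult_left_le)
    then show ?thesis using B[of x] unfolding a by simp
  qed
  then show ?case by blast
qed auto

lemma wave_differentiable: "wave L differentiable (at x)"
proof (induction L)
  case Nil
  have "wave [] = (\<lambda>x. 0)" by auto
  then show ?case by simp
next
  case (Cons a L)
  obtain c k p where a: "a = (c,k,p)" by (cases a)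
  have "((\<lambda>x. c * cos (k \<bullet> x + p)) has_derivative (\<lambda>h. c * (- sin (k \<bullet> x + p) * (k \<bullet> h)))) (at x)"
    by (auto intro!: derivative_eq_intros)
  then have "(\<lambda>x. c * cos (k \<bullet> x + p)) differentiable (at x)" by (auto simp: differentiable_def)
  moreover have "wave (a # L) = (\<lambda>x. c * cos (k \<bullet> x + p) + wave L x)" using a by auto
  ultimately show ?case using Cons by simp
qed

lemma pd_wave: "pd i (wave L) = wave (dv i L)"
proof (rule ext, induction L)
  case (Nil x)
  have "wave [] = (\<lambda>x. 0)" by auto
  then show ?case by (simp add: pd_has_derivative[of _ "\<lambda>h. 0"])
next
  case (Cons a L x)
  obtain c k p where a: "a = (c,k,p)" by (cases a)
  have D: "((\<lambda>x. c * cos (k \<bullet> x + p)) has_derivative (\<lambda>h. c * (- sin (k \<bullet> x + p) * (k \<bullet> h)))) (at x)"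
    by (auto intro!: derivative_eq_intros)
  then have d: "(\<lambda>x. c * cos (k \<bullet> x + p)) differentiable (at x)" by (auto simp: differentiable_def)
  have "pd i (\<lambda>x. c * cos (k \<bullet> x + p)) x = c * k $ i * cos (k \<bullet> x + (p + pi/2))"
    by (simp add: pd_has_derivative[OF D] inner_axis cos_add[of "k \<bullet> x + p" "pi/2", simplified]
        add.assoc[symmetric])
  moreover have "wave (a # L) = (\<lambda>x. c * cos (k \<bullet> x + p) + wave L x)" using a by auto
  ultimately show ?case using Cons a by (simp add: pd_add[OF d wave_differentiable])
qed

lemma wave_continuous: "continuous_on UNIV (wave L)"
  by (meson wave_differentiable continuous_at_imp_continuous_on differentiable_imp_continuous_within)

lemma C2_wave: "C2 (wave L)"
  by (simp add: C2_def pd_wave wave_differentiable wave_continuous)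

lemma lap_wave: "lap (wave L) x = - wave (multiplier (\<lambda>k. k \<bullet> k) L) x"
proof -
  have "(\<Sum>i\<in>UNIV. wave (dv i (dv i L)) x) = - wave (multiplier (\<lambda>k. k \<bullet> k) L) x"
  proof (induction L)
    case (Cons a L)
    obtain c k p where a: "a = (c,k,p)" by (cases a)
    have "k \<bullet> x + (p + pi / 2 + pi / 2) = (k \<bullet> x + p) + pi" by simp
    then have "cos (k \<bullet> x + (p + pi / 2 + pi / 2)) = - cos (k \<bullet> x + p)"
      by (simp only: cos_periodic_pi)
    then have "wave (dv i (dv i (a # L))) x = - (c * cos (k \<bullet> x + p)) * (k $ i * k $ i) + wave (dv i (dv i L)) x" for i
      by (simp add: a)
    then have "(\<Sum>i\<in>UNIV. wave (dv i (dv i (a # L))) x) =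
        - (c * cos (k \<bullet> x + p)) * (\<Sum>i\<in>UNIV. k $ i * k $ i) + (\<Sum>i\<in>UNIV. wave (dv i (dv i L)) x)"
      by (simp only: sum.distrib sum_distrib_left)
    then show ?case using Cons by (simp add: a inner_vec_def[of k k])
  qed simp
  then show ?thesis by (simp add: lap_def pd_wave)
qed

lemma resolvent_solves:
  assumes "lam > 0"
  shows "- lap (wave (resolvent lam L)) x + lam * wave (resolvent lam L) x = wave L x"
proof -
  have "wave (multiplier (\<lambda>k. k \<bullet> k) (resolvent lam L)) x + lam * wave (resolvent lam L) x = wave L x"
    unfolding resolvent_def multiplier_multiplier
  proof (induction L)
    case (Cons a L)
    obtain c k p where a: "a = (c,k,p)" by (cases a)
    have "lam + k \<bullet> k \<noteq> 0" using assms inner_ge_zero[of k] by linarith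
    then have "c = c * ((lam + k \<bullet> k) * (1 / (lam + k \<bullet> k)))" by simp
    also have "\<dots> = c * (k \<bullet> k * (1 / (lam + k \<bullet> k))) + lam * (c * (1 / (lam + k \<bullet> k)))"
      by (simp only: algebra_simps)
    finally have "c * (k \<bullet> k * (1 / (lam + k \<bullet> k))) + lam * (c * (1 / (lam + k \<bullet> k))) = c" ..
    then have "c * (k \<bullet> k * (1 / (lam + k \<bullet> k))) * X + lam * (c * (1 / (lam + k \<bullet> k)) * X) = c * X" for X
      by (metis (no_types, lifting) distrib_right mult.assoc)
    from this[of "cos (k \<bullet> x + p)"] Cons show ?case
      unfolding a multiplier_simps wave_simps distrib_left by linarith
  qed simp
  then show ?thesis by (simp add: lap_wave)
qed

section \<open>The heat flow as Gaussian averaging, and its derivative bounds\<close>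

lemma wave_line_measurable: "(\<lambda>z. wave L (x + (s * z) *\<^sub>R axis j 1)) \<in> borel_measurable borel"
  by (intro borel_measurable_continuous_onI continuous_on_compose2[OF wave_continuous] continuous_intros) auto

lemma integrable_ND_wave: "integrable ND (\<lambda>z. wave L (x + (s * z) *\<^sub>R axis j 1))"
  and integrable_ND_mult_wave: "integrable ND (\<lambda>z. z * wave L (x + (s * z) *\<^sub>R axis j 1))"
proof -
  obtain B where B: "\<And>x. \<bar>wave L x\<bar> \<le> B" using wave_bounded by blast
  show "integrable ND (\<lambda>z. wave L (x + (s * z) *\<^sub>R axis j 1))"
    by (rule integrable_ND_bounded[OF wave_line_measurable B])
  show "integrable ND (\<lambda>z. z * wave L (x + (s * z) *\<^sub>R axis j 1))"
    by (rule integrable_ND_mult_bounded[OF wave_line_measurable B])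
qed

text \<open>A step \<open>sqrt (2 * t) * z\<close> has variance 2t, and the characteristic function
  at \<open>sqrt (2 * t) * k $ j\<close> is exactly the heat multiplier of coordinate j.\<close>

lemma heat_average:
  assumes "0 \<le> t"
  shows "wave (multiplier (\<lambda>k. exp (- t * (k $ j)\<^sup>2)) L) x
      = (LINT z|ND. wave L (x + (sqrt (2 * t) * z) *\<^sub>R axis j 1))"
proof (induction L)
  case (Cons a L)
  obtain c k p where a: "a = (c,k,p)" by (cases a)
  let ?s = "sqrt (2 * t)"
  have eq: "k \<bullet> (x + (?s * z) *\<^sub>R axis j 1) + p = (k \<bullet> x + p) + (?s * k $ j) * z" for z
    by (simp add: inner_add_right inner_axis)
  have "(LINT z|ND. wave (a # L) (x + (?s * z) *\<^sub>R axis j 1)) =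
    (LINT z|ND. c * cos ((k \<bullet> x + p) + (?s * k $ j) * z)) + (LINT z|ND. wave L (x + (?s * z) *\<^sub>R axis j 1))"
    unfolding a wave_simps eq
    by (intro Bochner_Integration.integral_add integrable_mult_right integrable_ND_wave
        integrable_ND_bounded[of _ 1]) auto
  also have "(LINT z|ND. c * cos ((k \<bullet> x + p) + (?s * k $ j) * z)) =
      c * (exp (- (?s * k $ j)\<^sup>2 / 2) * cos (k \<bullet> x + p))"
    by (simp add: integral_ND_cos)
  also have "- (?s * k $ j)\<^sup>2 / 2 = - t * (k $ j)\<^sup>2"
    using assms by (simp add: power_mult_distrib)
  finally show ?case using Cons a by simp
qed simp

text \<open>Integration by parts moves the derivative from the sum to the Gaussian weight: the
  right-hand side contains no derivative of \<open>L\<close>, at the price of a factor 1 / sqrt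
  (2t).\<close>

lemma heat_gradient_average:
  assumes "0 < t"
  shows "wave (dv j (multiplier (\<lambda>k. exp (- t * (k $ j)\<^sup>2)) L)) x
      = (LINT z|ND. z * wave L (x + (sqrt (2 * t) * z) *\<^sub>R axis j 1)) / sqrt (2 * t)"
proof (induction L)
  case (Cons a L)
  obtain c k p where a: "a = (c,k,p)" by (cases a)
  let ?s = "sqrt (2 * t)"
  have s: "?s \<noteq> 0" using assms by simp
  have eq: "k \<bullet> (x + (?s * z) *\<^sub>R axis j 1) + p = (k \<bullet> x + p) + (?s * k $ j) * z" for z
    by (simp add: inner_add_right inner_axis)
  have "(LINT z|ND. z * wave (a # L) (x + (?s * z) *\<^sub>R axis j 1)) =
    (LINT z|ND. c * (z * cos ((k \<bullet> x + p) + (?s * k $ j) * z)) + z * wave L (x + (?s * z) *\<^sub>R axis j 1))"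
    unfolding a wave_simps eq by (simp add: algebra_simps)
  also have "\<dots> =
    (LINT z|ND. c * (z * cos ((k \<bullet> x + p) + (?s * k $ j) * z))) + (LINT z|ND. z * wave L (x + (?s * z) *\<^sub>R axis j 1))"
    by (intro Bochner_Integration.integral_add integrable_mult_right integrable_ND_mult_wave
        integrable_ND_mult_bounded[of _ 1]) auto
  also have "(LINT z|ND. c * (z * cos ((k \<bullet> x + p) + (?s * k $ j) * z))) =
      ?s * (c * k $ j * exp (- (?s * k $ j)\<^sup>2 / 2) * (- sin (k \<bullet> x + p)))"
    by (simp add: integral_ND_mult_cos)
  also have "- (?s * k $ j)\<^sup>2 / 2 = - t * (k $ j)\<^sup>2"
    using assms by (simp add: power_mult_distrib)
  also have "- sin (k \<bullet> x + p) = cos (k \<bullet> x + (p + pi/2))"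
    by (simp add: cos_add[of "k \<bullet> x + p" "pi/2", simplified] add.assoc[symmetric])
  finally show ?case using Cons a s by (simp add: add_divide_distrib)
qed simp

lemma abs_integral_ND_le:
  fixes f g :: "real \<Rightarrow> real"
  assumes "integrable ND f" "integrable ND g" "\<And>z. \<bar>f z\<bar> \<le> g z"
  shows "\<bar>LINT z|ND. f z\<bar> \<le> (LINT z|ND. g z)"
  using Bochner_Integration.integral_norm_bound_integral[of ND f g] assms by simp

text \<open>Averages commute with translations and do not enlarge uniform bounds. With \<theta> = 1
  this says that the flow preserves any modulus of continuity.\<close>

lemma heat_contraction:
  assumes "0 \<le> t" "\<And>x. \<bar>wave L (x + h) - \<theta> * wave L x\<bar> \<le> M"
  shows "\<bar>wave (heat J t L) (x + h) - \<theta> * wave (heat J t L) x\<bar> \<le> M"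
proof (induction J arbitrary: x rule: infinite_finite_induct)
  case (insert j J)
  let ?s = "sqrt (2 * t)"
  have eq: "wave (heat (insert j J) t L) (x + h) - \<theta> * wave (heat (insert j J) t L) x =
     (LINT z|ND. wave (heat J t L) ((x + h) + (?s * z) *\<^sub>R axis j 1) - \<theta> * wave (heat J t L) (x + (?s * z) *\<^sub>R axis j 1))"
    unfolding heat_insert[OF insert.hyps(2)] heat_average[OF assms(1)]
    by (subst Bochner_Integration.integral_diff)
      (auto intro!: integrable_ND_wave integrable_mult_right)
  have "\<bar>LINT z|ND. wave (heat J t L) ((x + h) + (?s * z) *\<^sub>R axis j 1) - \<theta> * wave (heat J t L) (x + (?s * z) *\<^sub>R axis j 1)\<bar>
      \<le> (LINT z|ND. M)"
  proof (rule abs_integral_ND_le)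
    show "\<bar>wave (heat J t L) ((x + h) + (?s * z) *\<^sub>R axis j 1) - \<theta> * wave (heat J t L) (x + (?s * z) *\<^sub>R axis j 1)\<bar> \<le> M" for z
      using insert.IH[of "x + (?s * z) *\<^sub>R axis j 1"] by (simp add: add_ac)
  qed (auto intro!: integrable_ND_wave integrable_mult_right Bochner_Integration.integrable_diff integrable_ND_const)
  then show ?case unfolding eq integral_ND_const .
qed (use assms in auto)

text \<open>A common polynomial majorant for the Gaussian moments below; its average is 2, so no
  fractional moment has to be computed.\<close>

lemma abs_powr_le_one_plus_square:
  fixes z a :: real
  assumes "0 \<le> a" "a \<le> 1"
  shows "\<bar>z\<bar> powr a \<le> 1 + z\<^sup>2" "\<bar>z\<bar> * \<bar>z\<bar> powr a \<le> 1 + z\<^sup>2" "\<bar>z\<bar> \<le> 1 + z\<^sup>2"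
proof -
  show 1: "\<bar>z\<bar> \<le> 1 + z\<^sup>2"
    using zero_le_power2[of "\<bar>z\<bar> - 1"] by (simp add: power2_diff)
  have *: "\<bar>z\<bar> powr a \<le> 1 \<or> \<bar>z\<bar> powr a \<le> \<bar>z\<bar> \<and> 1 \<le> \<bar>z\<bar>"
  proof (cases "\<bar>z\<bar> \<le> 1")
    case True then show ?thesis using assms by (simp add: powr_le1)
  next
    case False then show ?thesis using powr_mono[of a 1 "\<bar>z\<bar>"] assms by auto
  qed
  then show "\<bar>z\<bar> powr a \<le> 1 + z\<^sup>2" using 1 by (auto intro: order_trans)
  from * show "\<bar>z\<bar> * \<bar>z\<bar> powr a \<le> 1 + z\<^sup>2"
  proof
    assume "\<bar>z\<bar> powr a \<le> 1"
    then have "\<bar>z\<bar> * \<bar>z\<bar> powr a \<le> \<bar>z\<bar> * 1" by (intro mult_left_mono) auto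
    then show ?thesis using 1 by linarith
  next
    assume "\<bar>z\<bar> powr a \<le> \<bar>z\<bar> \<and> 1 \<le> \<bar>z\<bar>"
    then have "\<bar>z\<bar> * \<bar>z\<bar> powr a \<le> \<bar>z\<bar> * \<bar>z\<bar>" by (intro mult_left_mono) auto
    then show ?thesis by (simp add: power2_eq_square)
  qed
qed

text \<open>The tolerance \<open>e\<close> makes one lemma serve two purposes: with
  \<open>K = 0\<close> it treats functions that are merely bounded, which allows iteration, and with
  both terms it treats an approximation of a Hoelder function. The factor 2 is the average of 1 +
  z^2.\<close>

lemma heat_gradient_bound:
  assumes "0 < t" "0 \<le> a" "a \<le> 1" "0 \<le> e" "0 \<le> K"
    and osc: "\<And>x h. \<bar>wave L (x + h) - wave L x\<bar> \<le> e + K * norm h powr a"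
  shows "\<bar>wave (dv i (heat UNIV t L)) x\<bar> \<le> 2 * (e + K * sqrt (2 * t) powr a) / sqrt (2 * t)"
proof -
  let ?s = "sqrt (2 * t)" and ?L = "heat (UNIV - {i}) t L"
  have s: "?s > 0" using assms by simp
  have osc': "\<bar>wave ?L (x + h) - wave ?L x\<bar> \<le> e + K * norm h powr a" for x h
    using heat_contraction[of t L h 1 "e + K * norm h powr a" "UNIV - {i}" x] assms(1) osc by simp
  \<comment> \<open>Only coordinate \<open>i\<close> smooths; the flow in the remaining coordinates
    merely has to keep the oscillation bound.\<close>
  have eq: "heat UNIV t L = multiplier (\<lambda>k. exp (- t * (k $ i)\<^sup>2)) ?L"
    using heat_insert[of i "UNIV - {i}" t L] by (simp add: insert_absorb)
  let ?f = "\<lambda>z. z * wave ?L (x + (?s * z) *\<^sub>R axis i 1)"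
  \<comment> \<open>Since z has mean zero, the value at \<open>x\<close> may be subtracted, and only
    increments remain under the integral.\<close>
  have eq1: "(LINT z|ND. ?f z) = (LINT z|ND. ?f z - wave ?L x * z)"
    by (subst Bochner_Integration.integral_diff)
      (auto intro!: integrable_ND_mult_wave integrable_mult_right integrable_ND_id simp: integral_ND_id)
  have le: "\<bar>LINT z|ND. ?f z - wave ?L x * z\<bar> \<le> (LINT z|ND. (e + K * ?s powr a) * (1 + z\<^sup>2))"
  proof (rule abs_integral_ND_le)
    show "integrable ND (\<lambda>z. ?f z - wave ?L x * z)"
      by (auto intro!: integrable_ND_mult_wave integrable_mult_right integrable_ND_id
          Bochner_Integration.integrable_diff)
    show "integrable ND (\<lambda>z. (e + K * ?s powr a) * (1 + z\<^sup>2))"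
      by (intro integrable_mult_right Bochner_Integration.integrable_add integrable_ND_const integrable_ND_square)
    fix z
    have "?f z - wave ?L x * z = z * (wave ?L (x + (?s * z) *\<^sub>R axis i 1) - wave ?L x)"
      by (simp add: algebra_simps)
    then have "\<bar>?f z - wave ?L x * z\<bar> = \<bar>z\<bar> * \<bar>wave ?L (x + (?s * z) *\<^sub>R axis i 1) - wave ?L x\<bar>"
      by (simp add: abs_mult)
    also have "\<dots> \<le> \<bar>z\<bar> * (e + K * norm ((?s * z) *\<^sub>R axis i 1 :: real^'a) powr a)"
      by (intro mult_left_mono osc') auto
    also have "norm ((?s * z) *\<^sub>R axis i 1 :: real^'a) powr a = ?s powr a * \<bar>z\<bar> powr a"
      using s by (simp add: abs_mult powr_mult)
    also have "\<bar>z\<bar> * (e + K * (?s powr a * \<bar>z\<bar> powr a)) = e * \<bar>z\<bar> + K * ?s powr a * (\<bar>z\<bar> * \<bar>z\<bar> powr a)"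
      by (simp add: algebra_simps)
    also have "\<dots> \<le> e * (1 + z\<^sup>2) + K * ?s powr a * (1 + z\<^sup>2)"
      using assms abs_powr_le_one_plus_square[OF assms(2,3), of z]
      by (intro add_mono mult_left_mono) auto
    finally show "\<bar>?f z - wave ?L x * z\<bar> \<le> (e + K * ?s powr a) * (1 + z\<^sup>2)"
      by (simp add: algebra_simps)
  qed
  have "\<bar>LINT z|ND. ?f z\<bar> \<le> 2 * (e + K * ?s powr a)"
    using le unfolding eq1 integral_ND_one_plus_square .
  then show ?thesis
    unfolding eq heat_gradient_average[OF assms(1)] using s by (simp add: divide_right_mono)
qed

text \<open>One coordinate is averaged at each step, while those already treated keep the modulus of
  continuity; the equal costs add up to the factor \<open>card J\<close>.\<close>

lemma heat_near_identity:
  assumes "0 < t" "0 \<le> a" "a \<le> 1" "0 \<le> e" "0 \<le> K"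
    and osc: "\<And>x h. \<bar>wave L (x + h) - wave L x\<bar> \<le> e + K * norm h powr a"
  shows "\<bar>wave (heat J t L) x - wave L x\<bar> \<le> real (card J) * (2 * (e + K * sqrt (2 * t) powr a))"
proof (induction J rule: infinite_finite_induct)
  case (insert j J)
  let ?s = "sqrt (2 * t)" and ?L = "heat J t L"
  have s: "?s > 0" using assms by simp
  have osc': "\<bar>wave ?L (x + h) - wave ?L x\<bar> \<le> e + K * norm h powr a" for x h
    using heat_contraction[of t L h 1 "e + K * norm h powr a" J x] assms(1) osc by simp
  have eq1: "wave (heat (insert j J) t L) x - wave ?L x = (LINT z|ND. wave ?L (x + (?s * z) *\<^sub>R axis j 1) - wave ?L x)"
    unfolding heat_insert[OF insert.hyps(2)] heat_average[OF less_imp_le[OF assms(1)]]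
    by (subst Bochner_Integration.integral_diff)
      (auto intro!: integrable_ND_wave integrable_ND_const simp: integral_ND_const simp del: lebesgue_integral_const)
  have le: "\<bar>LINT z|ND. wave ?L (x + (?s * z) *\<^sub>R axis j 1) - wave ?L x\<bar> \<le> (LINT z|ND. (e + K * ?s powr a) * (1 + z\<^sup>2))"
  proof (rule abs_integral_ND_le)
    show "integrable ND (\<lambda>z. (e + K * ?s powr a) * (1 + z\<^sup>2))"
      by (intro integrable_mult_right Bochner_Integration.integrable_add integrable_ND_const integrable_ND_square)
    fix z
    have "\<bar>wave ?L (x + (?s * z) *\<^sub>R axis j 1) - wave ?L x\<bar> \<le> e + K * norm ((?s * z) *\<^sub>R axis j 1 :: real^'a) powr a"
      by (rule osc')
    also have "norm ((?s * z) *\<^sub>R axis j 1 :: real^'a) powr a = ?s powr a * \<bar>z\<bar> powr a"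
      using s by (simp add: abs_mult powr_mult)
    also have "e + K * (?s powr a * \<bar>z\<bar> powr a) = e * 1 + K * ?s powr a * (\<bar>z\<bar> powr a)"
      by (simp add: algebra_simps)
    also have "\<dots> \<le> e * (1 + z\<^sup>2) + K * ?s powr a * (1 + z\<^sup>2)"
      using assms abs_powr_le_one_plus_square[OF assms(2,3), of z]
      by (intro add_mono mult_left_mono) auto
    finally show "\<bar>wave ?L (x + (?s * z) *\<^sub>R axis j 1) - wave ?L x\<bar> \<le> (e + K * ?s powr a) * (1 + z\<^sup>2)"
      by (simp add: algebra_simps)
  qed (auto intro!: integrable_ND_wave integrable_ND_const Bochner_Integration.integrable_diff)
  have "\<bar>wave (heat (insert j J) t L) x - wave ?L x\<bar> \<le> 2 * (e + K * ?s powr a)"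
    using le unfolding eq1[symmetric] integral_ND_one_plus_square .
  then show ?case using insert by (simp add: algebra_simps)
qed auto

text \<open>Each derivative gets half of the time. After time t/2 the first derivative is bounded,
  hence oscillates by at most twice its bound, and the gradient bound applies again without a
  Hoelder term. The resulting power of t is integrable at 0 when a > 0.\<close>

lemma heat_second_derivative_bound:
  assumes "0 < t" "0 \<le> a" "a \<le> 1" "0 \<le> K"
    and osc: "\<And>x h. \<bar>wave L (x + h) - wave L x\<bar> \<le> K * norm h powr a"
  shows "\<bar>wave (dv j (dv i (heat UNIV t L))) x\<bar> \<le> 8 * K * t powr (a/2 - 1)"
proof -
  define B where "B = 2 * (K * sqrt t powr a) / sqrt t"
  have B0: "B \<ge> 0" using assms unfolding B_def by simp
  let ?L = "dv i (heat UNIV (t/2) L)"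
  have B: "\<bar>wave ?L x\<bar> \<le> B" for x
    using heat_gradient_bound[of "t/2" a 0 K L i x] assms unfolding B_def by simp
  have "\<bar>wave ?L (x + h) - wave ?L x\<bar> \<le> 2 * B + 0 * norm h powr a" for x h
    using B[of x] B[of "x + h"] by simp
  then have "\<bar>wave (dv j (heat UNIV (t/2) ?L)) x\<bar> \<le> 2 * (2 * B) / sqrt t"
    using heat_gradient_bound[of "t/2" a "2 * B" 0 ?L j x] assms B0 by simp
  also have "heat UNIV (t/2) ?L = dv i (heat UNIV t L)"
    by (simp add: dv_heat heat_heat)
  also have "2 * (2 * B) / sqrt t = 8 * K * (sqrt t powr a / (sqrt t * sqrt t))"
    by (simp add: B_def)
  also have "sqrt t powr a / (sqrt t * sqrt t) = t powr (a/2 - 1)"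
  proof -
    have "sqrt t * sqrt t = t" using assms by simp
    moreover have "sqrt t powr a = t powr (a/2)"
      using assms by (simp add: powr_half_sqrt[symmetric] powr_powr)
    ultimately show ?thesis using assms by (simp add: powr_diff)
  qed
  finally show ?thesis .
qed

text \<open>Time is halved once more: 4 * 8 = 32 is multiplied by 2^(1 - a/2) <= 2, the price of
  evaluating the previous bound at t/2. For a < 1 the power of t is integrable at infinity.\<close>

lemma heat_third_derivative_bound:
  assumes "0 < t" "0 \<le> a" "a \<le> 1" "0 \<le> K"
    and osc: "\<And>x h. \<bar>wave L (x + h) - wave L x\<bar> \<le> K * norm h powr a"
  shows "\<bar>wave (dv l (dv j (dv i (heat UNIV t L)))) x\<bar> \<le> 64 * K * t powr (a/2 - 3/2)"
proof -
  define B where "B = 8 * K * (t/2) powr (a/2 - 1)"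
  have B0: "B \<ge> 0" using assms unfolding B_def by simp
  let ?L = "dv j (dv i (heat UNIV (t/2) L))"
  have B: "\<bar>wave ?L x\<bar> \<le> B" for x
    using heat_second_derivative_bound[of "t/2" a K L j i x] assms unfolding B_def by simp
  have "\<bar>wave ?L (x + h) - wave ?L x\<bar> \<le> 2 * B + 0 * norm h powr a" for x h
    using B[of x] B[of "x + h"] by simp
  then have "\<bar>wave (dv l (heat UNIV (t/2) ?L)) x\<bar> \<le> 2 * (2 * B) / sqrt t"
    using heat_gradient_bound[of "t/2" a "2 * B" 0 ?L l x] assms B0 by simp
  also have "heat UNIV (t/2) ?L = dv j (dv i (heat UNIV t L))"
    by (simp add: dv_heat heat_heat)
  also have "2 * (2 * B) / sqrt t = 32 * K * ((t/2) powr (a/2 - 1) / sqrt t)"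
    by (simp add: B_def)
  also have "(t/2) powr (a/2 - 1) / sqrt t = 2 powr (1 - a/2) * t powr (a/2 - 3/2)"
  proof -
    have "(t/2) powr (a/2 - 1) = t powr (a/2 - 1) / 2 powr (a/2 - 1)"
      using assms by (simp add: powr_divide)
    also have "\<dots> = t powr (a/2 - 1) * 2 powr (1 - a/2)"
      using powr_minus_divide[of "2::real" "a/2 - 1"] by simp
    finally have "(t/2) powr (a/2 - 1) / sqrt t = 2 powr (1 - a/2) * (t powr (a/2 - 1) / t powr (1/2))"
      using assms by (simp add: powr_half_sqrt)
    also have "t powr (a/2 - 1) / t powr (1/2) = t powr (a/2 - 3/2)"
      by (simp add: powr_diff[symmetric])
    finally show ?thesis .
  qed
  also have "32 * K * (2 powr (1 - a/2) * t powr (a/2 - 3/2)) \<le> 32 * K * (2 * t powr (a/2 - 3/2))"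
    using assms powr_mono[of "1 - a/2" 1 2] by (intro mult_left_mono mult_right_mono) auto
  finally show ?thesis by simp
qed

text \<open>Entry by entry this is the elementary Laplace transform of an exponential. For a finite
  sum nothing is singular at t = 0; singularities appear only in bounds that are uniform in the
  sum.\<close>

lemma resolvent_second_derivative_integral:
  assumes "lam > 0"
  shows "((\<lambda>t. exp (- lam * t) * wave (dv j (dv i (heat UNIV t L))) x)
      has_integral wave (dv j (dv i (resolvent lam L))) x) {0..}"
proof (induction L)
  case (Cons b L)
  obtain c k p where b: "b = (c,k,p)" by (cases b)
  let ?C = "c * k $ i * k $ j * cos (k \<bullet> x + (p + pi/2 + pi/2))"
  have pos: "lam + k \<bullet> k > 0" using assms inner_ge_zero[of k] by linarith
  have kk: "(\<Sum>j\<in>UNIV. (k $ j)\<^sup>2) = k \<bullet> k" by (simp add: inner_vec_def power2_eq_square)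
  have e: "exp (- lam * t) * exp (- t * (k \<bullet> k)) = exp (- (lam + k \<bullet> k) * t)" for t
    by (simp add: exp_add[symmetric] algebra_simps)
  have "((\<lambda>t. ?C * exp (- (lam + k \<bullet> k) * t)) has_integral ?C * (exp (- (lam + k \<bullet> k) * 0) / (lam + k \<bullet> k))) {0..}"
    by (intro has_integral_mult_right has_integral_exp_minus_to_infinity pos)
  then have "((\<lambda>t. ?C * exp (- (lam + k \<bullet> k) * t) + exp (- lam * t) * wave (dv j (dv i (heat UNIV t L))) x) has_integral
     ?C * (1 / (lam + k \<bullet> k)) + wave (dv j (dv i (resolvent lam L))) x) {0..}"
    using Cons by (intro has_integral_add) auto
  moreover have "?C * exp (- (lam + k \<bullet> k) * t) + exp (- lam * t) * wave (dv j (dv i (heat UNIV t L))) x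
      = exp (- lam * t) * wave (dv j (dv i (heat UNIV t (b # L)))) x" for t
    unfolding e[symmetric] by (simp add: b heat_def kk distrib_left mult_ac)
  moreover have "?C * (1 / (lam + k \<bullet> k)) + wave (dv j (dv i (resolvent lam L))) x
      = wave (dv j (dv i (resolvent lam (b # L)))) x"
    by (simp add: b resolvent_def mult_ac)
  ultimately show ?case by simp
qed (simp add: heat_def resolvent_def)

section \<open>Schauder estimate for trigonometric sums\<close>

lemma square_powr: "0 \<le> (h::real) \<Longrightarrow> (h\<^sup>2) powr b = h powr (2 * b)"
  by (cases "h = 0") (simp_all flip: powr_numeral add: powr_powr)

text \<open>The two summands are the integrals of the majorants before and after the splitting time:
  16 / (a/2) and 64 d / ((1 - a)/2).\<close>

definition schauder_const :: "nat \<Rightarrow> real \<Rightarrow> real" where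
  "schauder_const d a = 32 / a + 128 * real d / (1 - a)"

text \<open>The time integral is split at the square of the distance: below it the second
  derivatives are estimated separately at the two points, above it by the third derivative.\<close>

lemma schauder_trig:
  fixes L :: "(real \<times> (real^'n::finite) \<times> real) list"
  assumes "lam > 0" "0 < a" "a < 1" "0 \<le> K"
    and osc: "\<And>x h. \<bar>wave L (x + h) - wave L x\<bar> \<le> K * norm h powr a"
  shows "\<bar>wave (dv j (dv i (resolvent lam L))) x - wave (dv j (dv i (resolvent lam L))) y\<bar>
      \<le> schauder_const CARD('n) a * K * dist x y powr a"
proof (cases "x = y")
  case False
  define h where "h = dist x y"
  have h: "h > 0" using False h_def by simp
  let ?n = "real CARD('n)"
  let ?w = "\<lambda>t. wave (dv j (dv i (heat UNIV t L)))"
  define f where "f t = exp (- lam * t) * ?w t x - exp (- lam * t) * ?w t y" for t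
  \<comment> \<open>16 is the 8 of the second-derivative bound once for each point. In
    \<open>b2\<close> the third-derivative constant 64 meets the factor d of the Lipschitz
    estimate.\<close>
  define b1 where "b1 t = 16 * K * t powr (a/2 - 1)" for t
  define b2 where "b2 t = ?n * (64 * K) * h * t powr (a/2 - 3/2)" for t
  define b where "b t = (if t \<le> h\<^sup>2 then b1 t else b2 t)" for t
  have f: "(f has_integral (wave (dv j (dv i (resolvent lam L))) x - wave (dv j (dv i (resolvent lam L))) y)) {0..}"
    unfolding f_def by (intro has_integral_diff resolvent_second_derivative_integral assms)
  have "(b1 has_integral 16 * K * ((h\<^sup>2) powr (a/2 - 1 + 1) / (a/2 - 1 + 1))) {0..h\<^sup>2}"
    unfolding b1_def using assms by (intro has_integral_mult_right has_integral_powr_from_0) auto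
  then have "(b has_integral 16 * K * ((h\<^sup>2) powr (a/2) / (a/2))) {0..h\<^sup>2}"
    by (subst has_integral_cong[where g = b1]) (auto simp: b_def)
  moreover have "(b2 has_integral ?n * (64 * K) * h * (- ((h\<^sup>2) powr (a/2 - 3/2 + 1)) / (a/2 - 3/2 + 1))) {h\<^sup>2..}"
    unfolding b2_def using assms h by (intro has_integral_mult_right has_integral_powr_to_inf) auto
  \<comment> \<open>At the splitting time itself \<open>b\<close> follows its first branch, so
    \<open>b\<close> and \<open>b2\<close> may differ at that single point.\<close>
  then have "(b has_integral ?n * (64 * K) * h * (- ((h\<^sup>2) powr (a/2 - 1/2)) / (a/2 - 1/2))) {h\<^sup>2..}"
    by (subst has_integral_spike_finite_eq[where S = "{h\<^sup>2}" and f = b2 and g = b, symmetric]) (auto simp: b_def)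
  ultimately have "(b has_integral 16 * K * ((h\<^sup>2) powr (a/2) / (a/2)) +
      ?n * (64 * K) * h * (- ((h\<^sup>2) powr (a/2 - 1/2)) / (a/2 - 1/2))) ({0..h\<^sup>2} \<union> {h\<^sup>2..})"
  proof (rule has_integral_Un)
    have "{0..h\<^sup>2} \<inter> {h\<^sup>2..} = {h\<^sup>2}" by auto
    then show "negligible ({0..h\<^sup>2} \<inter> {h\<^sup>2..})" by simp
  qed
  moreover have "{0..h\<^sup>2} \<union> {h\<^sup>2..} = {0..}" by (auto intro: order_trans[of 0 "h\<^sup>2"])
  ultimately have bi: "(b has_integral 16 * K * ((h\<^sup>2) powr (a/2) / (a/2)) +
      ?n * (64 * K) * h * (- ((h\<^sup>2) powr (a/2 - 1/2)) / (a/2 - 1/2))) {0..}" by simp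
  have p1: "(h\<^sup>2) powr (a/2) = h powr a" using h by (simp add: square_powr)
  have p2: "h * (h\<^sup>2) powr (a/2 - 1/2) = h powr a"
  proof -
    have "h * (h\<^sup>2) powr (a/2 - 1/2) = h powr 1 * h powr (a - 1)"
      using h by (simp add: square_powr algebra_simps)
    also have "\<dots> = h powr a" by (simp only: powr_add[symmetric]) simp
    finally show ?thesis .
  qed
  have "16 * K * ((h\<^sup>2) powr (a/2) / (a/2)) +
      ?n * (64 * K) * h * (- ((h\<^sup>2) powr (a/2 - 1/2)) / (a/2 - 1/2)) =
      16 * K * ((h\<^sup>2) powr (a/2) / (a/2)) + ?n * (64 * K) * (- (h * (h\<^sup>2) powr (a/2 - 1/2)) / (a/2 - 1/2))"
    by (simp add: algebra_simps)
  also have "\<dots> = 16 * K * (h powr a / (a/2)) + ?n * (64 * K) * (- (h powr a) / (a/2 - 1/2))"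
    unfolding p1 p2 ..
  also have "\<dots> = schauder_const CARD('n) a * K * h powr a"
    using assms unfolding schauder_const_def by (simp add: field_simps)
  finally have B: "(b has_integral schauder_const CARD('n) a * K * h powr a) {0..}"
    using bi by simp
  have bound: "norm (f t) \<le> b t" if t: "t > 0" for t
  proof -
    have e: "exp (- lam * t) \<le> 1" "0 \<le> exp (- lam * t)" using assms t by auto
    have ft: "norm (f t) \<le> \<bar>?w t x - ?w t y\<bar>"
      unfolding f_def right_diff_distrib[symmetric] using e
      by (simp only: real_norm_def abs_mult) (simp add: mult_left_le_one_le)
    have w: "\<bar>?w t z\<bar> \<le> 8 * K * t powr (a/2 - 1)" for z
      by (rule heat_second_derivative_bound[OF t _ _ _ osc]) (use assms in auto)
    have w': "\<bar>pd l (?w t) z\<bar> \<le> 64 * K * t powr (a/2 - 3/2)" for l z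
      unfolding pd_wave by (rule heat_third_derivative_bound[OF t _ _ _ osc]) (use assms in auto)
    show ?thesis
    proof (cases "t \<le> h\<^sup>2")
      case True
      then show ?thesis using ft w[of x] w[of y] unfolding b_def b1_def by simp
    next
      case False
      have "\<bar>?w t x - ?w t y\<bar> \<le> ?n * (64 * K * t powr (a/2 - 3/2)) * dist x y"
        by (rule lipschitz_of_pd_bound[OF wave_differentiable w'])
      then show ?thesis using False ft unfolding b_def b2_def h_def by (simp add: mult_ac)
    qed
  qed
  \<comment> \<open>At t = 0 the majorant is 0, because 0 \<open>powr\<close> any exponent is 0; the
    integrand is changed there to respect it.\<close>
  define f0 where "f0 t = (if t = 0 then 0 else f t)" for t
  have f0: "(f0 has_integral (wave (dv j (dv i (resolvent lam L))) x - wave (dv j (dv i (resolvent lam L))) y)) {0..}"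
    by (rule has_integral_spike_finite[OF _ _ f, of "{0}"]) (auto simp: f0_def)
  have "norm (integral {0..} f0) \<le> integral {0..} b"
  proof (rule integral_norm_bound_integral)
    show "norm (f0 t) \<le> b t" if "t \<in> {0..}" for t
      using that bound[of t] by (auto simp: f0_def b_def b1_def)
  qed (use f0 B in auto)
  then show ?thesis using integral_unique[OF f0] integral_unique[OF B] by (simp add: h_def)
qed simp

section \<open>Density of periodic trigonometric sums\<close>

definition per_list :: "(real \<times> (real^'n::finite) \<times> real) list \<Rightarrow> bool" where
  "per_list L \<longleftrightarrow> (\<forall>(c,k,p)\<in>set L. \<forall>i. k $ i / (2 * pi) \<in> \<int>)"

lemma per_list_simps [simp]:
  "per_list []" "per_list ((c,k,p) # L) \<longleftrightarrow> (\<forall>i. k $ i / (2 * pi) \<in> \<int>) \<and> per_list L"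
  by (auto simp: per_list_def)

lemma per_list_append [simp]: "per_list (L @ L') \<longleftrightarrow> per_list L \<and> per_list L'"
  unfolding per_list_def set_append by blast

lemma per_list_multiplier [simp]: "per_list (multiplier g L) \<longleftrightarrow> per_list L"
  by (induction L) auto

lemma per_list_heat [simp]: "per_list (heat J t L) \<longleftrightarrow> per_list L"
  by (simp add: heat_def)

lemma per_list_resolvent [simp]: "per_list (resolvent lam L) \<longleftrightarrow> per_list L"
  by (simp add: resolvent_def)

lemma periodic_wave: "per_list L \<Longrightarrow> periodic (wave L)"
proof (induction L)
  case (Cons a L)
  obtain c k p where a: "a = (c,k,p)" by (cases a)
  have "cos (k \<bullet> (x + axis i 1) + p) = cos (k \<bullet> x + p)" for x i
  proof -
    obtain m where "k $ i / (2 * pi) = of_int m" using Cons.prems a by (auto elim: Ints_cases)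
    then have "k $ i = 2 * pi * of_int m" by (simp add: field_simps)
    then have "k \<bullet> (x + axis i 1) + p = (k \<bullet> x + p) + 2 * pi * of_int m"
      by (simp add: inner_add_right inner_axis)
    then show ?thesis by (simp only: cos_add cos_int_2pin sin_int_2pin) simp
  qed
  then show ?case using Cons a by (simp add: periodic_def)
qed (simp add: periodic_def)

definition trig :: "(real^'n::finite \<Rightarrow> real) \<Rightarrow> bool" where
  "trig w \<longleftrightarrow> (\<exists>L. per_list L \<and> w = wave L)"

lemma trig_const: "trig (\<lambda>x. c)"
  unfolding trig_def by (rule exI[of _ "[(c,0,0)]"]) auto

lemma trig_add: "trig w \<Longrightarrow> trig w' \<Longrightarrow> trig (\<lambda>x. w x + w' x)"
  unfolding trig_def by (metis (no_types, lifting) ext per_list_append wave_append)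

lemma trig_sum: "(\<And>i. i \<in> I \<Longrightarrow> trig (w i)) \<Longrightarrow> trig (\<lambda>x. \<Sum>i\<in>I. w i x)"
  by (induction I rule: infinite_finite_induct) (auto intro: trig_const trig_add)

text \<open>Product-to-sum formula. Sums and differences of admissible wave vectors stay in the dual
  lattice, so periodic trigonometric sums form an algebra.\<close>

lemma trig_mode_mult:
  assumes "\<forall>i. k $ i / (2 * pi) \<in> \<int>" "per_list L"
  shows "trig (\<lambda>x. (c * cos (k \<bullet> x + p)) * wave L x)"
  using assms(2)
proof (induction L)
  case Nil then show ?case using trig_const[of 0] by simp
next
  case (Cons a L)
  obtain c' k' p' where a: "a = (c',k',p')" by (cases a)
  let ?L = "[(c * c' / 2, k - k', p - p'), (c * c' / 2, k + k', p + p')]"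
  have "per_list ?L" using assms(1) Cons.prems a
    by (auto simp: add_divide_distrib diff_divide_distrib)
  moreover have "(c * cos (k \<bullet> x + p)) * (c' * cos (k' \<bullet> x + p')) = wave ?L x" for x
  proof -
    have "(k \<bullet> x + p) - (k' \<bullet> x + p') = (k - k') \<bullet> x + (p - p')"
      "(k \<bullet> x + p) + (k' \<bullet> x + p') = (k + k') \<bullet> x + (p + p')"
      by (simp_all add: inner_diff_left inner_add_left)
    then have "cos (k \<bullet> x + p) * cos (k' \<bullet> x + p') =
        (cos ((k - k') \<bullet> x + (p - p')) + cos ((k + k') \<bullet> x + (p + p'))) / 2"
      by (simp only: cos_times_cos)
    then have "(c * cos (k \<bullet> x + p)) * (c' * cos (k' \<bullet> x + p')) = c * c' *
        ((cos ((k - k') \<bullet> x + (p - p')) + cos ((k + k') \<bullet> x + (p + p'))) / 2)"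
      by (metis (no_types, lifting) mult.assoc mult.left_commute)
    then show ?thesis by (simp add: algebra_simps)
  qed
  ultimately have 1: "trig (\<lambda>x. (c * cos (k \<bullet> x + p)) * (c' * cos (k' \<bullet> x + p')))"
    unfolding trig_def by (intro exI[of _ ?L]) auto
  have 2: "trig (\<lambda>x. (c * cos (k \<bullet> x + p)) * wave L x)" using Cons a by simp
  show ?case using trig_add[OF 1 2] unfolding a wave_simps by (simp add: distrib_left)
qed

lemma trig_mult:
  assumes "trig w" "trig w'" shows "trig (\<lambda>x. w x * w' x)"
proof -
  obtain L' where L': "per_list L'" "w' = wave L'" using assms(2) trig_def by blast
  obtain L where L: "per_list L" "w = wave L" using assms(1) trig_def by blast
  have "trig (\<lambda>x. wave L x * wave L' x)" using L(1)
  proof (induction L)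
    case Nil then show ?case using trig_const[of 0] by simp
  next
    case (Cons a L)
    obtain c k p where a: "a = (c,k,p)" by (cases a)
    have "trig (\<lambda>x. (c * cos (k \<bullet> x + p)) * wave L' x + wave L x * wave L' x)"
      using Cons a L'(1) by (intro trig_add trig_mode_mult) auto
    then show ?case by (simp add: a distrib_right)
  qed
  then show ?thesis using L L' by simp
qed

lemma trig_cos_sin: "trig (\<lambda>x. cos (2 * pi * x $ i))" "trig (\<lambda>x. sin (2 * pi * x $ i))"
proof -
  have k: "\<forall>j. ((2 * pi) *\<^sub>R axis i (1::real)) $ j / (2 * pi) \<in> \<int>"
    by (auto simp: axis_def)
  have "cos (2 * pi * x $ i) = wave [(1, (2 * pi) *\<^sub>R axis i 1, 0)] x"
    "sin (2 * pi * x $ i) = wave [(1, (2 * pi) *\<^sub>R axis i 1, - pi/2)] x" for x :: "real^'a"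
    using cos_diff[of "2 * pi * x $ i" "pi/2"] by (simp_all add: inner_axis')
  then show "trig (\<lambda>x. cos (2 * pi * x $ i))" "trig (\<lambda>x. sin (2 * pi * x $ i))"
    unfolding trig_def using k by (metis (no_types, lifting) ext per_list_simps)+
qed

text \<open>The standard embedding of the torus in R^(2d). It turns periodic functions into
  functions on a compact set, to which the Stone-Weierstrass theorem applies.\<close>

definition torus_map :: "real^'n::finite \<Rightarrow> (real^'n) \<times> (real^'n)" where
  "torus_map x = (\<chi> i. cos (2 * pi * x $ i), \<chi> i. sin (2 * pi * x $ i))"

lemma trig_polynomial_torus_map:
  assumes "real_polynomial_function g"
  shows "trig (\<lambda>x. g (torus_map x))"
  using assms
proof induction
  case (linear h)
  interpret bounded_linear h by fact
  have "h (torus_map x) = (\<Sum>i\<in>UNIV. h (axis i 1, 0) * cos (2 * pi * x $ i)) +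
      (\<Sum>i\<in>UNIV. h (0, axis i 1) * sin (2 * pi * x $ i))" for x
  proof -
    have v: "y = (\<Sum>i\<in>UNIV. y $ i *\<^sub>R axis i 1)" for y :: "real^'a"
      using basis_expansion[of y] by (simp add: scalar_mult_eq_scaleR)
    have "torus_map x = (\<Sum>i\<in>UNIV. cos (2 * pi * x $ i) *\<^sub>R (axis i 1, 0)) +
        (\<Sum>i\<in>UNIV. sin (2 * pi * x $ i) *\<^sub>R (0, axis i 1))"
      using v[of "\<chi> i. cos (2 * pi * x $ i)"] v[of "\<chi> i. sin (2 * pi * x $ i)"]
      by (simp add: torus_map_def prod_eq_iff fst_sum snd_sum)
    then show ?thesis by (simp only: add sum scaleR) (simp add: mult.commute)
  qed
  then show ?case
    by (simp add: trig_add trig_sum trig_mult trig_const trig_cos_sin)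
qed (auto intro: trig_const trig_add trig_mult)

text \<open>Points with the same image under the embedding differ by a lattice vector, so the
  function factors through it; the factor is approximated by a polynomial, which pulls back to a
  trigonometric sum.\<close>

lemma trig_dense:
  fixes \<xi> :: "real^'n::finite \<Rightarrow> real"
  assumes per: "periodic \<xi>" and cont: "continuous_on UNIV \<xi>" and "0 < e"
  obtains L where "per_list L" "\<And>x. \<bar>wave L x - \<xi> x\<bar> < e"
proof -
  let ?S = "torus_map ` unit_cube :: ((real^'n) \<times> (real^'n)) set"
  have ct: "continuous_on A torus_map" for A :: "(real^'n) set"
    unfolding torus_map_def by (intro continuous_intros continuous_on_vec_lambda)
  have comp: "compact ?S" by (intro compact_continuous_image ct compact_unit_cube)
  have inj: "\<xi> x = \<xi> y" if eq: "torus_map x = torus_map y" for x y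
  proof (rule periodic_int_shift[OF per])
    fix i
    have "cos (2 * pi * x $ i) = cos (2 * pi * y $ i)" "sin (2 * pi * x $ i) = sin (2 * pi * y $ i)"
      using eq by (auto simp: torus_map_def vec_eq_iff)
    then obtain m :: int where "2 * pi * x $ i = 2 * pi * y $ i + 2 * pi * m"
      using sin_cos_eq_iff by metis
    then have "2 * pi * (x $ i - y $ i) = 2 * pi * m" by (simp add: algebra_simps)
    then have "x $ i - y $ i = m" by simp
    then show "x $ i - y $ i \<in> \<int>" by simp
  qed
  define F where "F q = \<xi> (SOME x. torus_map x = q)" for q
  have F: "F (torus_map x) = \<xi> x" for x
    unfolding F_def by (rule someI2[of _ x]) (auto intro: inj)
  \<comment> \<open>Quotient argument: the part of the image on which \<open>F\<close> takes values
    in a closed set is the image of a compact part of the cube, hence closed.\<close>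
  have "continuous_on ?S F"
    unfolding continuous_on_closed_vimage[OF compact_imp_closed[OF comp]]
  proof (intro allI impI)
    fix B :: "real set" assume "closed B"
    have "F -` B \<inter> ?S = torus_map ` (unit_cube \<inter> \<xi> -` B)" using F by auto
    moreover have "closed (\<xi> -` B)" using cont \<open>closed B\<close> by (simp add: continuous_on_closed_vimage)
    then have "compact (unit_cube \<inter> \<xi> -` B)" using compact_unit_cube by blast
    ultimately show "closed (F -` B \<inter> ?S)"
      using compact_continuous_image[OF ct] compact_imp_closed by metis
  qed
  then obtain g where g: "real_polynomial_function g" "\<And>q. q \<in> ?S \<Longrightarrow> \<bar>F q - g q\<bar> < e"
    using Stone_Weierstrass_real_polynomial_function[OF comp _ \<open>0 < e\<close>] by blast
  obtain L where L: "per_list L" "(\<lambda>x. g (torus_map x)) = wave L"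
    using trig_polynomial_torus_map[OF g(1)] unfolding trig_def by blast
  have "\<bar>wave L x - \<xi> x\<bar> < e" for x
  proof -
    have "\<bar>\<xi> (frac_vec x) - wave L (frac_vec x)\<bar> < e"
      using g(2)[OF imageI[OF frac_vec_in_unit_cube[of x]]] fun_cong[OF L(2), of "frac_vec x"]
      by (simp add: F)
    then show ?thesis
      using periodic_frac_vec[OF per] periodic_frac_vec[OF periodic_wave[OF L(1)]]
      by (simp add: abs_minus_commute)
  qed
  then show ?thesis using that L(1) by blast
qed

lemma hoelder_continuous:
  fixes w :: "real^'n::finite \<Rightarrow> real"
  assumes "\<And>x y. \<bar>w x - w y\<bar> \<le> K * dist x y powr a" "0 < a"
  shows "continuous_on UNIV w"
  unfolding continuous_on_eq_continuous_at[OF open_UNIV]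
proof
  fix x :: "real^'n"
  have d: "((\<lambda>y. dist y x) \<longlongrightarrow> 0) (at x)"
    by (rule tendsto_eq_intros refl | simp)+
  have "((\<lambda>y. dist y x powr a) \<longlongrightarrow> 0 powr a) (at x)"
    by (rule tendsto_powr'[OF d tendsto_const]) (use assms(2) in auto)
  then have lim: "((\<lambda>y. K * dist y x powr a) \<longlongrightarrow> 0) (at x)"
    using tendsto_mult_right_zero by force
  have "((\<lambda>y. w y - w x) \<longlongrightarrow> 0) (at x)"
    by (rule Lim_null_comparison[OF always_eventually lim]) (simp add: assms(1))
  then show "isCont w x" by (simp add: isCont_def LIM_zero_iff)
qed

text \<open>Stone--Weierstrass loses control of the Hoelder constant; a short heat flow recovers it.\<close>

lemma trig_dense_hoelder:
  fixes \<xi> :: "real^'n::finite \<Rightarrow> real"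
  assumes per: "periodic \<xi>" and xi: "hb a M \<xi>" and "0 < M" "0 < a" "a \<le> 1" "0 < e"
  obtains L where "per_list L" "\<And>x. \<bar>wave L x - \<xi> x\<bar> \<le> e"
    "\<And>x h. \<bar>wave L (x + h) - wave L x\<bar> \<le> 6 * real CARD('n) * M * norm h powr a"
proof -
  let ?n = "real CARD('n)"
  \<comment> \<open>The Stone-Weierstrass error counts once directly and 6 d times through the heat
    flow: per coordinate, 2 times an oscillation of 3 \<eta> at the time chosen below.\<close>
  define \<eta> where "\<eta> = e / (6 * ?n + 1)"
  have eta: "\<eta> > 0" "6 * ?n * \<eta> + \<eta> = e"
  proof -
    have p: "6 * ?n + 1 > 0" by (simp add: add_pos_pos)
    then show "\<eta> > 0" using \<open>0 < e\<close> by (simp add: \<eta>_def)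
    have "6 * ?n * \<eta> + \<eta> = (6 * ?n + 1) * \<eta>" by (simp only: distrib_right mult_1)
    also have "\<dots> = e" unfolding \<eta>_def using p by simp
    finally show "6 * ?n * \<eta> + \<eta> = e" .
  qed
  \<comment> \<open>The length at which the Hoelder bound of \<xi> equals the approximation error.
    Below it the smoothed sum is controlled by its gradient, above it the error is absorbed by the
    Hoelder term. The time s^2 / 2 makes \<open>sqrt (2 * t)\<close> equal to s.\<close>
  define s where "s = (\<eta> / M) powr (1/a)"
  have s: "s > 0" using eta assms by (simp add: s_def)
  have sa: "M * s powr a = \<eta>" using eta assms by (simp add: s_def powr_powr)
  define t where "t = s\<^sup>2 / 2"
  have t: "t > 0" "sqrt (2 * t) = s" using s by (auto simp: t_def)
  have xih: "\<And>x y. \<bar>\<xi> x - \<xi> y\<bar> \<le> M * dist x y powr a" using xi by (simp add: hb_def)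
  obtain L where L: "per_list L" "\<And>x. \<bar>wave L x - \<xi> x\<bar> < \<eta>"
    using trig_dense[OF per hoelder_continuous[OF xih] eta(1)] assms by metis
  have osc: "\<bar>wave L (x + h) - wave L x\<bar> \<le> 2 * \<eta> + M * norm h powr a" for x h
    using L(2)[of x] L(2)[of "x + h"] xih[of "x + h" x] by (simp add: dist_norm)
  let ?L = "heat UNIV t L"
  have osc': "\<bar>wave ?L (x + h) - wave ?L x\<bar> \<le> 2 * \<eta> + M * norm h powr a" for x h
    using heat_contraction[of t L h 1 "2 * \<eta> + M * norm h powr a" UNIV x] t osc by simp
  have grad: "\<bar>wave (dv i ?L) x\<bar> \<le> 6 * \<eta> / s" for i x
    using heat_gradient_bound[of t a "2 * \<eta>" M L i x] assms t osc eta(1) sa by simp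
  have near: "\<bar>wave ?L x - wave L x\<bar> \<le> 6 * ?n * \<eta>" for x
    using heat_near_identity[of t a "2 * \<eta>" M L UNIV x] assms t osc eta(1) sa by simp
  have close: "\<bar>wave ?L x - \<xi> x\<bar> \<le> e" for x
    using near[of x] L(2)[of x] eta(2) by linarith
  have "\<bar>wave ?L (x + h) - wave ?L x\<bar> \<le> 6 * ?n * M * norm h powr a" for x h
  proof (cases "norm h \<le> s")
    case True
    have "\<bar>wave ?L (x + h) - wave ?L x\<bar> \<le> ?n * (6 * \<eta> / s) * dist (x + h) x"
      by (rule lipschitz_of_pd_bound) (auto simp: wave_differentiable pd_wave grad)
    also have "\<dots> = 6 * ?n * M * (s powr a / s * norm h)"
      by (simp add: sa[symmetric] dist_norm)
    also have "s powr a / s * norm h \<le> norm h powr a"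
    proof (cases "h = 0")
      case False
      have "s powr (a - 1) \<le> norm h powr (a - 1)"
        using True False assms by (intro powr_mono2') auto
      then have "s powr (a - 1) * norm h \<le> norm h powr (a - 1) * norm h"
        by (intro mult_right_mono) auto
      then show ?thesis using s False by (simp add: powr_diff)
    qed simp
    finally show ?thesis using assms by (simp add: mult_left_mono)
  next
    case False
    have "\<eta> \<le> M * norm h powr a"
      unfolding sa[symmetric] using False s assms by (intro mult_left_mono powr_mono2) auto
    then have "\<bar>wave ?L (x + h) - wave ?L x\<bar> \<le> 3 * 1 * (M * norm h powr a)" using osc'[of x h] by simp
    also have "\<dots> \<le> 6 * ?n * (M * norm h powr a)" using assms by (intro mult_right_mono mult_mono) auto
    finally show ?thesis by (simp add: mult.assoc)
  qed
  then show ?thesis using that[of ?L] L(1) close by simp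
qed

section \<open>Schauder theory for the resolvent of the Laplacian\<close>

text \<open>The argument type is left open so that a whole family of derivatives can be treated at
  once, with the indices as part of the argument.\<close>

lemma uniform_Cauchy_limit:
  fixes g :: "nat \<Rightarrow> 'a \<Rightarrow> real"
  assumes "\<And>k m x. k \<le> m \<Longrightarrow> \<bar>g k x - g m x\<bar> \<le> r k" "r \<longlonglongrightarrow> 0"
  obtains g' where "\<And>k x. \<bar>g k x - g' x\<bar> \<le> r k"
proof -
  have "Cauchy (\<lambda>m. g m x)" for x
  proof (rule metric_CauchyI)
    fix e :: real assume "0 < e"
    then have "eventually (\<lambda>k. r k < e/2) sequentially"
      using assms(2) by (intro order_tendstoD) auto
    then obtain N where N: "r N < e/2" by (auto simp: eventually_sequentially)
    have "dist (g m x) (g n x) < e" if "N \<le> m" "N \<le> n" for m n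
      using assms(1)[OF that(1), of x] assms(1)[OF that(2), of x] N by (simp add: dist_real_def)
    then show "\<exists>M. \<forall>m\<ge>M. \<forall>n\<ge>M. dist (g m x) (g n x) < e" by blast
  qed
  then have conv: "(\<lambda>m. g m x) \<longlonglongrightarrow> lim (\<lambda>m. g m x)" for x
    by (simp add: Cauchy_convergent_iff convergent_LIMSEQ_iff)
  have "\<bar>g k x - lim (\<lambda>m. g m x)\<bar> \<le> r k" for k x
  proof (rule tendsto_upperbound)
    show "(\<lambda>m. \<bar>g k x - g m x\<bar>) \<longlonglongrightarrow> \<bar>g k x - lim (\<lambda>m. g m x)\<bar>"
      by (intro tendsto_intros conv)
    show "eventually (\<lambda>m. \<bar>g k x - g m x\<bar> \<le> r k) sequentially"
      using assms(1) by (auto simp: eventually_sequentially)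
  qed auto
  then show ?thesis by (rule that)
qed

lemma tendsto_of_uniform_bound:
  fixes g :: "nat \<Rightarrow> real"
  assumes "\<And>k. \<bar>g k - l\<bar> \<le> r k" "r \<longlonglongrightarrow> 0"
  shows "g \<longlonglongrightarrow> l"
  by (rule LIM_zero_cancel, rule Lim_null_comparison[OF _ assms(2)]) (use assms(1) in auto)

lemma pd_uniform_limit:
  fixes w :: "nat \<Rightarrow> real^'n::finite \<Rightarrow> real"
  assumes diff: "\<And>k x. w k differentiable (at x)"
    and w: "\<And>k x. \<bar>w k x - w' x\<bar> \<le> r k" and d: "\<And>k i x. \<bar>pd i (w k) x - d i x\<bar> \<le> r k"
    and r: "r \<longlonglongrightarrow> 0"
  shows "w' differentiable (at x)" "pd i w' x = d i x"
proof -
  let ?n = "real CARD('n)"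
  have "\<exists>g. \<forall>x\<in>UNIV. (\<lambda>k. w k x) \<longlonglongrightarrow> g x \<and> (g has_derivative (\<lambda>h. \<Sum>i\<in>UNIV. h $ i * d i x)) (at x within UNIV)"
  proof (rule has_derivative_sequence[of UNIV w "\<lambda>k x h. \<Sum>i\<in>UNIV. h $ i * pd i (w k) x" _ 0 "w' 0"])
    show "(w k has_derivative (\<lambda>h. \<Sum>i\<in>UNIV. h $ i * pd i (w k) x)) (at x within UNIV)" for k x
      using has_derivative_pd[OF diff] by simp
    show "(\<lambda>k. w k 0) \<longlonglongrightarrow> w' 0" by (rule tendsto_of_uniform_bound[OF w r])
    fix e :: real assume "0 < e"
    then have "eventually (\<lambda>k. r k < e / ?n) sequentially"
      using r by (intro order_tendstoD) auto
    then show "\<forall>\<^sub>F k in sequentially. \<forall>x\<in>UNIV. \<forall>h. norm ((\<Sum>i\<in>UNIV. h $ i * pd i (w k) x) - (\<Sum>i\<in>UNIV. h $ i * d i x)) \<le> e * norm h"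
    proof eventually_elim
      case (elim k)
      show ?case
      proof (intro ballI allI)
        fix x h :: "real^'n"
        have "norm (\<Sum>i\<in>UNIV. h $ i * pd i (w k) x - h $ i * d i x) \<le> (\<Sum>i::'n\<in>UNIV. norm h * (e / ?n))"
        proof (rule sum_norm_le)
          fix i
          have "norm (h $ i * pd i (w k) x - h $ i * d i x) = \<bar>h $ i\<bar> * \<bar>pd i (w k) x - d i x\<bar>"
            by (simp add: abs_mult[symmetric] algebra_simps)
          also have "\<dots> \<le> norm h * (e / ?n)"
            using component_le_norm_cart[of h i] d[of i k x] elim by (intro mult_mono) auto
          finally show "norm (h $ i * pd i (w k) x - h $ i * d i x) \<le> norm h * (e / ?n)" .
        qed
        then show "norm ((\<Sum>i\<in>UNIV. h $ i * pd i (w k) x) - (\<Sum>i\<in>UNIV. h $ i * d i x)) \<le> e * norm h"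
          by (simp add: sum_subtractf mult.commute)
      qed
    qed
  qed auto
  then obtain g where g: "\<And>x. (\<lambda>k. w k x) \<longlonglongrightarrow> g x"
    "\<And>x. (g has_derivative (\<lambda>h. \<Sum>i\<in>UNIV. h $ i * d i x)) (at x)" by auto
  have "g = w'" using LIMSEQ_unique[OF g(1) tendsto_of_uniform_bound[OF w r]] by blast
  then have D: "(w' has_derivative (\<lambda>h. \<Sum>i\<in>UNIV. h $ i * d i x)) (at x)" using g(2) by simp
  then show "w' differentiable (at x)" by (auto simp: differentiable_def)
  have "(\<Sum>j\<in>UNIV. axis i 1 $ j * d j x) = (\<Sum>j\<in>UNIV. if j = i then d j x else 0)"
    by (intro sum.cong) (auto simp: axis_def)
  then show "pd i w' x = d i x" using pd_has_derivative[OF D, of i] by simp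
qed

text \<open>Every derivative vanishes within distance 1. For the second derivatives the seminorm
  then gives K; these bound the Lipschitz constant of the first derivatives by d K, and the same
  argument applies to them.\<close>

lemma periodic_second_derivative_bounds:
  fixes w :: "real^'n::finite \<Rightarrow> real"
  assumes "periodic w" "C2 w" "0 \<le> K" "0 < a"
    and K: "\<And>i j x y. \<bar>pd j (pd i w) x - pd j (pd i w) y\<bar> \<le> K * dist x y powr a"
  shows "\<bar>pd j (pd i w) x\<bar> \<le> K" "\<bar>pd i w x\<bar> \<le> real CARD('n) * K"
proof -
  have d: "\<And>x. w differentiable (at x)" "\<And>i x. pd i w differentiable (at x)"
    using assms(2) by (auto simp: C2_def)
  show dd: "\<bar>pd j (pd i w) x\<bar> \<le> K" for i j x
  proof -
    obtain y where y: "dist x y \<le> 1" "pd j (pd i w) y = 0"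
      using periodic_pd_zero_nearby[OF periodic_pd[OF assms(1) d(1)] d(2)] .
    have "\<bar>pd j (pd i w) x\<bar> \<le> K * dist x y powr a" using K[of j i x y] y by simp
    also have "\<dots> \<le> K * 1" using y assms by (intro mult_left_mono powr_le1) auto
    finally show ?thesis by simp
  qed
  obtain y where y: "dist x y \<le> 1" "pd i w y = 0"
    using periodic_pd_zero_nearby[OF assms(1) d(1)] .
  have "\<bar>pd i w x\<bar> \<le> real CARD('n) * K * dist x y"
    using lipschitz_of_pd_bound[OF d(2), of i K x y] dd y by simp
  also have "\<dots> \<le> real CARD('n) * K * 1" using y assms by (intro mult_left_mono) auto
  finally show "\<bar>pd i w x\<bar> \<le> real CARD('n) * K" by simp
qed

section \<open>Hoelder right-hand sides: existence, uniqueness and bounds\<close>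

lemma wave_neg: "wave (multiplier (\<lambda>k. - 1) L) x = - wave L x"
  by (induction L) auto

lemma resolvent_neg: "resolvent lam (multiplier (\<lambda>k. - 1) L) = multiplier (\<lambda>k. - 1) (resolvent lam L)"
  by (simp add: resolvent_def multiplier_multiplier)

lemma resolvent_append: "resolvent lam (L @ L') = resolvent lam L @ resolvent lam L'"
  by (simp add: resolvent_def multiplier_append)

lemma schauder_const_nonneg: "0 < a \<Longrightarrow> a < 1 \<Longrightarrow> 0 \<le> schauder_const d a"
  by (simp add: schauder_const_def)

lemma resolvent_exists:
  fixes \<xi> :: "real^'n::finite \<Rightarrow> real"
  assumes lam: "lam > 0" and per: "periodic \<xi>" and xi: "hb a M \<xi>" and M: "0 < M" and a: "0 < a" "a < 1"
  obtains v where "periodic v" "C2 v" "\<And>x. - lap v x + lam * v x = \<xi> x"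
    "\<And>i j x y. \<bar>pd j (pd i v) x - pd j (pd i v) y\<bar>
      \<le> schauder_const CARD('n) a * (6 * real CARD('n) * M) * dist x y powr a"
proof -
  let ?n = "real CARD('n)"
  define e where "e k = inverse (real (Suc k))" for k
  have e: "\<And>k. e k > 0" "e \<longlonglongrightarrow> 0" "\<And>k m. k \<le> m \<Longrightarrow> e m \<le> e k"
    unfolding e_def using LIMSEQ_inverse_real_of_nat by (auto simp: le_imp_inverse_le)
  define K where "K = 6 * ?n * M"
  have K: "K \<ge> 0" using M by (simp add: K_def)
  have "\<forall>k. \<exists>L. per_list L \<and> (\<forall>x. \<bar>wave L x - \<xi> x\<bar> \<le> e k) \<and> (\<forall>x h. \<bar>wave L (x + h) - wave L x\<bar> \<le> K * norm h powr a)"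
    using trig_dense_hoelder[OF per xi M a(1) less_imp_le[OF a(2)] e(1)] unfolding K_def by metis
  then obtain L where L: "\<And>k. per_list (L k)" "\<And>k x. \<bar>wave (L k) x - \<xi> x\<bar> \<le> e k"
    "\<And>k x h. \<bar>wave (L k) (x + h) - wave (L k) x\<bar> \<le> K * norm h powr a" by metis
  let ?R = "\<lambda>k. resolvent lam (L k)"
  \<comment> \<open>The rate has a maximum-principle part for the functions and a Schauder part for
    the derivatives. The latter uses exponent a/2, because the seminorm of the differences tends to
    0 there, while at exponent a it is only bounded.\<close>
  define r where "r k = 2 * e k / lam + (1 + ?n) * (schauder_const CARD('n) (a/2) * ((4 * e k) powr (1/2) * (2 * K) powr (1/2)))" for k
  have r: "r \<longlonglongrightarrow> 0"
    unfolding r_def using e(2) lam by (auto intro!: tendsto_eq_intros simp: e(1) less_imp_le)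
  have cauchy: "\<bar>wave (?R k) x - wave (?R m) x\<bar> \<le> r k"
    "\<bar>wave (dv i (?R k)) x - wave (dv i (?R m)) x\<bar> \<le> r k"
    "\<bar>wave (dv j (dv i (?R k))) x - wave (dv j (dv i (?R m))) x\<bar> \<le> r k" if km: "k \<le> m" for k m i j x
  proof -
    \<comment> \<open>The difference of two sums is again a sum of the same kind, so the estimates
      apply to it directly.\<close>
    define D where "D = L k @ multiplier (\<lambda>k. - 1) (L m)"
    have wD: "wave D x = wave (L k) x - wave (L m) x" for x
      by (simp add: D_def wave_append wave_neg)
    have RD: "wave (resolvent lam D) x = wave (?R k) x - wave (?R m) x"
      "wave (dv i (resolvent lam D)) x = wave (dv i (?R k)) x - wave (dv i (?R m)) x"
      "wave (dv j (dv i (resolvent lam D))) x = wave (dv j (dv i (?R k))) x - wave (dv j (dv i (?R m))) x" for i j x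
      by (simp_all add: D_def resolvent_append resolvent_neg dv_append dv_multiplier wave_append wave_neg)
    have sup: "\<bar>wave D x\<bar> \<le> 2 * e k" for x
      using L(2)[of k x] L(2)[of m x] e(3)[OF km] unfolding wD by linarith
    have hD: "\<bar>wave D x - wave D y\<bar> \<le> 2 * K * dist x y powr a" for x y
      using L(3)[of k y "x - y"] L(3)[of m y "x - y"] unfolding wD dist_norm by simp
    define B where "B = (4 * e k) powr (1/2) * (2 * K) powr (1/2)"
    have B: "B \<ge> 0" by (simp add: B_def)
    have osc: "\<bar>wave D (x + h) - wave D x\<bar> \<le> B * norm h powr (a/2)" for x h
      using hoelder_interpolation[of "wave D" "2 * e k" "2 * K" a "a/2" "x + h" x, OF sup hD] a K
      by (simp add: B_def dist_norm)
    define S where "S = schauder_const CARD('n) (a/2) * B"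
    have S0: "S \<ge> 0" using B schauder_const_nonneg[of "a/2"] a by (simp add: S_def)
    have per: "periodic (wave (resolvent lam D))"
      using L(1) by (intro periodic_wave) (simp add: D_def)
    have S: "\<bar>pd j (pd i (wave (resolvent lam D))) x - pd j (pd i (wave (resolvent lam D))) y\<bar> \<le> S * dist x y powr (a/2)" for i j x y
      unfolding pd_wave S_def using a by (intro schauder_trig lam osc B) auto
    have a2: "0 < a/2" using a by simp
    note bounds = periodic_second_derivative_bounds[OF per C2_wave S0 a2 S, unfolded pd_wave]
    have rk: "r k = 2 * e k / lam + (1 + ?n) * S" by (simp add: r_def S_def B_def)
    have nn: "0 \<le> 2 * e k / lam" "0 \<le> ?n * S" using e(1)[of k] lam S0 by auto
    have "\<bar>wave (resolvent lam D) x\<bar> \<le> 2 * e k / lam"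
      by (rule max_principle[OF lam per C2_wave]) (simp only: resolvent_solves[OF lam] sup)
    then show "\<bar>wave (?R k) x - wave (?R m) x\<bar> \<le> r k"
      using nn S0 unfolding RD rk distrib_right by linarith
    show "\<bar>wave (dv i (?R k)) x - wave (dv i (?R m)) x\<bar> \<le> r k"
      using bounds(2)[of i x] nn S0 unfolding RD rk distrib_right by linarith
    show "\<bar>wave (dv j (dv i (?R k))) x - wave (dv j (dv i (?R m))) x\<bar> \<le> r k"
      using bounds(1)[of j i x] nn S0 unfolding RD rk distrib_right by linarith
  qed
  obtain v where v: "\<And>k x. \<bar>wave (?R k) x - v x\<bar> \<le> r k"
    using uniform_Cauchy_limit[of "\<lambda>k. wave (?R k)" r] cauchy(1) r by metis
  \<comment> \<open>The direction and the point form one argument, so that a single limit function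
    serves all partial derivatives.\<close>
  obtain d' where d': "\<And>k q. \<bar>wave (dv (fst q) (?R k)) (snd q) - d' q\<bar> \<le> r k"
    using uniform_Cauchy_limit[of "\<lambda>k q. wave (dv (fst q) (?R k)) (snd q)" r] cauchy(2) r by metis
  define d where "d i x = d' (i, x)" for i x
  have d: "\<bar>wave (dv i (?R k)) x - d i x\<bar> \<le> r k" for i k x using d'[of "(i, x)" k] by (simp add: d_def)
  obtain dd' where dd': "\<And>k q. \<bar>wave (dv (fst q) (dv (fst (snd q)) (?R k))) (snd (snd q)) - dd' q\<bar> \<le> r k"
    using uniform_Cauchy_limit[of "\<lambda>k q. wave (dv (fst q) (dv (fst (snd q)) (?R k))) (snd (snd q))" r] cauchy(3) r by metis
  define dd where "dd j i x = dd' (j, i, x)" for i j x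
  have dd: "\<bar>wave (dv j (dv i (?R k))) x - dd j i x\<bar> \<le> r k" for i j k x using dd'[of "(j, i, x)" k] by (simp add: dd_def)
  have pv: "v differentiable (at x)" "pd i v x = d i x" for i x
    using pd_uniform_limit[of "\<lambda>k. wave (?R k)" v r d, OF wave_differentiable v _ r] d by (auto simp: pd_wave)
  have pd: "d i differentiable (at x)" "pd j (d i) x = dd j i x" for i j x
    using pd_uniform_limit[of "\<lambda>k. wave (dv i (?R k))" "d i" r "\<lambda>j. dd j i", OF wave_differentiable d _ r] dd
    by (auto simp: pd_wave)
  have pdv: "pd i v = d i" for i using pv by blast
  have pddv: "pd j (pd i v) = dd j i" for i j unfolding pdv using pd by blast
  have lim: "(\<lambda>k. wave (?R k) x) \<longlonglongrightarrow> v x" "(\<lambda>k. wave (dv j (dv i (?R k))) x) \<longlonglongrightarrow> dd j i x" for i j x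
    using tendsto_of_uniform_bound[OF v r] tendsto_of_uniform_bound[OF dd r] by auto
  have hoelder: "\<bar>pd j (pd i v) x - pd j (pd i v) y\<bar> \<le> schauder_const CARD('n) a * K * dist x y powr a" for i j x y
    unfolding pddv
  proof (rule tendsto_upperbound)
    show "(\<lambda>k. \<bar>wave (dv j (dv i (?R k))) x - wave (dv j (dv i (?R k))) y\<bar>) \<longlonglongrightarrow> \<bar>dd j i x - dd j i y\<bar>"
      by (intro tendsto_intros lim)
    show "\<forall>\<^sub>F k in sequentially. \<bar>wave (dv j (dv i (?R k))) x - wave (dv j (dv i (?R k))) y\<bar>
        \<le> schauder_const CARD('n) a * K * dist x y powr a"
      by (intro always_eventually allI schauder_trig lam a K L(3))
  qed auto
  show ?thesis
  proof (rule that[of v])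
    show "periodic v" unfolding periodic_def
    proof (intro allI)
      fix x i
      have "(\<lambda>k. wave (?R k) (x + axis i 1)) = (\<lambda>k. wave (?R k) x)"
        using periodic_wave[of "?R _"] L(1) by (simp add: periodic_def)
      then show "v (x + axis i 1) = v x" using lim(1)[of x] lim(1)[of "x + axis i 1"] LIMSEQ_unique by metis
    qed
    show "C2 v" unfolding C2_def
      using pv(1) pd(1) hoelder_continuous[OF hoelder a(1)] by (auto simp: pdv)
    show "- lap v x + lam * v x = \<xi> x" for x
    proof -
      have "(\<lambda>k. - lap (wave (?R k)) x + lam * wave (?R k) x) \<longlonglongrightarrow> - lap v x + lam * v x"
        unfolding lap_def pddv pd_wave by (intro tendsto_intros lim)
      moreover have "(\<lambda>k. wave (L k) x) \<longlonglongrightarrow> \<xi> x"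
        by (rule tendsto_of_uniform_bound[OF L(2) e(2)])
      ultimately show ?thesis unfolding resolvent_solves[OF lam] using LIMSEQ_unique by blast
    qed
  qed (use hoelder in \<open>auto simp: K_def\<close>)
qed

text \<open>\<open>Tres\<close> is a definite description, so exhibiting a solution identifies it
  once solutions are unique; the difference of two solves the homogeneous equation and vanishes by
  the maximum principle.\<close>

lemma Tres_eqI:
  fixes v :: "real^'n::finite \<Rightarrow> real"
  assumes lam: "lam > 0" and v: "periodic v" "C2 v" "\<And>x. - lap v x + lam * v x = \<xi> x"
  shows "Tres lam \<xi> = v"
  unfolding Tres_def
proof (rule the_equality)
  fix w assume w: "periodic w \<and> C2 w \<and> (\<forall>x. - lap w x + lam * w x = \<xi> x)"
  have mv: "C2 (\<lambda>x. - v x)" using C2_uminus[OF v(2)] .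
  show "w = v"
  proof
    fix x
    have "\<bar>w x + - v x\<bar> \<le> 0 / lam"
    proof (rule max_principle[OF lam])
      show "periodic (\<lambda>x. w x + - v x)" using v(1) w by (simp add: periodic_def)
      show "C2 (\<lambda>x. w x + - v x)" using w mv by (intro C2_add) auto
      fix x
      have "lap (\<lambda>x. w x + - v x) x = lap w x - lap v x"
        unfolding lap_def using w pd_pd_add[OF _ mv] pd_pd_uminus[OF v(2)] by (simp add: sum_subtractf)
      then show "\<bar>- lap (\<lambda>x. w x + - v x) x + lam * (w x + - v x)\<bar> \<le> 0"
        using w v(3)[of x] by (simp add: algebra_simps)
    qed
    then show "w x = v x" by simp
  qed
qed (use v in auto)

text \<open>The second-order companion of \<open>hb\<close>. It is equivalent to a bound on
  \<open>norm2a\<close> up to a factor depending on the dimension, but contains no supremum.\<close>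

definition c2b :: "real \<Rightarrow> real \<Rightarrow> (real^'n::finite \<Rightarrow> real) \<Rightarrow> bool" where
  "c2b a M w \<longleftrightarrow> C2a a w \<and> (\<forall>x. \<bar>w x\<bar> \<le> M) \<and> (\<forall>i x. \<bar>pd i w x\<bar> \<le> M) \<and> (\<forall>i j. hb a M (pd j (pd i w)))"

lemma Tres_bounds:
  fixes lam a :: real
  assumes lam: "lam > 0" and a: "0 < a" "a < 1"
  obtains C where "C > 0"
    "\<And>\<xi> :: real^'n::finite \<Rightarrow> real. \<And>M. periodic \<xi> \<Longrightarrow> hb a M \<xi> \<Longrightarrow>
      c2b a (C * M) (Tres lam \<xi>) \<and> (\<forall>x. - lap (Tres lam \<xi>) x + lam * Tres lam \<xi> x = \<xi> x)"
proof -
  let ?n = "real CARD('n)"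
  define C0 where "C0 = schauder_const CARD('n) a * (6 * ?n)"
  \<comment> \<open>1 / \<open>lam\<close> serves the function, \<open>C0\<close> its second
    derivatives and d times \<open>C0\<close> its first derivatives.\<close>
  define C where "C = 1 / lam + (1 + ?n) * C0"
  have C0: "C0 \<ge> 0" using schauder_const_nonneg[OF a] by (simp add: C0_def)
  have C: "C > 0" using C0 lam by (simp add: C_def add_pos_nonneg)
  have Cge: "1 / lam \<le> C" "C0 \<le> C" "?n * C0 \<le> C" using C0 lam by (auto simp: C_def algebra_simps add_increasing)
  have "c2b a (C * M) (Tres lam \<xi>) \<and> (\<forall>x. - lap (Tres lam \<xi>) x + lam * Tres lam \<xi> x = \<xi> x)"
    if per: "periodic \<xi>" and xi: "hb a M \<xi>" for \<xi> :: "real^'n \<Rightarrow> real" and M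
  proof (cases "M = 0")
    \<comment> \<open>The approximation needs a positive \<open>M\<close>, by which the smoothing
      scale is computed, so the zero function is treated by hand.\<close>
    case True
    then have xi0: "\<xi> = (\<lambda>x. 0)" using xi by (auto simp: hb_def)
    have p0: "pd i (\<lambda>x::real^'n. 0) = (\<lambda>x. 0)" for i
      by (rule ext) (simp add: pd_has_derivative[of _ "\<lambda>h. 0"])
    have c: "C2 (\<lambda>x::real^'n. 0)" by (simp add: C2_def p0)
    have "Tres lam \<xi> = (\<lambda>x. 0)"
      by (rule Tres_eqI[OF lam _ c]) (auto simp: xi0 periodic_def lap_def p0)
    then show ?thesis using c
      by (auto simp: c2b_def C2a_def p0 True hb_def holder_bdd_def periodic_def xi0 lap_def intro: exI[of _ 0])
  next
    case False
    then have M: "M > 0" using hb_nonneg[OF xi] by simp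
    obtain v where v: "periodic v" "C2 v" "\<And>x. - lap v x + lam * v x = \<xi> x"
      and h: "\<And>i j x y. \<bar>pd j (pd i v) x - pd j (pd i v) y\<bar> \<le> schauder_const CARD('n) a * (6 * ?n * M) * dist x y powr a"
      using resolvent_exists[OF lam per xi M a] by blast
    have h': "\<bar>pd j (pd i v) x - pd j (pd i v) y\<bar> \<le> (C0 * M) * dist x y powr a" for i j x y
      using h[of j i x y] by (simp add: C0_def mult_ac)
    have T: "Tres lam \<xi> = v" by (rule Tres_eqI[OF lam v])
    have CM0: "0 \<le> C0 * M" using C0 M by simp
    note b = periodic_second_derivative_bounds[OF v(1,2) CM0 a(1) h']
    have "C0 * M \<le> C * M" "?n * (C0 * M) \<le> C * M" "M / lam \<le> C * M"
      using mult_right_mono[OF Cge(1), of M] mult_right_mono[OF Cge(2), of M] mult_right_mono[OF Cge(3), of M] M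
      by (auto simp: mult.assoc)
    note le = this
    have "\<bar>v x\<bar> \<le> M / lam" for x
      using xi by (intro max_principle[OF lam v(1,2)]) (simp add: v(3)[simplified] hb_def)
    then have 1: "\<bar>v x\<bar> \<le> C * M" for x using le(3) order_trans by blast
    have 2: "\<bar>pd i v x\<bar> \<le> C * M" for i x using b(2)[of i x] le(2) by linarith
    have 3: "hb a (C0 * M) (pd j (pd i v))" for i j using b(1) h' by (simp add: hb_def)
    have "C2a a v" unfolding C2a_def holder_bdd_def using v h' by blast
    then show ?thesis unfolding T c2b_def using 1 2 hb_mono[OF 3 le(1)] v(3) by blast
  qed
  then show ?thesis using that C by blast
qed

section \<open>Compact perturbations of the identity\<close>

text \<open>Pointwise scaling makes pairs of functions a real vector space, the setting in which the
  Riesz theory is stated.\<close>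

instantiation "fun" :: (type, real_vector) real_vector
begin

definition scaleR_fun_def: "c *\<^sub>R f = (\<lambda>x. c *\<^sub>R f x)"

instance
  by standard (auto simp: scaleR_fun_def plus_fun_def fun_eq_iff scaleR_add_right scaleR_add_left)

end

text \<open>The Hoelder spaces are carriers inside function types, so the Riesz theory is done for a
  subspace with its own norm. Completeness is not assumed: the limits that are needed come from
  compactness.\<close>

locale normed_carrier =
  fixes S :: "'v::real_vector set" and N :: "'v \<Rightarrow> real"
  assumes subspace_S: "subspace S"
    and N_add: "x \<in> S \<Longrightarrow> y \<in> S \<Longrightarrow> N (x + y) \<le> N x + N y"
    and N_scaleR_le: "x \<in> S \<Longrightarrow> N (c *\<^sub>R x) \<le> \<bar>c\<bar> * N x"
    and N_eq_0: "x \<in> S \<Longrightarrow> N x = 0 \<Longrightarrow> x = 0"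
begin

lemma S_closed: "0 \<in> S" "x \<in> S \<Longrightarrow> y \<in> S \<Longrightarrow> x + y \<in> S" "x \<in> S \<Longrightarrow> y \<in> S \<Longrightarrow> x - y \<in> S"
  "x \<in> S \<Longrightarrow> c *\<^sub>R x \<in> S"
  using subspace_S by (auto simp: subspace_0 subspace_add subspace_diff subspace_scale)

lemma N_minus_le: "x \<in> S \<Longrightarrow> N (- x) \<le> N x"
  using N_scaleR_le[of x "-1"] by simp

lemma N_diff: "x \<in> S \<Longrightarrow> y \<in> S \<Longrightarrow> N (x - y) \<le> N x + N y"
  using N_add[of x "- y"] N_minus_le[of y] subspace_neg[OF subspace_S, of y] by simp

lemma N_minus_commute: "x \<in> S \<Longrightarrow> y \<in> S \<Longrightarrow> N (x - y) = N (y - x)"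
  using N_minus_le[of "x - y"] N_minus_le[of "y - x"] S_closed by (simp add: order_antisym)

lemma N_0: "N 0 = 0"
proof -
  have "N 0 \<le> 0" using N_scaleR_le[of 0 0] S_closed by simp
  moreover have "N 0 \<le> N 0 + N 0" using N_add[of 0 0] S_closed by simp
  ultimately show ?thesis by simp
qed

lemma N_nonneg: "x \<in> S \<Longrightarrow> 0 \<le> N x"
  using N_diff[of x x] N_0 by simp

lemma N_scaleR: "x \<in> S \<Longrightarrow> N (c *\<^sub>R x) = \<bar>c\<bar> * N x"
proof (cases "c = 0")
  case False
  assume x: "x \<in> S"
  have "N (inverse c *\<^sub>R (c *\<^sub>R x)) \<le> \<bar>inverse c\<bar> * N (c *\<^sub>R x)"
    using x S_closed by (intro N_scaleR_le) auto
  then have "\<bar>c\<bar> * N x \<le> N (c *\<^sub>R x)" using False by (simp add: field_simps)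
  then show ?thesis using N_scaleR_le[OF x, of c] by simp
qed (simp add: N_0)

lemma eq_0_if_N_le_null:
  assumes "z \<in> S" "\<And>n. N z \<le> e n" "e \<longlonglongrightarrow> 0"
  shows "z = 0"
proof -
  have "N z \<le> 0" using assms by (intro LIMSEQ_le_const[OF assms(3)]) auto
  then show ?thesis using N_nonneg[OF assms(1)] N_eq_0[OF assms(1)] by simp
qed

end

lemma subsequence_null: "e \<longlonglongrightarrow> (0::real) \<Longrightarrow> strict_mono r \<Longrightarrow> (\<lambda>n. e (r n)) \<longlonglongrightarrow> 0"
  using LIMSEQ_subseq_LIMSEQ[of e 0 r] by (simp add: o_def)

locale compact_perturbation = normed_carrier S N for S :: "'v::real_vector set" and N +
  fixes K :: "'v \<Rightarrow> 'v"
  assumes K_in: "x \<in> S \<Longrightarrow> K x \<in> S"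
    and K_add: "x \<in> S \<Longrightarrow> y \<in> S \<Longrightarrow> K (x + y) = K x + K y"
    and K_scaleR: "x \<in> S \<Longrightarrow> K (c *\<^sub>R x) = c *\<^sub>R K x"
    and K_bounded: "\<exists>B. \<forall>x\<in>S. N (K x) \<le> B * N x"
    and K_compact: "(\<And>n. X n \<in> S) \<Longrightarrow> (\<And>n. N (X n) \<le> B) \<Longrightarrow>
      \<exists>r l. strict_mono (r::nat \<Rightarrow> nat) \<and> l \<in> S \<and> (\<lambda>n. N (K (X (r n)) - l)) \<longlonglongrightarrow> 0"
    and inj: "x \<in> S \<Longrightarrow> x + K x = 0 \<Longrightarrow> x = 0"
begin

definition "A x = x + K x"

lemma K_diff: "x \<in> S \<Longrightarrow> y \<in> S \<Longrightarrow> K (x - y) = K x - K y"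
  using K_add[of x "(-1) *\<^sub>R y"] K_scaleR[of y "-1"] S_closed(4)[of y "-1"] by simp

lemma A_in: "x \<in> S \<Longrightarrow> A x \<in> S"
  by (simp add: A_def K_in S_closed)

lemma A_add: "x \<in> S \<Longrightarrow> y \<in> S \<Longrightarrow> A (x + y) = A x + A y"
  by (simp add: A_def K_add)

lemma A_diff: "x \<in> S \<Longrightarrow> y \<in> S \<Longrightarrow> A (x - y) = A x - A y"
  by (simp add: A_def K_diff)

lemma A_scaleR: "x \<in> S \<Longrightarrow> A (c *\<^sub>R x) = c *\<^sub>R A x"
  by (simp add: A_def K_scaleR scaleR_add_right)

lemma A_bounded: "\<exists>B. \<forall>x\<in>S. N (A x) \<le> B * N x"
proof -
  obtain B where B: "\<And>x. x \<in> S \<Longrightarrow> N (K x) \<le> B * N x" using K_bounded by blast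
  have "N (A x) \<le> (1 + B) * N x" if "x \<in> S" for x
    using N_add[OF that K_in[OF that]] B[OF that] by (simp add: A_def distrib_right)
  then show ?thesis by blast
qed

text \<open>Otherwise there are unit vectors Y with A Y tending to 0. Along a subsequence K Y tends
  to some l, so Y tends to -l and A l = 0. Injectivity forces l = 0, which contradicts the unit
  norms.\<close>

lemma bounded_below: "\<exists>c>0. \<forall>x\<in>S. c * N x \<le> N (A x)"
proof (rule ccontr)
  assume "\<not> ?thesis"
  then have neg: "\<forall>c>0. \<exists>x\<in>S. N (A x) < c * N x" by (auto simp: not_le)
  have "\<forall>n. \<exists>x. x \<in> S \<and> N x = 1 \<and> N (A x) \<le> inverse (real (Suc n))"
  proof
    fix n
    have "0 < inverse (real (Suc n))" by simp
    then obtain x where x: "x \<in> S" "N (A x) < inverse (real (Suc n)) * N x"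
      using neg by blast
    have pos: "N x > 0"
    proof (rule ccontr)
      assume "\<not> N x > 0"
      then have "N x = 0" using N_nonneg[OF x(1)] by simp
      then show False using x(2) N_nonneg[OF A_in[OF x(1)]] by simp
    qed
    let ?y = "inverse (N x) *\<^sub>R x"
    have "N ?y = 1" using pos x(1) by (simp add: N_scaleR)
    moreover have "N (A ?y) \<le> inverse (real (Suc n))"
      using x pos by (simp add: A_scaleR N_scaleR A_in field_simps)
    moreover have "?y \<in> S" using x(1) by (rule S_closed)
    ultimately show "\<exists>x. x \<in> S \<and> N x = 1 \<and> N (A x) \<le> inverse (real (Suc n))"
      by (intro exI[of _ ?y]) simp
  qed
  then obtain Y where Y: "\<And>n. Y n \<in> S" "\<And>n. N (Y n) = 1" "\<And>n. N (A (Y n)) \<le> inverse (real (Suc n))"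
    by metis
  obtain r l where r: "strict_mono r" "l \<in> S" "(\<lambda>n. N (K (Y (r n)) - l)) \<longlonglongrightarrow> 0"
    using K_compact[of Y 1] Y by auto
  obtain B where B: "\<And>x. x \<in> S \<Longrightarrow> N (A x) \<le> B * N x" using A_bounded by blast
  have i0: "(\<lambda>n. inverse (real (Suc (r n)))) \<longlonglongrightarrow> 0"
    using subsequence_null[OF LIMSEQ_inverse_real_of_nat r(1)] .
  define e where "e n = inverse (real (Suc (r n))) + N (K (Y (r n)) - l)" for n
  have e0: "e \<longlonglongrightarrow> 0" unfolding e_def using tendsto_add[OF i0 r(3)] by simp
  have e: "N (l + Y (r n)) \<le> e n" for n
  proof -
    have eq: "l + Y (r n) = A (Y (r n)) - (K (Y (r n)) - l)" by (simp add: A_def)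
    show ?thesis unfolding eq using N_diff[OF A_in[OF Y(1)] S_closed(3)[OF K_in[OF Y(1)] r(2)], of "r n" "r n"] Y(3)[of "r n"]
      by (simp add: e_def)
  qed
  have "A l = 0"
  proof (rule eq_0_if_N_le_null[OF A_in[OF r(2)]])
    show "(\<lambda>n. \<bar>B\<bar> * e n + inverse (real (Suc (r n)))) \<longlonglongrightarrow> 0"
      using tendsto_add[OF tendsto_mult_right_zero[OF e0, of "\<bar>B\<bar>"] i0] by simp
    fix n
    have "A l = A (l + Y (r n)) - A (Y (r n))" using r(2) Y(1) by (simp add: A_add)
    then have "N (A l) \<le> N (A (l + Y (r n))) + N (A (Y (r n)))"
      using N_diff[OF A_in A_in] Y(1) r(2) S_closed by metis
    moreover have "N (A (l + Y (r n))) \<le> B * N (l + Y (r n))" using B Y(1) r(2) S_closed by blast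
    moreover have "B * N (l + Y (r n)) \<le> \<bar>B\<bar> * e n"
      using e[of n] N_nonneg[OF S_closed(2)[OF r(2) Y(1)], of "r n"] by (intro mult_mono) auto
    ultimately show "N (A l) \<le> \<bar>B\<bar> * e n + inverse (real (Suc (r n)))" using Y(3)[of "r n"] by linarith
  qed
  then have "l = 0" using inj r(2) by (simp add: A_def)
  then have "1 \<le> e n" for n using e[of n] Y(2) by simp
  then have "(1::real) \<le> 0" by (intro LIMSEQ_le_const[OF e0]) auto
  then show False by simp
qed

section \<open>The chain of ranges of the powers of A, and surjectivity\<close>

definition "range_pow n = (A ^^ n) ` S"

lemma range_pow_0: "range_pow 0 = S" by (simp add: range_pow_def)

lemma range_pow_Suc: "range_pow (Suc n) = A ` range_pow n"
  by (simp add: range_pow_def image_comp)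

lemma range_pow_subset: "range_pow n \<subseteq> S"
  by (induction n) (auto simp: range_pow_0 range_pow_Suc A_in)

lemma range_pow_antimono: "range_pow (Suc n) \<subseteq> range_pow n"
  by (induction n) (auto simp: range_pow_0 range_pow_Suc A_in)

lemma range_pow_le: "m \<le> n \<Longrightarrow> range_pow n \<subseteq> range_pow m"
  using lift_Suc_antimono_le[of range_pow m n] range_pow_antimono by blast

lemma range_pow_linear:
  "x \<in> range_pow n \<Longrightarrow> y \<in> range_pow n \<Longrightarrow> x + y \<in> range_pow n"
  "x \<in> range_pow n \<Longrightarrow> c *\<^sub>R x \<in> range_pow n"
proof -
  show "x \<in> range_pow n \<Longrightarrow> y \<in> range_pow n \<Longrightarrow> x + y \<in> range_pow n"
  proof (induction n arbitrary: x y)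
    case 0 then show ?case by (simp add: range_pow_0 S_closed)
  next
    case (Suc n)
    then obtain x' y' where *: "x' \<in> range_pow n" "y' \<in> range_pow n" "x = A x'" "y = A y'"
      by (auto simp: range_pow_Suc)
    then have "x + y = A (x' + y')" using range_pow_subset[of n] by (simp add: A_add subset_iff)
    then show ?case using Suc.IH[OF *(1,2)] by (auto simp: range_pow_Suc)
  qed
  show "x \<in> range_pow n \<Longrightarrow> c *\<^sub>R x \<in> range_pow n"
  proof (induction n arbitrary: x)
    case 0 then show ?case by (simp add: range_pow_0 S_closed)
  next
    case (Suc n)
    then obtain x' where *: "x' \<in> range_pow n" "x = A x'"
      by (auto simp: range_pow_Suc)
    then have "c *\<^sub>R x = A (c *\<^sub>R x')" using range_pow_subset[of n] by (simp add: A_scaleR subset_iff)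
    then show ?case using Suc.IH[OF *(1)] by (auto simp: range_pow_Suc)
  qed
qed

lemma range_pow_diff: "x \<in> range_pow n \<Longrightarrow> y \<in> range_pow n \<Longrightarrow> x - y \<in> range_pow n"
  using range_pow_linear(1)[of x n "(-1) *\<^sub>R y"] range_pow_linear(2)[of y n "-1"] by simp

text \<open>Preimages of a convergent sequence are bounded because A is bounded below; compactness
  of K then makes a subsequence of them converge, and the induction hypothesis places its limit in
  the previous range.\<close>

lemma range_pow_closed:
  "(\<And>k. Y k \<in> range_pow n) \<Longrightarrow> y \<in> S \<Longrightarrow> (\<lambda>k. N (Y k - y)) \<longlonglongrightarrow> 0 \<Longrightarrow> y \<in> range_pow n"
proof (induction n arbitrary: Y y)
  case 0 then show ?case by (simp add: range_pow_0)
next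
  case (Suc n)
  have "\<forall>k. \<exists>z. z \<in> range_pow n \<and> Y k = A z" using Suc.prems(1) by (auto simp: range_pow_Suc)
  then obtain Z where Z: "\<And>k. Z k \<in> range_pow n" "\<And>k. Y k = A (Z k)" by metis
  have ZS: "Z k \<in> S" for k using Z(1) range_pow_subset by blast
  have YS: "Y k \<in> S" for k using Suc.prems(1) range_pow_subset by blast
  obtain c where c: "c > 0" "\<And>x. x \<in> S \<Longrightarrow> c * N x \<le> N (A x)" using bounded_below by blast
  obtain D where D: "\<And>k. N (Y k - y) \<le> D"
    using Bseq_def convergent_imp_Bseq[OF convergentI[OF Suc.prems(3)]] by (metis abs_le_D1 real_norm_def)
  have "N (Z k) \<le> (D + N y) / c" for k
  proof -
    have "N (Y k) \<le> N (Y k - y) + N y"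
      using N_add[OF S_closed(3)[OF YS Suc.prems(2)] Suc.prems(2), of k] by simp
    then have "c * N (Z k) \<le> D + N y" using c(2)[OF ZS, of k] D[of k] Z(2)[of k] by simp
    then show ?thesis using c(1) by (simp add: field_simps)
  qed
  then obtain r l where r: "strict_mono r" "l \<in> S" "(\<lambda>k. N (K (Z (r k)) - l)) \<longlonglongrightarrow> 0"
    using K_compact[of Z] ZS by blast
  \<comment> \<open>The limit of the preimages, read off from Z = Y - K Z.\<close>
  let ?z = "y - l"
  have zS: "?z \<in> S" using Suc.prems(2) r(2) S_closed by blast
  have sub: "(\<lambda>k. N (Y (r k) - y)) \<longlonglongrightarrow> 0" using subsequence_null[OF Suc.prems(3) r(1)] .
  have lim: "(\<lambda>k. N (Z (r k) - ?z)) \<longlonglongrightarrow> 0"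
  proof (rule tendsto_sandwich[OF _ _ tendsto_const])
    show "(\<lambda>k. N (Y (r k) - y) + N (K (Z (r k)) - l)) \<longlonglongrightarrow> 0"
      using tendsto_add[OF sub r(3)] by simp
    show "\<forall>\<^sub>F k in sequentially. 0 \<le> N (Z (r k) - ?z)"
      using N_nonneg ZS zS S_closed by (simp add: always_eventually)
    have "N (Z (r k) - ?z) \<le> N (Y (r k) - y) + N (K (Z (r k)) - l)" for k
    proof -
      have eq: "Z (r k) - ?z = (Y (r k) - y) - (K (Z (r k)) - l)" by (simp add: Z(2) A_def)
      show ?thesis unfolding eq
        using N_diff[OF S_closed(3)[OF YS Suc.prems(2)] S_closed(3)[OF K_in[OF ZS] r(2)], of "r k" "r k"] by simp
    qed
    then show "\<forall>\<^sub>F k in sequentially. N (Z (r k) - ?z) \<le> N (Y (r k) - y) + N (K (Z (r k)) - l)" by simp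
  qed
  have zn: "?z \<in> range_pow n" by (rule Suc.IH[OF Z(1) zS lim])
  obtain B where B: "\<And>x. x \<in> S \<Longrightarrow> N (A x) \<le> B * N x" using A_bounded by blast
  have "A ?z - y = 0"
  proof (rule eq_0_if_N_le_null)
    show "A ?z - y \<in> S" using A_in zS Suc.prems(2) S_closed by blast
    show "(\<lambda>k. B * N (Z (r k) - ?z) + N (Y (r k) - y)) \<longlonglongrightarrow> 0"
      using tendsto_add[OF tendsto_mult_right_zero[OF lim, of B] sub] by simp
    fix k
    have "A ?z - y = (Y (r k) - y) - A (Z (r k) - ?z)"
      using A_diff[OF ZS zS, of "r k"] by (simp only: Z(2)) simp
    then have "N (A ?z - y) \<le> N (Y (r k) - y) + N (A (Z (r k) - ?z))"
      using N_diff[OF S_closed(3)[OF YS Suc.prems(2)] A_in[OF S_closed(3)[OF ZS zS]], of "r k" "r k"]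
      by (simp only:)
    then show "N (A ?z - y) \<le> B * N (Z (r k) - ?z) + N (Y (r k) - y)"
      using B[OF S_closed(3)[OF ZS zS], of "r k"] by linarith
  qed
  then have "y = A ?z" by simp
  then show ?case using zn by (auto simp: range_pow_Suc)
qed

text \<open>Closedness gives \<open>y\<close> a positive distance d from the smaller range. Some w0
  in it is nearer than 2d, and normalising y - w0 by its norm q costs a factor below 2d: subtracting
  w corresponds to subtracting w0 + q w, which is again in that range.\<close>

lemma riesz_lemma:
  assumes "y \<in> range_pow n" "y \<notin> range_pow (Suc n)"
  shows "\<exists>x\<in>range_pow n. N x = 1 \<and> (\<forall>w\<in>range_pow (Suc n). N (x - w) \<ge> 1/2)"
proof -
  let ?M = "range_pow (Suc n)"
  have yS: "y \<in> S" using assms(1) range_pow_subset by blast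
  have MS: "w \<in> S" if "w \<in> ?M" for w using that range_pow_subset by blast
  have ne: "0 \<in> ?M" using subspace_S range_pow_linear(2)[of _ "Suc n" 0]
    by (metis A_in S_closed(1) image_eqI range_pow_def scale_zero_left)
  have "\<exists>d>0. \<forall>w\<in>?M. d \<le> N (y - w)"
  proof (rule ccontr)
    assume "\<not> ?thesis"
    then have neg: "\<And>d. d > 0 \<Longrightarrow> \<exists>w\<in>?M. N (y - w) < d" by (auto simp: not_le)
    have "\<forall>k. \<exists>w. w \<in> ?M \<and> N (y - w) < inverse (real (Suc k))"
      using neg[of "inverse (real (Suc _))"] by auto
    then obtain W where W: "\<And>k. W k \<in> ?M" "\<And>k. N (y - W k) < inverse (real (Suc k))" by metis
    have "(\<lambda>k. N (W k - y)) \<longlonglongrightarrow> 0"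
    proof (rule tendsto_sandwich[OF _ _ tendsto_const LIMSEQ_inverse_real_of_nat])
      show "\<forall>\<^sub>F k in sequentially. 0 \<le> N (W k - y)"
        using N_nonneg S_closed(3)[OF MS[OF W(1)] yS] by (simp add: always_eventually)
      show "\<forall>\<^sub>F k in sequentially. N (W k - y) \<le> inverse (real (Suc k))"
        using W(2) N_minus_commute[OF yS MS[OF W(1)]] by (simp add: always_eventually less_imp_le)
    qed
    then show False using range_pow_closed[of W "Suc n" y, OF W(1) yS] assms(2) by blast
  qed
  then obtain d0 where d0: "d0 > 0" "\<And>w. w \<in> ?M \<Longrightarrow> d0 \<le> N (y - w)" by blast
  define d where "d = Inf ((\<lambda>w. N (y - w)) ` ?M)"
  have bdd: "bdd_below ((\<lambda>w. N (y - w)) ` ?M)" using d0(2) by (intro bdd_belowI2)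
  have d: "d \<ge> d0" unfolding d_def using ne d0(2) by (intro cINF_greatest) auto
  have dle: "d \<le> N (y - w)" if "w \<in> ?M" for w unfolding d_def by (rule cINF_lower[OF bdd that])
  have "d < 2 * d" using d d0 by simp
  then obtain w0 where w0: "w0 \<in> ?M" "N (y - w0) < 2 * d"
    unfolding d_def using cInf_lessD[of "(\<lambda>w. N (y - w)) ` ?M"] ne by blast
  define q where "q = N (y - w0)"
  have q: "q > 0" "q < 2 * d" using dle[OF w0(1)] d d0 w0 by (auto simp: q_def)
  have yw: "y - w0 \<in> range_pow n" using assms(1) w0(1) range_pow_antimono by (intro range_pow_diff) auto
  have ywS: "y - w0 \<in> S" using yw range_pow_subset by blast
  let ?x = "inverse q *\<^sub>R (y - w0)"
  have "N (?x - w) \<ge> 1/2" if w: "w \<in> ?M" for w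
  proof -
    have in': "w0 + q *\<^sub>R w \<in> ?M" using w w0(1) by (intro range_pow_linear)
    have "?x - w = inverse q *\<^sub>R (y - (w0 + q *\<^sub>R w))"
      using q by (simp add: scaleR_diff_right scaleR_add_right)
    then have "N (?x - w) = inverse q * N (y - (w0 + q *\<^sub>R w))"
      using N_scaleR[OF S_closed(3)[OF yS MS[OF in']], of "inverse q"] q by simp
    moreover have "inverse q * d \<le> inverse q * N (y - (w0 + q *\<^sub>R w))"
      using dle[OF in'] q by (intro mult_left_mono) auto
    moreover have "1/2 \<le> inverse q * d" using q by (simp add: field_simps)
    ultimately show ?thesis by linarith
  qed
  moreover have "N ?x = 1" using N_scaleR[OF ywS] q by (simp add: q_def)
  moreover have "?x \<in> range_pow n" using yw by (rule range_pow_linear)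
  ultimately show ?thesis by blast
qed

text \<open>If A were not onto, injectivity would make the chain of ranges strictly decreasing, and
  the Riesz lemma would give unit vectors whose images under K stay 1/2 apart.\<close>

lemma surjective: "A ` S = S"
proof (rule ccontr)
  assume "A ` S \<noteq> S"
  then obtain y where y: "y \<in> S" "y \<notin> A ` S" using A_in by blast
  \<comment> \<open>The missing point is pushed down the chain; injectivity keeps its n-th image out
    of the next range.\<close>
  have yn: "(A ^^ n) y \<in> range_pow n \<and> (A ^^ n) y \<notin> range_pow (Suc n)" for n
  proof (induction n)
    case 0 then show ?case using y by (simp add: range_pow_def)
  next
    case (Suc n)
    have "(A ^^ Suc n) y \<notin> range_pow (Suc (Suc n))"
    proof
      assume "(A ^^ Suc n) y \<in> range_pow (Suc (Suc n))"
      then obtain w where w: "w \<in> range_pow (Suc n)" "A ((A ^^ n) y) = A w"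
        by (auto simp: range_pow_Suc)
      have S: "w \<in> S" "(A ^^ n) y \<in> S" using w(1) Suc range_pow_subset by blast+
      then have "A ((A ^^ n) y - w) = 0" using w(2) by (simp add: A_diff)
      then have "(A ^^ n) y - w = 0" using inj[OF S_closed(3)[OF S(2,1)]] by (simp only: A_def)
      then show False using Suc w(1) by simp
    qed
    then show ?case using Suc by (simp add: range_pow_Suc)
  qed
  have "\<forall>n. \<exists>x. x \<in> range_pow n \<and> N x = 1 \<and> (\<forall>w\<in>range_pow (Suc n). N (x - w) \<ge> 1/2)"
    using riesz_lemma yn by blast
  then obtain X where X: "\<And>n. X n \<in> range_pow n" "\<And>n. N (X n) = 1"
    "\<And>n w. w \<in> range_pow (Suc n) \<Longrightarrow> N (X n - w) \<ge> 1/2" by metis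
  have XS: "X n \<in> S" for n using X(1) range_pow_subset by blast
  obtain r l where r: "strict_mono r" "l \<in> S" "(\<lambda>n. N (K (X (r n)) - l)) \<longlonglongrightarrow> 0"
    using K_compact[of X 1] XS X(2) by auto
  have "\<forall>\<^sub>F n in sequentially. N (K (X (r n)) - l) < 1/4"
    using r(3) by (intro order_tendstoD) auto
  then obtain n0 where n0: "\<And>n. n \<ge> n0 \<Longrightarrow> N (K (X (r n)) - l) < 1/4"
    by (auto simp: eventually_sequentially)
  define n m where "n = r n0" and "m = r (Suc n0)"
  have nm: "n < m" using r(1) by (simp add: n_def m_def strict_mono_def)
  have KS: "K (X n) - l \<in> S" "K (X m) - l \<in> S" using K_in XS r(2) S_closed by blast+
  have "N (K (X n) - K (X m)) \<le> N (K (X n) - l) + N (K (X m) - l)"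
    using N_diff[OF KS] by simp
  then have small: "N (K (X n) - K (X m)) < 1/2"
    using n0[of n0] n0[of "Suc n0"] by (simp add: n_def m_def)
  \<comment> \<open>Chosen so that X n - w is K (X m) - K (X n); all three terms lie in the range of
    index n + 1 because n < m.\<close>
  let ?w = "A (X n) - A (X m) + X m"
  have "A (X n) \<in> range_pow (Suc n)" using X(1) by (simp add: range_pow_Suc)
  moreover have "A (X m) \<in> range_pow (Suc m)" using X(1) by (simp add: range_pow_Suc)
  then have "A (X m) \<in> range_pow (Suc n)" using range_pow_le[of "Suc n" "Suc m"] nm by auto
  moreover have "X m \<in> range_pow (Suc n)" using range_pow_le[of "Suc n" m] nm X(1)[of m] by auto
  ultimately have w: "?w \<in> range_pow (Suc n)" by (intro range_pow_linear range_pow_diff)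
  have "N (X n - ?w) \<ge> 1/2" by (rule X(3)[OF w])
  moreover have "X n - ?w = K (X m) - K (X n)" by (simp add: A_def)
  ultimately show False using small N_minus_commute[OF K_in[OF XS] K_in[OF XS], of n m] by simp
qed

end

section \<open>Compactness in Hoelder spaces\<close>

text \<open>Arzela-Ascoli on a period cell gives uniform convergence; the limit inherits the bound
  at exponent a, and interpolating against that bound upgrades the convergence to any smaller
  exponent.\<close>

lemma hoelder_compact:
  fixes X :: "nat \<Rightarrow> real^'n::finite \<Rightarrow> real"
  assumes per: "\<And>n. periodic (X n)" and X: "\<And>n. hb a M (X n)" and ab: "0 < b" "b < a"
  obtains r \<xi> e where "strict_mono (r::nat \<Rightarrow> nat)" "periodic \<xi>" "hb a M \<xi>" "e \<longlonglongrightarrow> 0"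
    "\<And>n. hb b (e n) (\<lambda>x. X (r n) x - \<xi> x)"
proof -
  have M: "M \<ge> 0" using hb_nonneg[OF X] .
  have X1: "\<bar>X n x\<bar> \<le> M" and X2: "\<bar>X n x - X n y\<bar> \<le> M * dist x y powr a" for n x y
    using X by (auto simp: hb_def)
  have equi: "\<exists>d>0. \<forall>n y. y \<in> unit_cube \<and> norm (x - y) < d \<longrightarrow> norm (X n x - X n y) < e"
    if "0 < e" for x e
  proof (intro exI conjI allI impI)
    \<comment> \<open>M + 1 in the denominator avoids a division by zero when M = 0.\<close>
    let ?d = "(e / (M + 1)) powr (1/a)"
    show "?d > 0" using that M by simp
    fix n y assume "y \<in> unit_cube \<and> norm (x - y) < ?d"
    then have "dist x y < ?d" by (simp add: dist_norm)
    then have "dist x y powr a < ?d powr a" using ab by (intro powr_less_mono2) auto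
    also have "?d powr a = e / (M + 1)" using ab that M by (simp add: powr_powr)
    finally have "(M + 1) * dist x y powr a < e" using M by (simp add: field_simps)
    moreover have "M * dist x y powr a \<le> (M + 1) * dist x y powr a" by (intro mult_right_mono) auto
    ultimately show "norm (X n x - X n y) < e" using X2[of n x y] by simp
  qed
  obtain g r where r: "strict_mono (r :: nat \<Rightarrow> nat)"
    "\<And>e. 0 < e \<Longrightarrow> \<exists>N. \<forall>n x. n \<ge> N \<and> x \<in> unit_cube \<longrightarrow> norm (X (r n) x - g x) < e"
    using Arzela_Ascoli[OF compact_unit_cube, of X M] X1 equi by (metis real_norm_def)
  \<comment> \<open>The limit is known on the cube only and is extended from there through the
    fractional parts.\<close>
  define \<xi> where "\<xi> x = g (frac_vec x)" for x
  have conv: "\<exists>N. \<forall>n\<ge>N. \<forall>x. \<bar>X (r n) x - \<xi> x\<bar> < e" if "0 < e" for e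
    using r(2)[OF that] frac_vec_in_unit_cube periodic_frac_vec[OF per]
    by (metis \<xi>_def real_norm_def)
  have lim: "(\<lambda>n. X (r n) x) \<longlonglongrightarrow> \<xi> x" for x
    unfolding LIMSEQ_iff using conv by (metis real_norm_def)
  have xi: "hb a M \<xi>" unfolding hb_def
  proof (intro conjI allI)
    fix x y
    show "\<bar>\<xi> x\<bar> \<le> M"
      by (rule tendsto_upperbound[OF tendsto_rabs[OF lim]]) (auto simp: X1)
    show "\<bar>\<xi> x - \<xi> y\<bar> \<le> M * dist x y powr a"
      by (rule tendsto_upperbound[OF tendsto_rabs[OF tendsto_diff[OF lim lim]]]) (auto simp: X2)
  qed
  have pxi: "periodic \<xi>" unfolding periodic_def
    using lim per LIMSEQ_unique unfolding periodic_def by (metis (no_types, lifting) LIMSEQ_unique ext)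
  define s where "s n = (SUP x. \<bar>X (r n) x - \<xi> x\<bar>)" for n
  have xi1: "\<bar>\<xi> x\<bar> \<le> M" for x using xi by (simp add: hb_def)
  have bd: "\<bar>X (r n) x - \<xi> x\<bar> \<le> 2 * M" for n x using X1[of "r n" x] xi1[of x] by linarith
  have s: "\<bar>X (r n) x - \<xi> x\<bar> \<le> s n" for n x
    unfolding s_def by (rule cSUP_upper) (use bd in \<open>auto intro!: bdd_aboveI2[of UNIV _ "2 * M"]\<close>)
  have s0: "s \<longlonglongrightarrow> 0"
  proof (rule LIMSEQ_I)
    fix e :: real assume e: "0 < e"
    obtain n0 where n0: "\<And>n x. n \<ge> n0 \<Longrightarrow> \<bar>X (r n) x - \<xi> x\<bar> < e/2" using conv[of "e/2"] e by auto
    have "norm (s n - 0) < e" if "n \<ge> n0" for n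
    proof -
      have "s n \<le> e/2" unfolding s_def using n0[OF that] by (intro cSUP_least) (auto intro: less_imp_le)
      moreover have "s n \<ge> 0" using s[of n undefined] by linarith
      ultimately show ?thesis using e by simp
    qed
    then show "\<exists>no. \<forall>n\<ge>no. norm (s n - 0) < e" by blast
  qed
  define e where "e n = s n + (2 * s n) powr (1 - b/a) * (2 * M) powr (b/a)" for n
  have sn: "s n \<ge> 0" for n using s[of n undefined] by linarith
  have ba: "b/a < 1" using ab by simp
  have "(\<lambda>n. (2 * s n) powr (1 - b/a)) \<longlonglongrightarrow> 0 powr (1 - b/a)"
    by (rule tendsto_powr'[OF tendsto_mult_right_zero[OF s0] tendsto_const]) (use sn ba in auto)
  then have "e \<longlonglongrightarrow> 0"
    unfolding e_def using tendsto_add[OF s0 tendsto_mult_left_zero] by fastforce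
  moreover have "hb b (e n) (\<lambda>x. X (r n) x - \<xi> x)" for n
    unfolding hb_def
  proof (intro conjI allI)
    fix x y
    have p: "0 \<le> (2 * s n) powr (1 - b/a) * (2 * M) powr (b/a)" by simp
    show "\<bar>X (r n) x - \<xi> x\<bar> \<le> e n" using s[of n x] p unfolding e_def by linarith
    have "\<bar>X (r n) x - \<xi> x - (X (r n) y - \<xi> y)\<bar> \<le> ((2 * s n) powr (1 - b/a) * (2 * M) powr (b/a)) * dist x y powr b"
    proof (rule hoelder_interpolation[of "\<lambda>x. X (r n) x - \<xi> x"])
      show "\<bar>X (r n) x - \<xi> x - (X (r n) y - \<xi> y)\<bar> \<le> (2 * M) * dist x y powr a" for x y
        using hb_diff[OF X xi] by (simp add: hb_def)
    qed (use s ab M in auto)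
    also have "\<dots> \<le> e n * dist x y powr b"
      using sn by (intro mult_right_mono) (auto simp: e_def)
    finally show "\<bar>X (r n) x - \<xi> x - (X (r n) y - \<xi> y)\<bar> \<le> e n * dist x y powr b" .
  qed
  ultimately show ?thesis using that[OF r(1) pxi xi] by blast
qed

section \<open>Hoelder norms\<close>

lemma supn_le: "(\<And>x. \<bar>w x\<bar> \<le> M) \<Longrightarrow> supn w \<le> M"
  unfolding supn_def by (rule cSUP_least) auto

text \<open>The supremum of an unbounded set is an unspecified number, so some bound must be
  supplied; its size does not enter the conclusion.\<close>

lemma le_supn: "(\<And>x. \<bar>w x\<bar> \<le> M) \<Longrightarrow> \<bar>w x\<bar> \<le> supn w"
  unfolding supn_def by (rule cSUP_upper) (auto intro!: bdd_aboveI2[of UNIV _ M])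

lemma holder_semi_le:
  fixes w :: "real^'n::finite \<Rightarrow> real"
  assumes "\<And>x y. \<bar>w x - w y\<bar> \<le> M * dist x y powr a"
  shows "holder_semi a w \<le> M"
  unfolding holder_semi_def
proof (rule cSup_least)
  \<comment> \<open>Two distinct points, so that the supremum is not taken over the empty
    set.\<close>
  have "(0::real^'n) \<noteq> axis undefined 1" by (simp add: axis_eq_0_iff eq_commute[of 0])
  then show "{\<bar>w x - w y\<bar> / dist x y powr a |x y. x \<noteq> y} \<noteq> {}" by blast
  fix q assume "q \<in> {\<bar>w x - w y\<bar> / dist x y powr a |x y. x \<noteq> y}"
  then obtain x y where "x \<noteq> y" "q = \<bar>w x - w y\<bar> / dist x y powr a" by blast
  then show "q \<le> M" using assms[of x y] by (simp add: divide_le_eq)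
qed

lemma le_holder_semi:
  assumes "\<And>x y. \<bar>w x - w y\<bar> \<le> M * dist x y powr a"
  shows "\<bar>w x - w y\<bar> \<le> holder_semi a w * dist x y powr a"
proof (cases "x = y")
  case False
  have "\<bar>w x - w y\<bar> / dist x y powr a \<le> holder_semi a w"
    unfolding holder_semi_def
  proof (rule cSup_upper)
    show "bdd_above {\<bar>w x - w y\<bar> / dist x y powr a |x y. x \<noteq> y}"
      using assms by (intro bdd_aboveI[of _ M]) (auto simp: divide_le_eq)
  qed (use False in blast)
  then show ?thesis using False by (simp add: divide_le_eq)
qed simp

lemma holder_semi_nonneg:
  fixes w :: "real^'n::finite \<Rightarrow> real"
  assumes "\<And>x y. \<bar>w x - w y\<bar> \<le> M * dist x y powr a"
  shows "0 \<le> holder_semi a w"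
proof -
  have "(0::real^'n) \<noteq> axis undefined 1" by (simp add: axis_eq_0_iff eq_commute[of 0])
  then have p: "0 < dist (0::real^'n) (axis undefined 1) powr a" by simp
  have "0 \<le> holder_semi a w * dist (0::real^'n) (axis undefined 1) powr a"
    using le_holder_semi[OF assms, of 0 "axis undefined 1"] abs_ge_zero order_trans by blast
  then show ?thesis using p by (simp add: zero_le_mult_iff)
qed

text \<open>\<open>C2a\<close> provides a separate Hoelder constant for each pair of indices. The
  sum of their absolute values dominates them all, and periodicity turns it into bounds on the
  derivatives.\<close>

lemma C2a_bounded:
  fixes w :: "real^'n::finite \<Rightarrow> real"
  assumes "C2a a w" "0 < a"
  obtains B where "\<And>x. \<bar>w x\<bar> \<le> B" "\<And>i x. \<bar>pd i w x\<bar> \<le> B" "\<And>i j x. \<bar>pd j (pd i w) x\<bar> \<le> B"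
    "\<And>i j x y. \<bar>pd j (pd i w) x - pd j (pd i w) y\<bar> \<le> B * dist x y powr a"
proof -
  have w: "periodic w" "C2 w" using assms by (auto simp: C2a_def)
  have "\<forall>i j. \<exists>C. \<forall>x y. \<bar>pd j (pd i w) x - pd j (pd i w) y\<bar> \<le> C * dist x y powr a"
    using assms(1) by (auto simp: C2a_def holder_bdd_def)
  then obtain C where C: "\<And>i j x y. \<bar>pd j (pd i w) x - pd j (pd i w) y\<bar> \<le> C i j * dist x y powr a" by metis
  define D where "D = (\<Sum>i\<in>UNIV. \<Sum>j\<in>UNIV. \<bar>C i j\<bar>)"
  have le: "C i j \<le> D" for i j
  proof -
    have "C i j \<le> (\<Sum>j\<in>UNIV. \<bar>C i j\<bar>)"
      using member_le_sum[of j UNIV "\<lambda>j. \<bar>C i j\<bar>"] by simp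
    also have "\<dots> \<le> D" unfolding D_def
      using member_le_sum[of i UNIV "\<lambda>i. \<Sum>j\<in>UNIV. \<bar>C i j\<bar>"] by (simp add: sum_nonneg)
    finally show ?thesis .
  qed
  have D: "D \<ge> 0" by (simp add: D_def sum_nonneg)
  have h: "\<bar>pd j (pd i w) x - pd j (pd i w) y\<bar> \<le> D * dist x y powr a" for i j x y
    using C[of j i x y] mult_right_mono[OF le[of i j], of "dist x y powr a"] by simp
  note b = periodic_second_derivative_bounds[OF w D assms(2) h]
  obtain E where E: "\<And>x. \<bar>w x\<bar> \<le> E" using periodic_bounded[OF w(1) C2_continuous[OF w(2)]] by blast
  have E0: "E \<ge> 0" using E[of undefined] by linarith
  let ?B = "E + (1 + real CARD('n)) * D"
  have "E \<le> ?B" "real CARD('n) * D \<le> ?B" "D \<le> ?B" using D E0 by (auto simp: distrib_right)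
  note B = this
  show ?thesis
  proof (rule that[of ?B])
    show "\<bar>pd j (pd i w) x - pd j (pd i w) y\<bar> \<le> ?B * dist x y powr a" for i j x y
      using h[of j i x y] mult_right_mono[OF B(3), of "dist x y powr a"] by simp
  qed (use order_trans[OF E B(1)] order_trans[OF b(1) B(3)] order_trans[OF b(2) B(2)] in auto)
qed

lemma c2b_norm2a:
  fixes w :: "real^'n::finite \<Rightarrow> real"
  assumes "C2a a w" "0 < a"
  shows "c2b a (norm2a a w) w"
proof -
  obtain B where B: "\<And>x. \<bar>w x\<bar> \<le> B" "\<And>i x. \<bar>pd i w x\<bar> \<le> B" "\<And>i j x. \<bar>pd j (pd i w) x\<bar> \<le> B"
    "\<And>i j x y. \<bar>pd j (pd i w) x - pd j (pd i w) y\<bar> \<le> B * dist x y powr a" using C2a_bounded[OF assms] by blast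
  let ?s0 = "supn w" and ?s1 = "\<lambda>i. supn (pd i w)" and ?s2 = "\<lambda>i j. supn (pd j (pd i w))"
    and ?s3 = "\<lambda>i j. holder_semi a (pd j (pd i w))"
  have ge: "\<bar>w x\<bar> \<le> ?s0" "\<bar>pd i w x\<bar> \<le> ?s1 i" "\<bar>pd j (pd i w) x\<bar> \<le> ?s2 i j"
    "\<bar>pd j (pd i w) x - pd j (pd i w) y\<bar> \<le> ?s3 i j * dist x y powr a" for i j x y
    using le_supn[OF B(1)] le_supn[OF B(2)] le_supn[OF B(3)] le_holder_semi[OF B(4)] by auto
  have nn: "0 \<le> ?s0" "0 \<le> ?s1 i" "0 \<le> ?s2 i j" "0 \<le> ?s3 i j" for i j
    using order_trans[OF abs_ge_zero ge(1)] order_trans[OF abs_ge_zero ge(2)]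
      order_trans[OF abs_ge_zero ge(3)] holder_semi_nonneg[OF B(4)] by auto
  have sums: "0 \<le> (\<Sum>i\<in>UNIV. ?s1 i)" "0 \<le> (\<Sum>i\<in>UNIV. \<Sum>j\<in>UNIV. ?s2 i j)" "0 \<le> (\<Sum>i\<in>UNIV. \<Sum>j\<in>UNIV. ?s3 i j)"
    by (auto intro!: sum_nonneg nn)
  have le1: "?s1 i \<le> (\<Sum>i\<in>UNIV. ?s1 i)" for i by (rule member_le_sum) (auto intro: nn)
  have le2: "?s2 i j \<le> (\<Sum>i\<in>UNIV. \<Sum>j\<in>UNIV. ?s2 i j)" for i j
  proof -
    have "?s2 i j \<le> (\<Sum>j\<in>UNIV. ?s2 i j)" by (rule member_le_sum) (auto intro: nn)
    also have "\<dots> \<le> (\<Sum>i\<in>UNIV. \<Sum>j\<in>UNIV. ?s2 i j)"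
      by (rule member_le_sum[of i UNIV "\<lambda>i. \<Sum>j\<in>UNIV. ?s2 i j"]) (auto intro!: nn sum_nonneg)
    finally show ?thesis .
  qed
  have le3: "?s3 i j \<le> (\<Sum>i\<in>UNIV. \<Sum>j\<in>UNIV. ?s3 i j)" for i j
  proof -
    have "?s3 i j \<le> (\<Sum>j\<in>UNIV. ?s3 i j)" by (rule member_le_sum) (auto intro: nn)
    also have "\<dots> \<le> (\<Sum>i\<in>UNIV. \<Sum>j\<in>UNIV. ?s3 i j)"
      by (rule member_le_sum[of i UNIV "\<lambda>i. \<Sum>j\<in>UNIV. ?s3 i j"]) (auto intro!: nn sum_nonneg)
    finally show ?thesis .
  qed
  have le: "?s0 \<le> norm2a a w" "?s1 i \<le> norm2a a w" "?s2 i j \<le> norm2a a w" "?s3 i j \<le> norm2a a w" for i j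
    unfolding norm2a_def using nn(1) sums le1[of i] le2[of j i] le3[of j i] by linarith+
  have "\<bar>w x\<bar> \<le> norm2a a w" "\<bar>pd i w x\<bar> \<le> norm2a a w" for i x
    using ge(1)[of x] ge(2)[of i x] le(1) le(2)[of i] by linarith+
  moreover have "hb a (norm2a a w) (pd j (pd i w))" for i j
    unfolding hb_def
  proof (intro conjI allI)
    fix x y
    show "\<bar>pd j (pd i w) x\<bar> \<le> norm2a a w" using ge(3)[of j i x] le(3)[of j i] by linarith
    show "\<bar>pd j (pd i w) x - pd j (pd i w) y\<bar> \<le> norm2a a w * dist x y powr a"
      using ge(4)[of j i x y] mult_right_mono[OF le(4)[of j i], of "dist x y powr a"] by simp
  qed
  ultimately show ?thesis unfolding c2b_def using assms(1) by blast
qed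

text \<open>The factor counts the terms of the norm: one function, d first derivatives, and d^2
  second derivatives counted twice, for supremum and seminorm.\<close>

lemma norm2a_le:
  fixes w :: "real^'n::finite \<Rightarrow> real"
  assumes "c2b a M w"
  shows "norm2a a w \<le> (1 + real CARD('n) + 2 * (real CARD('n))\<^sup>2) * M"
proof -
  let ?n = "real CARD('n)"
  have "supn w \<le> M" using assms by (intro supn_le) (auto simp: c2b_def)
  moreover have "(\<Sum>i\<in>UNIV. supn (pd i w)) \<le> (\<Sum>i::'n\<in>UNIV. M)"
    using assms by (intro sum_mono supn_le) (auto simp: c2b_def)
  moreover have "(\<Sum>i\<in>UNIV. \<Sum>j\<in>UNIV. supn (pd j (pd i w))) \<le> (\<Sum>i::'n\<in>UNIV. \<Sum>j::'n\<in>UNIV. M)"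
    using assms by (intro sum_mono supn_le) (auto simp: c2b_def hb_def)
  moreover have "(\<Sum>i\<in>UNIV. \<Sum>j\<in>UNIV. holder_semi a (pd j (pd i w))) \<le> (\<Sum>i::'n\<in>UNIV. \<Sum>j::'n\<in>UNIV. M)"
    using assms by (intro sum_mono holder_semi_le) (auto simp: c2b_def hb_def)
  ultimately have "norm2a a w \<le> M + ?n * M + ?n * (?n * M) + ?n * (?n * M)"
    unfolding norm2a_def sum_constant by linarith
  also have "\<dots> = (1 + ?n + 2 * ?n\<^sup>2) * M" by (simp add: algebra_simps power2_eq_square)
  finally show ?thesis .
qed

section \<open>Linear structure of the Hoelder spaces and their norms\<close>

lemma C2a_add:
  assumes "C2a a u" "C2a a v" shows "C2a a (\<lambda>x. u x + v x)"
proof -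
  have c: "C2 u" "C2 v" using assms by (auto simp: C2a_def)
  have "holder_bdd a (\<lambda>x. pd j (pd i u) x + pd j (pd i v) x)" for i j
  proof -
    obtain C C' where "\<And>x y. \<bar>pd j (pd i u) x - pd j (pd i u) y\<bar> \<le> C * dist x y powr a"
      "\<And>x y. \<bar>pd j (pd i v) x - pd j (pd i v) y\<bar> \<le> C' * dist x y powr a"
      using assms by (auto simp: C2a_def holder_bdd_def) metis
    note * = this
    have "\<bar>pd j (pd i u) x + pd j (pd i v) x - (pd j (pd i u) y + pd j (pd i v) y)\<bar> \<le> (C + C') * dist x y powr a" for x y
      using *(1)[of x y] *(2)[of x y] unfolding distrib_right by linarith
    then show ?thesis unfolding holder_bdd_def by blast
  qed
  then show ?thesis using assms C2_add[OF c]
    unfolding C2a_def pd_pd_add[OF c] by (simp add: periodic_def)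
qed

lemma C2a_cmult:
  assumes "C2a a u" shows "C2a a (\<lambda>x. c * u x)"
proof -
  have c: "C2 u" using assms by (auto simp: C2a_def)
  have "holder_bdd a (\<lambda>x. c * pd j (pd i u) x)" for i j
  proof -
    obtain C where *: "\<And>x y. \<bar>pd j (pd i u) x - pd j (pd i u) y\<bar> \<le> C * dist x y powr a"
      using assms by (auto simp: C2a_def holder_bdd_def) metis
    have "\<bar>c * pd j (pd i u) x - c * pd j (pd i u) y\<bar> \<le> (\<bar>c\<bar> * C) * dist x y powr a" for x y
      using mult_left_mono[OF *[of x y], of "\<bar>c\<bar>"]
      by (simp add: right_diff_distrib[symmetric] abs_mult mult.assoc)
    then show ?thesis unfolding holder_bdd_def by blast
  qed
  then show ?thesis using assms C2_cmult[OF c]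
    unfolding C2a_def pd_pd_cmult[OF c] by (simp add: periodic_def)
qed

lemma norm2a_add:
  fixes u v :: "real^'n::finite \<Rightarrow> real"
  assumes "C2a a u" "C2a a v" "0 < a"
  shows "norm2a a (\<lambda>x. u x + v x) \<le> norm2a a u + norm2a a v"
proof -
  have c: "C2 u" "C2 v" using assms by (auto simp: C2a_def)
  obtain B where B: "\<And>x. \<bar>u x\<bar> \<le> B" "\<And>i x. \<bar>pd i u x\<bar> \<le> B" "\<And>i j x. \<bar>pd j (pd i u) x\<bar> \<le> B"
    "\<And>i j x y. \<bar>pd j (pd i u) x - pd j (pd i u) y\<bar> \<le> B * dist x y powr a" using C2a_bounded[OF assms(1,3)] by blast
  obtain B' where B': "\<And>x. \<bar>v x\<bar> \<le> B'" "\<And>i x. \<bar>pd i v x\<bar> \<le> B'" "\<And>i j x. \<bar>pd j (pd i v) x\<bar> \<le> B'"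
    "\<And>i j x y. \<bar>pd j (pd i v) x - pd j (pd i v) y\<bar> \<le> B' * dist x y powr a" using C2a_bounded[OF assms(2,3)] by blast
  have s: "supn (\<lambda>x. f x + g x) \<le> supn f + supn g"
    if "\<And>x. \<bar>f x\<bar> \<le> C" "\<And>x. \<bar>g x\<bar> \<le> C'" for f g :: "real^'n \<Rightarrow> real" and C C'
  proof (rule supn_le)
    show "\<bar>f x + g x\<bar> \<le> supn f + supn g" for x
      using le_supn[of f C x, OF that(1)] le_supn[of g C' x, OF that(2)] by linarith
  qed
  have h: "holder_semi a (\<lambda>x. f x + g x) \<le> holder_semi a f + holder_semi a g"
    if "\<And>x y. \<bar>f x - f y\<bar> \<le> C * dist x y powr a" "\<And>x y. \<bar>g x - g y\<bar> \<le> C' * dist x y powr a"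
    for f g :: "real^'n \<Rightarrow> real" and C C'
  proof (rule holder_semi_le)
    show "\<bar>f x + g x - (f y + g y)\<bar> \<le> (holder_semi a f + holder_semi a g) * dist x y powr a" for x y
      using le_holder_semi[OF that(1), of x y] le_holder_semi[OF that(2), of x y] unfolding distrib_right by linarith
  qed
  have "supn (\<lambda>x. u x + v x) \<le> supn u + supn v" by (rule s[OF B(1) B'(1)])
  moreover have "(\<Sum>i\<in>UNIV. supn (\<lambda>x. pd i u x + pd i v x)) \<le> (\<Sum>i\<in>UNIV. supn (pd i u)) + (\<Sum>i\<in>UNIV. supn (pd i v))"
    unfolding sum.distrib[symmetric] by (intro sum_mono s[OF B(2) B'(2)])
  moreover have "(\<Sum>i\<in>UNIV. \<Sum>j\<in>UNIV. supn (\<lambda>x. pd j (pd i u) x + pd j (pd i v) x)) \<le>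
      (\<Sum>i\<in>UNIV. \<Sum>j\<in>UNIV. supn (pd j (pd i u))) + (\<Sum>i\<in>UNIV. \<Sum>j\<in>UNIV. supn (pd j (pd i v)))"
    unfolding sum.distrib[symmetric] by (intro sum_mono s[OF B(3) B'(3)])
  moreover have "(\<Sum>i\<in>UNIV. \<Sum>j\<in>UNIV. holder_semi a (\<lambda>x. pd j (pd i u) x + pd j (pd i v) x)) \<le>
      (\<Sum>i\<in>UNIV. \<Sum>j\<in>UNIV. holder_semi a (pd j (pd i u))) + (\<Sum>i\<in>UNIV. \<Sum>j\<in>UNIV. holder_semi a (pd j (pd i v)))"
    unfolding sum.distrib[symmetric] by (intro sum_mono h[OF B(4) B'(4)])
  ultimately show ?thesis unfolding norm2a_def pd_pd_add[OF c] unfolding pd_C2_add[OF c] by linarith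
qed

lemma norm2a_cmult:
  fixes u :: "real^'n::finite \<Rightarrow> real"
  assumes "C2a a u" "0 < a"
  shows "norm2a a (\<lambda>x. c * u x) \<le> \<bar>c\<bar> * norm2a a u"
proof -
  have c2: "C2 u" using assms by (auto simp: C2a_def)
  obtain B where B: "\<And>x. \<bar>u x\<bar> \<le> B" "\<And>i x. \<bar>pd i u x\<bar> \<le> B" "\<And>i j x. \<bar>pd j (pd i u) x\<bar> \<le> B"
    "\<And>i j x y. \<bar>pd j (pd i u) x - pd j (pd i u) y\<bar> \<le> B * dist x y powr a" using C2a_bounded[OF assms] by blast
  have s: "supn (\<lambda>x. c * f x) \<le> \<bar>c\<bar> * supn f"
    if "\<And>x. \<bar>f x\<bar> \<le> C" for f :: "real^'n \<Rightarrow> real" and C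
    by (rule supn_le) (simp add: abs_mult mult_left_mono le_supn[of f, OF that])
  have h: "holder_semi a (\<lambda>x. c * f x) \<le> \<bar>c\<bar> * holder_semi a f"
    if "\<And>x y. \<bar>f x - f y\<bar> \<le> C * dist x y powr a" for f :: "real^'n \<Rightarrow> real" and C
    using le_holder_semi[OF that] by (intro holder_semi_le)
      (auto simp: right_diff_distrib[symmetric] abs_mult mult.assoc intro: mult_left_mono)
  have "supn (\<lambda>x. c * u x) \<le> \<bar>c\<bar> * supn u" by (rule s[OF B(1)])
  moreover have "(\<Sum>i\<in>UNIV. supn (\<lambda>x. c * pd i u x)) \<le> \<bar>c\<bar> * (\<Sum>i\<in>UNIV. supn (pd i u))"
    unfolding sum_distrib_left by (intro sum_mono s[OF B(2)])
  moreover have "(\<Sum>i\<in>UNIV. \<Sum>j\<in>UNIV. supn (\<lambda>x. c * pd j (pd i u) x)) \<le> \<bar>c\<bar> * (\<Sum>i\<in>UNIV. \<Sum>j\<in>UNIV. supn (pd j (pd i u)))"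
    unfolding sum_distrib_left by (intro sum_mono s[OF B(3)])
  moreover have "(\<Sum>i\<in>UNIV. \<Sum>j\<in>UNIV. holder_semi a (\<lambda>x. c * pd j (pd i u) x)) \<le>
      \<bar>c\<bar> * (\<Sum>i\<in>UNIV. \<Sum>j\<in>UNIV. holder_semi a (pd j (pd i u)))"
    unfolding sum_distrib_left by (intro sum_mono h[OF B(4)])
  ultimately show ?thesis unfolding norm2a_def pd_pd_cmult[OF c2] unfolding pd_C2_cmult[OF c2] distrib_left by linarith
qed

section \<open>Bilinear expressions\<close>

definition grad_prod :: "(real^'n::finite \<Rightarrow> real) \<Rightarrow> (real^'n \<Rightarrow> real) \<Rightarrow> real^'n \<Rightarrow> real" where
  "grad_prod u w x = (\<Sum>i\<in>UNIV. pd i u x * pd i w x)"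

text \<open>div (m Du) with the product rule already carried out, so that it becomes a polynomial in
  the derivatives of m and u to which the \<open>hb\<close> rules apply.\<close>

definition div_prod :: "(real^'n::finite \<Rightarrow> real) \<Rightarrow> (real^'n \<Rightarrow> real) \<Rightarrow> real^'n \<Rightarrow> real" where
  "div_prod m u x = (\<Sum>i\<in>UNIV. m x * pd i (pd i u) x + pd i m x * pd i u x)"

lemma inner_grad: "grad u x \<bullet> grad w x = grad_prod u w x"
  by (simp add: grad_prod_def grad_def inner_vec_def)

lemma norm_grad_square: "(norm (grad u x))\<^sup>2 = grad_prod u u x"
  by (simp add: power2_norm_eq_inner inner_grad)

lemma dvg_scaleR_grad:
  assumes "C2 m" "C2 u"
  shows "dvg (\<lambda>y. m y *\<^sub>R grad u y) x = div_prod m u x"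
proof -
  have "pd i (\<lambda>y. m y * pd i u y) x = m x * pd i (pd i u) x + pd i m x * pd i u x" for i
    using assms by (intro pd_mult) (auto simp: C2_def)
  then show ?thesis by (simp add: dvg_def div_prod_def grad_def)
qed

lemma
  assumes "C2 u" "C2 v"
  shows C2_diff: "C2 (\<lambda>x. u x - v x)"
    and pd_C2_diff: "pd i (\<lambda>x. u x - v x) = (\<lambda>x. pd i u x - pd i v x)"
    and pd_pd_diff: "pd j (pd i (\<lambda>x. u x - v x)) = (\<lambda>x. pd j (pd i u) x - pd j (pd i v) x)"
  using C2_add[OF assms(1) C2_uminus[OF assms(2)]] pd_C2_add[OF assms(1) C2_uminus[OF assms(2)], of i]
    pd_pd_add[OF assms(1) C2_uminus[OF assms(2)], of j i] pd_uminus[OF assms(2)] pd_pd_uminus[OF assms(2)]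
  by auto

lemma grad_prod_commute: "grad_prod u w x = grad_prod w u x"
  by (simp add: grad_prod_def mult.commute)

lemma
  assumes "C2 w" "C2 w'"
  shows grad_prod_add: "grad_prod u (\<lambda>x. w x + w' x) x = grad_prod u w x + grad_prod u w' x"
    and grad_prod_diff: "grad_prod u (\<lambda>x. w x - w' x) x = grad_prod u w x - grad_prod u w' x"
    and div_prod_add: "div_prod u (\<lambda>x. w x + w' x) x = div_prod u w x + div_prod u w' x"
    and div_prod_diff: "div_prod u (\<lambda>x. w x - w' x) x = div_prod u w x - div_prod u w' x"
    and div_prod_add_left: "div_prod (\<lambda>x. w x + w' x) u x = div_prod w u x + div_prod w' u x"
    and div_prod_diff_left: "div_prod (\<lambda>x. w x - w' x) u x = div_prod w u x - div_prod w' u x"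
  unfolding grad_prod_def div_prod_def pd_pd_add[OF assms] pd_pd_diff[OF assms]
  unfolding pd_C2_add[OF assms] pd_C2_diff[OF assms]
  by (simp_all add: sum.distrib[symmetric] sum_subtractf[symmetric] algebra_simps)

lemma
  assumes "C2 w"
  shows grad_prod_cmult: "grad_prod u (\<lambda>x. c * w x) x = c * grad_prod u w x"
    and div_prod_cmult: "div_prod u (\<lambda>x. c * w x) x = c * div_prod u w x"
    and div_prod_cmult_left: "div_prod (\<lambda>x. c * w x) u x = c * div_prod w u x"
  unfolding grad_prod_def div_prod_def pd_pd_cmult[OF assms]
  unfolding pd_C2_cmult[OF assms]
  by (simp_all add: sum_distrib_left algebra_simps)

lemma periodic_grad_prod:
  "periodic u \<Longrightarrow> C2 u \<Longrightarrow> periodic w \<Longrightarrow> C2 w \<Longrightarrow> periodic (grad_prod u w)"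
  using periodic_pd[of u] periodic_pd[of w] by (simp add: C2_def periodic_def grad_prod_def)

lemma periodic_div_prod:
  "periodic u \<Longrightarrow> C2 u \<Longrightarrow> periodic w \<Longrightarrow> C2 w \<Longrightarrow> periodic (div_prod u w)"
  using periodic_pd[of u] periodic_pd[of w] periodic_pd[of "pd _ w"]
  by (simp add: C2_def periodic_def div_prod_def)

lemma c2b_C2: "c2b a M w \<Longrightarrow> C2 w" "c2b a M w \<Longrightarrow> periodic w"
  by (auto simp: c2b_def C2a_def)

lemma c2b_nonneg: "c2b a M w \<Longrightarrow> 0 \<le> M"
  unfolding c2b_def by (meson abs_ge_zero order_trans)

lemma c2b_mono: "c2b a M w \<Longrightarrow> M \<le> M' \<Longrightarrow> c2b a M' w"
  unfolding c2b_def using hb_mono order_trans by blast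

text \<open>The constant of the embedding of bounded C1 functions in a Hoelder class, as produced by
  \<open>hb_of_pd_bound\<close>.\<close>

definition emb :: "nat \<Rightarrow> real" where "emb d = 2 + real d"

lemma hb_c2b:
  fixes w :: "real^'n::finite \<Rightarrow> real"
  assumes "c2b a M w" "0 \<le> b" "b \<le> 1"
  shows "hb b (emb CARD('n) * M) w" "hb b (emb CARD('n) * M) (pd i w)"
proof -
  have d: "\<And>x. w differentiable (at x)" "\<And>i x. pd i w differentiable (at x)"
    and M: "\<And>x. \<bar>w x\<bar> \<le> M" "\<And>i x. \<bar>pd i w x\<bar> \<le> M" "\<And>i j x. \<bar>pd j (pd i w) x\<bar> \<le> M"
    using assms(1) by (auto simp: c2b_def C2a_def C2_def hb_def)
  show "hb b (emb CARD('n) * M) w" "hb b (emb CARD('n) * M) (pd i w)"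
    unfolding emb_def by (rule hb_of_pd_bound[OF M(1) d(1) M(2) assms(2,3)])
      (rule hb_of_pd_bound[OF M(2) d(2) M(3) assms(2,3)])
qed

lemma hb_grad_prod:
  fixes u w :: "real^'n::finite \<Rightarrow> real"
  assumes u: "c2b a M u" and w: "c2b a' M' w" and "0 \<le> b" "b \<le> 1"
  shows "hb b (4 * real CARD('n) * (emb CARD('n))\<^sup>2 * (M * M')) (grad_prod u w)"
proof -
  let ?c = "emb CARD('n)"
  have nn: "0 \<le> M * M'" using c2b_nonneg[OF u] c2b_nonneg[OF w] by simp
  have "hb b (real CARD('n) * (2 * (?c * M) * (?c * M'))) (grad_prod u w)"
    unfolding grad_prod_def by (intro hb_sum hb_mult hb_c2b[OF u] hb_c2b[OF w] assms)
  \<comment> \<open>2 would do here; the weaker 4 gives the same constant as for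
    \<open>div_prod\<close>.\<close>
  moreover have "real CARD('n) * (2 * (?c * M) * (?c * M')) \<le> 4 * real CARD('n) * ?c\<^sup>2 * (M * M')"
  proof -
    have "real CARD('n) * (2 * (?c * M) * (?c * M')) = 2 * (real CARD('n) * ?c\<^sup>2 * (M * M'))"
      by (simp add: power2_eq_square)
    also have "\<dots> \<le> 4 * (real CARD('n) * ?c\<^sup>2 * (M * M'))"
      using nn by (intro mult_right_mono) auto
    finally show ?thesis by (simp only: mult.assoc)
  qed
  ultimately show ?thesis by (rule hb_mono)
qed

text \<open>Second derivatives fall on \<open>u\<close> alone, so its exponent decides the class of
  the result. The first factor enters with its gradient only and may come from any class.\<close>

lemma hb_div_prod:
  fixes m u :: "real^'n::finite \<Rightarrow> real"
  assumes m: "c2b a M m" and u: "c2b b M' u" and b: "0 \<le> b" "b \<le> 1"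
  shows "hb b (4 * real CARD('n) * (emb CARD('n))\<^sup>2 * (M * M')) (div_prod m u)"
proof -
  let ?c = "emb CARD('n)"
  have "1 * M' \<le> ?c * M'" using c2b_nonneg[OF u] by (intro mult_right_mono) (auto simp: emb_def)
  then have "hb b (?c * M') (pd i (pd i u))" for i
    using u hb_mono[of b M' "pd i (pd i u)"] by (simp add: c2b_def)
  then have "hb b (real (card (UNIV :: 'n set)) * (2 * (?c * M) * (?c * M') + 2 * (?c * M) * (?c * M'))) (div_prod m u)"
    unfolding div_prod_def by (intro hb_sum hb_add hb_mult hb_c2b[OF u] hb_c2b[OF m] b)
  moreover have "real CARD('n) * (2 * (?c * M) * (?c * M') + 2 * (?c * M) * (?c * M')) = 4 * real CARD('n) * ?c\<^sup>2 * (M * M')"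
    by (simp add: power2_eq_square)
  ultimately show ?thesis by (simp only:)
qed

section \<open>The nonlinearity\<close>

lemma C2R_deriv:
  assumes "C2R f"
  shows "(f has_real_derivative deriv f s) (at s)" "(deriv f has_real_derivative deriv (deriv f) s) (at s)"
proof -
  have "(\<lambda>x. f x) field_differentiable (at s)" "deriv f field_differentiable (at s)"
    using assms unfolding C2R_def by (auto simp: field_differentiable_def real_differentiable_def)
  then show "(f has_real_derivative deriv f s) (at s)" "(deriv f has_real_derivative deriv (deriv f) s) (at s)"
    by (auto simp: field_differentiable_derivI)
qed

lemma C2R_bounds:
  assumes "C2R f"
  obtains F where "0 \<le> F" "\<And>s. \<bar>s\<bar> \<le> R \<Longrightarrow> \<bar>f s\<bar> \<le> F" "\<And>s. \<bar>s\<bar> \<le> R \<Longrightarrow> \<bar>deriv f s\<bar> \<le> F"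
    "\<And>s. \<bar>s\<bar> \<le> R \<Longrightarrow> \<bar>deriv (deriv f) s\<bar> \<le> F"
proof -
  have bd: "\<exists>B. \<forall>s. \<bar>s\<bar> \<le> R \<longrightarrow> \<bar>g s\<bar> \<le> B" if "continuous_on UNIV g" for g :: "real \<Rightarrow> real"
  proof -
    have "compact (g ` {-R..R})"
      using that by (intro compact_continuous_image continuous_on_subset[OF that]) auto
    then obtain B where "\<And>y. y \<in> g ` {-R..R} \<Longrightarrow> norm y \<le> B"
      using compact_imp_bounded bounded_iff by metis
    then show ?thesis by (intro exI[of _ B]) (auto simp: abs_le_iff)
  qed
  have c: "continuous_on UNIV f" "continuous_on UNIV (deriv f)" "continuous_on UNIV (deriv (deriv f))"
    using DERIV_isCont[OF C2R_deriv(1)[OF assms]] DERIV_isCont[OF C2R_deriv(2)[OF assms]] assms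
    by (auto simp: C2R_def continuous_at_imp_continuous_on)
  obtain A where A: "\<And>s. \<bar>s\<bar> \<le> R \<Longrightarrow> \<bar>f s\<bar> \<le> A" using bd[OF c(1)] by auto
  obtain B where B: "\<And>s. \<bar>s\<bar> \<le> R \<Longrightarrow> \<bar>deriv f s\<bar> \<le> B" using bd[OF c(2)] by auto
  obtain C where C: "\<And>s. \<bar>s\<bar> \<le> R \<Longrightarrow> \<bar>deriv (deriv f) s\<bar> \<le> C" using bd[OF c(3)] by auto
  show ?thesis
  proof (rule that[of "\<bar>A\<bar> + \<bar>B\<bar> + \<bar>C\<bar>"])
    fix s assume s: "\<bar>s\<bar> \<le> R"
    show "\<bar>f s\<bar> \<le> \<bar>A\<bar> + \<bar>B\<bar> + \<bar>C\<bar>" "\<bar>deriv f s\<bar> \<le> \<bar>A\<bar> + \<bar>B\<bar> + \<bar>C\<bar>" "\<bar>deriv (deriv f) s\<bar> \<le> \<bar>A\<bar> + \<bar>B\<bar> + \<bar>C\<bar>"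
      using A[OF s] B[OF s] C[OF s] by linarith+
  qed simp
qed

lemma MVT_bounded:
  fixes g g' :: "real \<Rightarrow> real"
  assumes "\<And>x. (g has_real_derivative g' x) (at x)" "\<bar>s\<bar> \<le> R" "\<bar>t\<bar> \<le> R"
  obtains \<xi> where "\<bar>\<xi>\<bar> \<le> R" "\<bar>\<xi> - t\<bar> \<le> \<bar>s - t\<bar>" "g s - g t = (s - t) * g' \<xi>"
proof -
  consider "s = t" | "s < t" | "t < s" by linarith
  then show ?thesis
  proof cases
    case 1 then show ?thesis using that[of s] assms by simp
  next
    case 2
    then obtain z where "s < z" "z < t" "g t - g s = (t - s) * g' z" using MVT2[of s t g g'] assms by blast
    then show ?thesis using that[of z] assms by (auto simp: algebra_simps abs_le_iff)
  next
    case 3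
    then obtain z where "t < z" "z < s" "g s - g t = (s - t) * g' z" using MVT2[of t s g g'] assms by blast
    then show ?thesis using that[of z] assms by (auto simp: algebra_simps abs_le_iff)
  qed
qed

lemma lipschitz_of_deriv_bound:
  fixes g g' :: "real \<Rightarrow> real"
  assumes "\<And>x. (g has_real_derivative g' x) (at x)" "\<And>s. \<bar>s\<bar> \<le> R \<Longrightarrow> \<bar>g' s\<bar> \<le> F" "\<bar>s\<bar> \<le> R" "\<bar>t\<bar> \<le> R"
  shows "\<bar>g s - g t\<bar> \<le> F * \<bar>s - t\<bar>"
proof -
  obtain z where "\<bar>z\<bar> \<le> R" "g s - g t = (s - t) * g' z" using MVT_bounded[OF assms(1,3,4)] .
  then show ?thesis using mult_left_mono[OF assms(2)[of z], of "\<bar>s - t\<bar>"] by (simp add: abs_mult mult.commute)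
qed

text \<open>The intermediate point is no farther from t than s is, so the Lipschitz bound for the
  derivative supplies the second factor. The mean value form gives L rather than L/2.\<close>

lemma taylor_bound:
  fixes g g' :: "real \<Rightarrow> real"
  assumes "\<And>x. (g has_real_derivative g' x) (at x)"
    and lip: "\<And>s t. \<bar>s\<bar> \<le> R \<Longrightarrow> \<bar>t\<bar> \<le> R \<Longrightarrow> \<bar>g' s - g' t\<bar> \<le> L * \<bar>s - t\<bar>" and "0 \<le> L" "\<bar>s\<bar> \<le> R" "\<bar>t\<bar> \<le> R"
  shows "\<bar>g s - g t - g' t * (s - t)\<bar> \<le> L * \<bar>s - t\<bar>\<^sup>2"
proof -
  obtain z where z: "\<bar>z\<bar> \<le> R" "\<bar>z - t\<bar> \<le> \<bar>s - t\<bar>" "g s - g t = (s - t) * g' z"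
    using MVT_bounded[OF assms(1,4,5)] .
  have "g s - g t - g' t * (s - t) = (s - t) * (g' z - g' t)" using z(3) by (simp add: algebra_simps)
  then have "\<bar>g s - g t - g' t * (s - t)\<bar> = \<bar>s - t\<bar> * \<bar>g' z - g' t\<bar>" by (simp add: abs_mult)
  also have "\<dots> \<le> \<bar>s - t\<bar> * (L * \<bar>s - t\<bar>)"
    using lip[OF z(1) assms(5)] mult_left_mono[OF z(2) assms(3)] by (intro mult_left_mono) auto
  finally show ?thesis by (simp add: power2_eq_square mult_ac)
qed

lemma hb_compose:
  fixes w :: "real^'n::finite \<Rightarrow> real"
  assumes w: "c2b a R w" and g: "\<And>x. (g has_real_derivative g' x) (at x)"
    and F: "\<And>s. \<bar>s\<bar> \<le> R \<Longrightarrow> \<bar>g s\<bar> \<le> F" "\<And>s. \<bar>s\<bar> \<le> R \<Longrightarrow> \<bar>g' s\<bar> \<le> F" and b: "0 \<le> b" "b \<le> 1"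
  shows "hb b (emb CARD('n) * (F * (1 + R))) (\<lambda>x. g (w x))"
  unfolding emb_def
proof (rule hb_of_pd_bound[OF _ _ _ b])
  have R: "0 \<le> R" using c2b_nonneg[OF w] .
  have F0: "0 \<le> F" using F(1)[of 0] R by simp
  have w1: "\<bar>w x\<bar> \<le> R" "\<bar>pd i w x\<bar> \<le> R" for i x using w by (auto simp: c2b_def)
  have d: "w differentiable (at x)" for x using c2b_C2[OF w] by (simp add: C2_def)
  fix i x
  have "F * 1 \<le> F * (1 + R)" using R F0 by (intro mult_left_mono) auto
  then show "\<bar>g (w x)\<bar> \<le> F * (1 + R)" using F(1)[OF w1(1), of x] by simp
  show "(\<lambda>x. g (w x)) differentiable (at x)" using pd_compose_real[OF d g] by blast
  have "pd i (\<lambda>x. g (w x)) x = g' (w x) * pd i w x" using pd_compose_real[OF d g] by blast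
  then show "\<bar>pd i (\<lambda>x. g (w x)) x\<bar> \<le> F * (1 + R)"
    using F(2)[OF w1(1)] order_trans[OF w1(2), of "1 + R"] R F0 by (auto simp: abs_mult intro!: mult_mono)
qed

text \<open>In the supremum the difference is of order d. Its Lipschitz constant is only bounded,
  since the two compositions are estimated separately and f'' has no modulus at hand. Interpolation
  leaves the order 1 - b.\<close>

lemma hb_deriv_difference:
  fixes m m1 :: "real^'n::finite \<Rightarrow> real"
  assumes f: "C2R f" and m: "c2b a R m" "c2b a R m1" and d: "\<And>x. \<bar>m1 x - m x\<bar> \<le> d" "d \<le> 1"
    and F: "\<And>s. \<bar>s\<bar> \<le> R \<Longrightarrow> \<bar>deriv (deriv f) s\<bar> \<le> F" and b: "0 < b" "b < 1"
  shows "hb b ((F + (2 * F) powr (1 - b) * (2 * (F * (real CARD('n) * R))) powr b) * d powr (1 - b))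
     (\<lambda>x. deriv f (m1 x) - deriv f (m x))"
proof -
  let ?n = "real CARD('n)"
  have R: "0 \<le> R" using c2b_nonneg[OF m(1)] .
  have F0: "0 \<le> F" using F[of 0] R by simp
  have d0: "0 \<le> d" using d(1)[of undefined] by linarith
  have mR: "\<bar>m x\<bar> \<le> R" "\<bar>m1 x\<bar> \<le> R" for x using m by (auto simp: c2b_def)
  have lip: "\<bar>deriv f s - deriv f t\<bar> \<le> F * \<bar>s - t\<bar>" if "\<bar>s\<bar> \<le> R" "\<bar>t\<bar> \<le> R" for s t
    by (rule lipschitz_of_deriv_bound[OF C2R_deriv(2)[OF f] F that])
  have sup: "\<bar>deriv f (m1 x) - deriv f (m x)\<bar> \<le> F * d" for x
    using lip[OF mR(2) mR(1), of x x] mult_left_mono[OF d(1) F0, of x] by linarith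
  have lw: "\<bar>deriv f (w x) - deriv f (w y)\<bar> \<le> F * (?n * R) * dist x y" if "c2b a R w" for w :: "real^'n \<Rightarrow> real" and x y
  proof -
    have "\<bar>w x - w y\<bar> \<le> ?n * R * dist x y"
      using that by (intro lipschitz_of_pd_bound) (auto simp: c2b_def C2a_def C2_def)
    then show ?thesis
      using lip[of "w x" "w y"] that mult_left_mono[of "\<bar>w x - w y\<bar>" _ F] F0
      by (force simp: c2b_def mult.assoc)
  qed
  have "\<bar>(deriv f (m1 x) - deriv f (m x)) - (deriv f (m1 y) - deriv f (m y))\<bar> \<le> 2 * (F * (?n * R)) * dist x y powr 1" for x y
    using lw[OF m(1), of x y] lw[OF m(2), of x y] by simp
  then have "\<bar>(deriv f (m1 x) - deriv f (m x)) - (deriv f (m1 y) - deriv f (m y))\<bar>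
      \<le> ((2 * (F * d)) powr (1 - b/1) * (2 * (F * (?n * R))) powr (b/1)) * dist x y powr b" for x y
    using F0 R b by (intro hoelder_interpolation[of "\<lambda>x. deriv f (m1 x) - deriv f (m x)"] sup) auto
  moreover have "(2 * (F * d)) powr (1 - b/1) * (2 * (F * (?n * R))) powr (b/1) =
     ((2 * F) powr (1 - b) * (2 * (F * (?n * R))) powr b) * d powr (1 - b)"
    using F0 d0 by (simp add: mult.assoc[symmetric] powr_mult)
  ultimately have h: "\<bar>(deriv f (m1 x) - deriv f (m x)) - (deriv f (m1 y) - deriv f (m y))\<bar>
      \<le> ((2 * F) powr (1 - b) * (2 * (F * (?n * R))) powr b) * d powr (1 - b) * dist x y powr b" for x y
    by (simp only:)
  have dd: "d \<le> d powr (1 - b)" using powr_mono'[of "1 - b" 1 d] d0 d(2) b by simp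
  let ?A = "F * d powr (1 - b)" and ?B = "((2 * F) powr (1 - b) * (2 * (F * (?n * R))) powr b) * d powr (1 - b)"
  have eq: "(F + (2 * F) powr (1 - b) * (2 * (F * (real CARD('n) * R))) powr b) * d powr (1 - b) = ?A + ?B"
    by (simp only: distrib_right)
  have A: "F * d \<le> ?A" "0 \<le> ?A" "0 \<le> ?B" using F0 dd by (auto intro: mult_left_mono)
  show ?thesis unfolding eq hb_def
  proof (intro conjI allI)
    fix x y
    show "\<bar>deriv f (m1 x) - deriv f (m x)\<bar> \<le> ?A + ?B" using sup[of x] A by linarith
    have "?B * dist x y powr b \<le> (?A + ?B) * dist x y powr b" using A by (intro mult_right_mono) auto
    then show "\<bar>(deriv f (m1 x) - deriv f (m x)) - (deriv f (m1 y) - deriv f (m y))\<bar> \<le> (?A + ?B) * dist x y powr b"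
      using h[of x y] by linarith
  qed
qed

text \<open>The expansion is at \<open>m1\<close> and evaluated at \<open>m\<close>: in the
  application \<open>m1\<close> is the Newton iterate and \<open>m\<close> the solution.\<close>

definition taylor_rem :: "(real \<Rightarrow> real) \<Rightarrow> (real^'n::finite \<Rightarrow> real) \<Rightarrow> (real^'n \<Rightarrow> real) \<Rightarrow> real^'n \<Rightarrow> real" where
  "taylor_rem f m m1 x = f (m x) - f (m1 x) - deriv f (m1 x) * (m x - m1 x)"

text \<open>The grouping isolates the first-order remainder of f', the only term whose order depends
  on the regularity of f''; the last term is quadratic in the difference in any case.\<close>

lemma taylor_rem_pd:
  fixes m m1 :: "real^'n::finite \<Rightarrow> real"
  assumes f: "C2R f" and m: "C2 m" "C2 m1"
  shows "taylor_rem f m m1 differentiable (at x)"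
    "pd i (taylor_rem f m m1) x = (deriv f (m x) - deriv f (m1 x) - deriv (deriv f) (m1 x) * (m x - m1 x)) * pd i m x
      + deriv (deriv f) (m1 x) * (m x - m1 x) * (pd i m x - pd i m1 x)"
proof -
  have d: "m differentiable (at x)" "m1 differentiable (at x)" using m by (auto simp: C2_def)
  have fm: "(\<lambda>x. f (m x)) differentiable (at x)" "pd i (\<lambda>x. f (m x)) x = deriv f (m x) * pd i m x"
    using pd_compose_real[OF d(1) C2R_deriv(1)[OF f]] by auto
  have fm1: "(\<lambda>x. f (m1 x)) differentiable (at x)" "pd i (\<lambda>x. f (m1 x)) x = deriv f (m1 x) * pd i m1 x"
    using pd_compose_real[OF d(2) C2R_deriv(1)[OF f]] by auto
  have dm1: "(\<lambda>x. deriv f (m1 x)) differentiable (at x)" "pd i (\<lambda>x. deriv f (m1 x)) x = deriv (deriv f) (m1 x) * pd i m1 x"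
    using pd_compose_real[OF d(2) C2R_deriv(2)[OF f]] by auto
  have dd: "(\<lambda>x. m x - m1 x) differentiable (at x)" "pd i (\<lambda>x. m x - m1 x) x = pd i m x - pd i m1 x"
    using d pd_diff[OF d] by auto
  have pr: "(\<lambda>x. deriv f (m1 x) * (m x - m1 x)) differentiable (at x)" using dm1 dd by simp
  have df: "(\<lambda>x. f (m x) - f (m1 x)) differentiable (at x)" using fm fm1 by simp
  have eq: "taylor_rem f m m1 = (\<lambda>x. (f (m x) - f (m1 x)) - deriv f (m1 x) * (m x - m1 x))"
    by (rule ext) (simp add: taylor_rem_def)
  show "taylor_rem f m m1 differentiable (at x)" unfolding eq using df pr by simp
  show "pd i (taylor_rem f m m1) x = (deriv f (m x) - deriv f (m1 x) - deriv (deriv f) (m1 x) * (m x - m1 x)) * pd i m x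
      + deriv (deriv f) (m1 x) * (m x - m1 x) * (pd i m x - pd i m1 x)"
    unfolding eq pd_diff[OF df pr] pd_diff[OF fm(1) fm1(1)] pd_mult[OF dm1(1) dd(1)] fm(2) fm1(2) dm1(2) dd(2)
    by (simp add: algebra_simps)
qed

text \<open>The exponent arises as 2 (1 - b) from the supremum plus b from the Lipschitz bound. When
  f'' is Lipschitz, the gradient of the remainder is itself quadratic, and the embedding of C1
  replaces the interpolation.\<close>

lemma hb_taylor_rem:
  fixes m m1 :: "real^'n::finite \<Rightarrow> real"
  assumes f: "C2R f" and m: "c2b a R m" "c2b a R m1"
    and d: "\<And>x. \<bar>m x - m1 x\<bar> \<le> d" "\<And>i x. \<bar>pd i m x - pd i m1 x\<bar> \<le> d" "d \<le> 1"
    and F: "\<And>s. \<bar>s\<bar> \<le> R \<Longrightarrow> \<bar>deriv (deriv f) s\<bar> \<le> F" and b: "0 < b" "b < 1"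
  shows "hb b ((F + (2 * F) powr (1 - b) * (real CARD('n) * (F * (3 * R + 1))) powr b) * d powr (2 - b)) (taylor_rem f m m1)"
    and "0 \<le> L \<Longrightarrow> (\<And>s t. \<bar>s\<bar> \<le> R \<Longrightarrow> \<bar>t\<bar> \<le> R \<Longrightarrow> \<bar>deriv (deriv f) s - deriv (deriv f) t\<bar> \<le> L * \<bar>s - t\<bar>)
      \<Longrightarrow> hb b (emb CARD('n) * ((F + L * R) * d\<^sup>2)) (taylor_rem f m m1)"
proof -
  let ?n = "real CARD('n)" and ?T = "taylor_rem f m m1"
  have R: "0 \<le> R" using c2b_nonneg[OF m(1)] .
  have F0: "0 \<le> F" using F[of 0] R by simp
  have d0: "0 \<le> d" using d(1)[of undefined] by linarith
  have mR: "\<bar>m x\<bar> \<le> R" "\<bar>m1 x\<bar> \<le> R" "\<bar>pd i m x\<bar> \<le> R" for x i using m by (auto simp: c2b_def)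
  have lip: "\<bar>deriv f s - deriv f t\<bar> \<le> F * \<bar>s - t\<bar>" if "\<bar>s\<bar> \<le> R" "\<bar>t\<bar> \<le> R" for s t
    by (rule lipschitz_of_deriv_bound[OF C2R_deriv(2)[OF f] F that])
  have sq: "\<bar>m x - m1 x\<bar>\<^sup>2 \<le> d\<^sup>2" for x using d(1)[of x] by (intro power_mono) auto
  have sup: "\<bar>?T x\<bar> \<le> F * d\<^sup>2" for x
    unfolding taylor_rem_def
    using taylor_bound[OF C2R_deriv(1)[OF f] lip F0 mR(1) mR(2), of x x] mult_left_mono[OF sq F0, of x] by linarith
  note pdT = taylor_rem_pd[OF f c2b_C2(1)[OF m(1)] c2b_C2(1)[OF m(2)]]
  have second: "\<bar>deriv (deriv f) (m1 x) * (m x - m1 x) * (pd i m x - pd i m1 x)\<bar> \<le> F * d\<^sup>2" for i x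
  proof -
    have "\<bar>deriv (deriv f) (m1 x)\<bar> * \<bar>m x - m1 x\<bar> * \<bar>pd i m x - pd i m1 x\<bar> \<le> F * d * d"
      using F[OF mR(2), of x] d F0 d0 by (intro mult_mono) auto
    then show ?thesis by (simp add: abs_mult power2_eq_square mult.assoc)
  qed
  have pd_le: "\<bar>pd i ?T x\<bar> \<le> \<bar>deriv f (m x) - deriv f (m1 x) - deriv (deriv f) (m1 x) * (m x - m1 x)\<bar> * R + F * d\<^sup>2" for i x
  proof -
    have "\<bar>pd i ?T x\<bar> \<le> \<bar>deriv f (m x) - deriv f (m1 x) - deriv (deriv f) (m1 x) * (m x - m1 x)\<bar> * \<bar>pd i m x\<bar>
        + \<bar>deriv (deriv f) (m1 x) * (m x - m1 x) * (pd i m x - pd i m1 x)\<bar>"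
      unfolding pdT(2) abs_mult[symmetric] by (rule abs_triangle_ineq)
    then show ?thesis using second[of x i] mult_left_mono[OF mR(3)[of i x], of
        "\<bar>deriv f (m x) - deriv f (m1 x) - deriv (deriv f) (m1 x) * (m x - m1 x)\<bar>"] by linarith
  qed
  \<comment> \<open>The remainder of f' is bounded by its two parts separately, each of order d; the
    quadratic term joins them because d <= 1.\<close>
  have rough: "\<bar>pd i ?T x\<bar> \<le> F * (3 * R + 1) * d" for i x
  proof -
    have "\<bar>deriv f (m x) - deriv f (m1 x)\<bar> \<le> F * d"
      using lip[OF mR(1,2), of x x] mult_left_mono[OF d(1)[of x] F0] by linarith
    moreover have "\<bar>deriv (deriv f) (m1 x) * (m x - m1 x)\<bar> \<le> F * d"
      unfolding abs_mult using F[OF mR(2)] d F0 by (intro mult_mono) auto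
    ultimately have "\<bar>deriv f (m x) - deriv f (m1 x) - deriv (deriv f) (m1 x) * (m x - m1 x)\<bar> \<le> 2 * (F * d)" by linarith
    then have "\<bar>deriv f (m x) - deriv f (m1 x) - deriv (deriv f) (m1 x) * (m x - m1 x)\<bar> * R \<le> 2 * (F * d) * R"
      using R by (rule mult_right_mono)
    moreover have "F * d\<^sup>2 \<le> F * d" using d0 d(3) F0 by (intro mult_left_mono) (auto simp: power2_eq_square mult_left_le)
    moreover have "0 \<le> F * d * R" using F0 d0 R by simp
    ultimately show ?thesis using pd_le[of i x] by (simp add: algebra_simps)
  qed
  show "hb b ((F + (2 * F) powr (1 - b) * (?n * (F * (3 * R + 1))) powr b) * d powr (2 - b)) ?T"
  proof -
    have "\<bar>?T x - ?T y\<bar> \<le> ?n * (F * (3 * R + 1)) * d * dist x y powr 1" for x y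
      using lipschitz_of_pd_bound[OF pdT(1) rough, of x y] by (simp add: mult.assoc)
    then have "\<bar>?T x - ?T y\<bar> \<le> ((2 * (F * d\<^sup>2)) powr (1 - b/1) * (?n * (F * (3 * R + 1)) * d) powr (b/1)) * dist x y powr b" for x y
      using F0 R d0 b by (intro hoelder_interpolation[of ?T] sup) auto
    moreover have "(2 * (F * d\<^sup>2)) powr (1 - b/1) * (?n * (F * (3 * R + 1)) * d) powr (b/1) =
      ((2 * F) powr (1 - b) * (?n * (F * (3 * R + 1))) powr b) * d powr (2 - b)"
    proof -
      have 1: "(2 * (F * d\<^sup>2)) powr (1 - b/1) = (2 * F) powr (1 - b) * d powr (2 * (1 - b))"
        using F0 d0 by (simp add: mult.assoc[symmetric] powr_mult square_powr)
      have 2: "(?n * (F * (3 * R + 1)) * d) powr (b/1) = (?n * (F * (3 * R + 1))) powr b * d powr b"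
        using F0 d0 R by (simp add: powr_mult)
      have 3: "d powr (2 - b) = d powr (2 * (1 - b)) * d powr b"
        by (simp add: powr_add[symmetric] algebra_simps)
      show ?thesis unfolding 1 2 3 by (simp only: mult_ac)
    qed
    ultimately have h: "\<bar>?T x - ?T y\<bar> \<le> ((2 * F) powr (1 - b) * (?n * (F * (3 * R + 1))) powr b) * d powr (2 - b) * dist x y powr b" for x y
      by (simp only:)
    let ?A = "F * d powr (2 - b)" and ?B = "((2 * F) powr (1 - b) * (?n * (F * (3 * R + 1))) powr b) * d powr (2 - b)"
    have "d\<^sup>2 \<le> d powr (2 - b)"
    proof (cases "d = 0")
      case False
      then have "d\<^sup>2 = d powr 2" using d0 by simp
      also have "\<dots> \<le> d powr (2 - b)" using powr_mono'[of "2 - b" 2 d] d0 d(3) b by simp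
      finally show ?thesis .
    qed simp
    then have A: "F * d\<^sup>2 \<le> ?A" "0 \<le> ?A" "0 \<le> ?B" using F0 by (auto intro: mult_left_mono)
    show ?thesis unfolding distrib_right hb_def
    proof (intro conjI allI)
      fix x y
      show "\<bar>?T x\<bar> \<le> ?A + ?B" using sup[of x] A by linarith
      have "0 \<le> ?A * dist x y powr b" using A by simp
      then show "\<bar>?T x - ?T y\<bar> \<le> ?A * dist x y powr b + ?B * dist x y powr b"
        using h[of x y] by linarith
    qed
  qed
  show "hb b (emb CARD('n) * ((F + L * R) * d\<^sup>2)) ?T" if L: "0 \<le> L"
    "\<And>s t. \<bar>s\<bar> \<le> R \<Longrightarrow> \<bar>t\<bar> \<le> R \<Longrightarrow> \<bar>deriv (deriv f) s - deriv (deriv f) t\<bar> \<le> L * \<bar>s - t\<bar>"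
    unfolding emb_def
  proof (rule hb_of_pd_bound)
    have LR: "0 \<le> L * R * d\<^sup>2" using L R by simp
    fix i x
    show "\<bar>?T x\<bar> \<le> (F + L * R) * d\<^sup>2" using sup[of x] LR by (simp add: distrib_right)
    have "\<bar>deriv f (m x) - deriv f (m1 x) - deriv (deriv f) (m1 x) * (m x - m1 x)\<bar> \<le> L * d\<^sup>2"
      using taylor_bound[OF C2R_deriv(2)[OF f] L(2) L(1) mR(1) mR(2), of x x] mult_left_mono[OF sq L(1), of x] by linarith
    then have "\<bar>deriv f (m x) - deriv f (m1 x) - deriv (deriv f) (m1 x) * (m x - m1 x)\<bar> * R \<le> L * d\<^sup>2 * R"
      using R by (rule mult_right_mono)
    then show "\<bar>pd i ?T x\<bar> \<le> (F + L * R) * d\<^sup>2"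
      using pd_le[of i x] by (simp add: algebra_simps)
  qed (use b pdT(1) in auto)
qed

section \<open>Newton's method\<close>

lemma Tres_add:
  fixes \<xi> \<xi>' :: "real^'n::finite \<Rightarrow> real"
  assumes "lam > 0" "0 < a" "a < 1" "periodic \<xi>" "hb a M \<xi>" "periodic \<xi>'" "hb a M' \<xi>'"
  shows "Tres lam (\<lambda>x. \<xi> x + \<xi>' x) = (\<lambda>x. Tres lam \<xi> x + Tres lam \<xi>' x)"
proof -
  obtain C where "C > 0" and C: "\<And>\<xi> :: real^'n \<Rightarrow> real. \<And>M. periodic \<xi> \<Longrightarrow> hb a M \<xi> \<Longrightarrow>
      c2b a (C * M) (Tres lam \<xi>) \<and> (\<forall>x. - lap (Tres lam \<xi>) x + lam * Tres lam \<xi> x = \<xi> x)"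
    using Tres_bounds[OF assms(1-3), where 'n = 'n] by blast
  note 1 = C[OF assms(4,5)] and 2 = C[OF assms(6,7)]
  have c: "C2 (Tres lam \<xi>)" "C2 (Tres lam \<xi>')" using 1 2 c2b_C2 by blast+
  show ?thesis
  proof (rule Tres_eqI[OF assms(1)])
    show "periodic (\<lambda>x. Tres lam \<xi> x + Tres lam \<xi>' x)"
      using 1 2 c2b_C2(2)[of a _ "Tres lam \<xi>"] c2b_C2(2)[of a _ "Tres lam \<xi>'"] by (auto simp: periodic_def)
    show "C2 (\<lambda>x. Tres lam \<xi> x + Tres lam \<xi>' x)" by (rule C2_add[OF c])
    fix x
    have "lap (\<lambda>x. Tres lam \<xi> x + Tres lam \<xi>' x) x = lap (Tres lam \<xi>) x + lap (Tres lam \<xi>') x"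
      unfolding lap_def pd_pd_add[OF c] by (simp add: sum.distrib)
    moreover have "- lap (Tres lam \<xi>) x + lam * Tres lam \<xi> x = \<xi> x" "- lap (Tres lam \<xi>') x + lam * Tres lam \<xi>' x = \<xi>' x"
      using 1 2 by auto
    ultimately show "- lap (\<lambda>x. Tres lam \<xi> x + Tres lam \<xi>' x) x + lam * (Tres lam \<xi> x + Tres lam \<xi>' x) = \<xi> x + \<xi>' x"
      by (simp add: distrib_left)
  qed
qed

lemma Tres_cmult:
  fixes \<xi> :: "real^'n::finite \<Rightarrow> real"
  assumes "lam > 0" "0 < a" "a < 1" "periodic \<xi>" "hb a M \<xi>"
  shows "Tres lam (\<lambda>x. c * \<xi> x) = (\<lambda>x. c * Tres lam \<xi> x)"
proof -
  obtain C where "C > 0" and C: "\<And>\<xi> :: real^'n \<Rightarrow> real. \<And>M. periodic \<xi> \<Longrightarrow> hb a M \<xi> \<Longrightarrow>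
      c2b a (C * M) (Tres lam \<xi>) \<and> (\<forall>x. - lap (Tres lam \<xi>) x + lam * Tres lam \<xi> x = \<xi> x)"
    using Tres_bounds[OF assms(1-3), where 'n = 'n] by blast
  note 1 = C[OF assms(4,5)]
  have c2: "C2 (Tres lam \<xi>)" using 1 c2b_C2 by blast
  show ?thesis
  proof (rule Tres_eqI[OF assms(1)])
    show "periodic (\<lambda>x. c * Tres lam \<xi> x)"
      using 1 c2b_C2(2)[of a _ "Tres lam \<xi>"] by (auto simp: periodic_def)
    show "C2 (\<lambda>x. c * Tres lam \<xi> x)" by (rule C2_cmult[OF c2])
    fix x
    have l: "lap (\<lambda>x. c * Tres lam \<xi> x) x = c * lap (Tres lam \<xi>) x"
      unfolding lap_def pd_pd_cmult[OF c2] by (simp add: sum_distrib_left)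
    have xi: "\<xi> x = - lap (Tres lam \<xi>) x + lam * Tres lam \<xi> x" using 1 by auto
    show "- lap (\<lambda>x. c * Tres lam \<xi> x) x + lam * (c * Tres lam \<xi> x) = c * \<xi> x"
      unfolding l xi by (simp add: algebra_simps)
  qed
qed

lemma C2a_exponent_mono:
  fixes w :: "real^'n::finite \<Rightarrow> real"
  assumes "C2a a w" "0 < b" "b \<le> a"
  shows "C2a b w"
proof -
  have c: "c2b a (norm2a a w) w" using assms by (intro c2b_norm2a) auto
  have "hb b (3 * norm2a a w) (pd j (pd i w))" for i j
    using c assms by (intro hb_exponent_mono[of a]) (auto simp: c2b_def)
  then show ?thesis using assms(1) unfolding C2a_def holder_bdd_def hb_def by blast
qed

lemma powr_small:
  fixes a b q :: real
  assumes "0 < b" "0 \<le> a" "0 < q"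
  obtains r where "0 < r" "r \<le> 1" "\<And>t. 0 \<le> t \<Longrightarrow> t \<le> r \<Longrightarrow> a * t powr q \<le> b"
proof -
  \<comment> \<open>The denominator a + 1 covers a = 0 as well.\<close>
  define r where "r = min 1 ((b / (a + 1)) powr (1/q))"
  have r: "0 < r" "r \<le> 1" using assms by (auto simp: r_def)
  have "a * t powr q \<le> b" if t: "0 \<le> t" "t \<le> r" for t
  proof -
    have "t powr q \<le> ((b / (a + 1)) powr (1/q)) powr q"
      using t assms by (intro powr_mono2) (auto simp: r_def)
    also have "\<dots> = b / (a + 1)" using assms by (simp add: powr_powr)
    finally have "a * t powr q \<le> a * (b / (a + 1))" using assms by (intro mult_left_mono)
    also have "\<dots> \<le> b" using assms by (simp add: field_simps)
    finally show ?thesis .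
  qed
  then show ?thesis using that r by blast
qed

locale mfg_newton =
  fixes lam \<beta> \<gamma> :: real and f :: "real \<Rightarrow> real" and m0 u m :: "real^'n::finite \<Rightarrow> real"
  assumes lam: "lam > 0" and expo: "0 < \<gamma>" "\<gamma> < \<beta>" "\<beta> < 1" and f: "C2R f"
    and u: "C2a \<beta> u" and m: "C2a \<gamma> m" and m0: "periodic m0" "\<exists>M. hb \<gamma> M m0"
    and st: "stable lam f m0 u m"
begin

section \<open>The product space and the map T into it\<close>

definition X :: "((real^'n \<Rightarrow> real) \<times> (real^'n \<Rightarrow> real)) set" where
  "X = {p. C2a \<beta> (fst p) \<and> C2a \<gamma> (snd p)}"

definition N :: "(real^'n \<Rightarrow> real) \<times> (real^'n \<Rightarrow> real) \<Rightarrow> real" where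
  "N p = norm2a \<beta> (fst p) + norm2a \<gamma> (snd p)"

text \<open>The right-hand sides that \<open>T\<close> maps into \<open>X\<close>, two derivatives
  lower. Since \<open>T\<close> rests on a definite description, its linearity too is established
  only for them.\<close>

definition Y :: "real \<Rightarrow> (real^'n \<Rightarrow> real) \<times> (real^'n \<Rightarrow> real) \<Rightarrow> bool" where
  "Y M p \<longleftrightarrow> periodic (fst p) \<and> periodic (snd p) \<and> hb \<beta> M (fst p) \<and> hb \<gamma> M (snd p)"

definition sol :: "(real^'n \<Rightarrow> real) \<times> (real^'n \<Rightarrow> real)" where "sol = (u, m)"

lemma beta_pos: "0 < \<beta>" "\<gamma> < 1" using expo by auto

lemma sol_in_X: "sol \<in> X" by (simp add: X_def sol_def u m)

lemma fun_ops:
  fixes v w :: "real^'n \<Rightarrow> real"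
  shows "v + w = (\<lambda>x. v x + w x)" "v - w = (\<lambda>x. v x - w x)" "c *\<^sub>R v = (\<lambda>x. c * v x)" "(0 :: real^'n \<Rightarrow> real) = (\<lambda>x. 0)"
    "- v = (\<lambda>x. - v x)"
  by (auto simp: scaleR_fun_def)

sublocale normed_carrier X N
proof
  have z: "C2a a (\<lambda>x::real^'n. 0)" for a
  proof -
    have p0: "pd i (\<lambda>x::real^'n. 0) = (\<lambda>x. 0)" for i
      by (rule ext) (simp add: pd_has_derivative[of _ "\<lambda>h. 0"])
    show ?thesis by (auto simp: C2a_def C2_def p0 periodic_def holder_bdd_def intro: exI[of _ 0])
  qed
  show "subspace X" unfolding subspace_def X_def
    by (auto simp: fun_ops z C2a_add C2a_cmult)
  show "N (x + y) \<le> N x + N y" if "x \<in> X" "y \<in> X" for x y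
    using norm2a_add[of \<beta> "fst x" "fst y"] norm2a_add[of \<gamma> "snd x" "snd y"] that expo beta_pos
    by (simp add: N_def X_def fun_ops)
  show "N (c *\<^sub>R x) \<le> \<bar>c\<bar> * N x" if "x \<in> X" for x c
    using norm2a_cmult[of \<beta> "fst x" c] norm2a_cmult[of \<gamma> "snd x" c] that expo beta_pos
    by (simp add: N_def X_def fun_ops distrib_left)
  show "x = 0" if x: "x \<in> X" "N x = 0" for x
  proof -
    have c: "c2b \<beta> (norm2a \<beta> (fst x)) (fst x)" "c2b \<gamma> (norm2a \<gamma> (snd x)) (snd x)"
      using x(1) expo beta_pos by (auto simp: X_def intro: c2b_norm2a)
    then have "norm2a \<beta> (fst x) = 0" "norm2a \<gamma> (snd x) = 0"
      using c2b_nonneg[OF c(1)] c2b_nonneg[OF c(2)] x(2) by (auto simp: N_def)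
    then show ?thesis using c by (auto simp: c2b_def prod_eq_iff fun_eq_iff)
  qed
qed

lemma X_c2b:
  assumes "p \<in> X" "N p \<le> R" shows "c2b \<beta> R (fst p)" "c2b \<gamma> R (snd p)"
proof -
  have c: "c2b \<beta> (norm2a \<beta> (fst p)) (fst p)" "c2b \<gamma> (norm2a \<gamma> (snd p)) (snd p)"
    using assms(1) expo beta_pos by (auto simp: X_def intro: c2b_norm2a)
  then show "c2b \<beta> R (fst p)" "c2b \<gamma> R (snd p)"
    using c2b_nonneg[OF c(1)] c2b_nonneg[OF c(2)] assms(2)
    by (auto simp: N_def intro: c2b_mono)
qed

lemma X_C2: "p \<in> X \<Longrightarrow> C2 (fst p)" "p \<in> X \<Longrightarrow> C2 (snd p)" "p \<in> X \<Longrightarrow> periodic (fst p)" "p \<in> X \<Longrightarrow> periodic (snd p)"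
  by (auto simp: X_def C2a_def)

lemma Y_add: "Y M p \<Longrightarrow> Y M' q \<Longrightarrow> Y (M + M') (p + q)"
  by (simp add: Y_def hb_add fun_ops) (simp add: periodic_def)

lemma Y_scaleR: "Y M p \<Longrightarrow> Y (\<bar>c\<bar> * M) (c *\<^sub>R p)"
  by (simp add: Y_def hb_cmult fun_ops) (simp add: periodic_def)

lemma Y_diff: "Y M p \<Longrightarrow> Y M' q \<Longrightarrow> Y (M + M') (p - q)"
  using Y_add[of M p "\<bar>-1\<bar> * M'" "(-1) *\<^sub>R q"] Y_scaleR[of M' q "-1"] by simp

lemma Y_mono: "Y M p \<Longrightarrow> M \<le> M' \<Longrightarrow> Y M' p"
  by (auto simp: Y_def intro: hb_mono)

lemma T_bound:
  obtains C where "C > 0" "\<And>p M. Y M p \<Longrightarrow> T lam p \<in> X \<and> N (T lam p) \<le> C * M"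
    "\<And>p M x. Y M p \<Longrightarrow> - lap (fst (T lam p)) x + lam * fst (T lam p) x = fst p x"
    "\<And>p M x. Y M p \<Longrightarrow> - lap (snd (T lam p)) x + lam * snd (T lam p) x = snd p x"
proof -
  obtain C1 where C1: "C1 > 0" "\<And>\<xi> :: real^'n \<Rightarrow> real. \<And>M. periodic \<xi> \<Longrightarrow> hb \<beta> M \<xi> \<Longrightarrow>
      c2b \<beta> (C1 * M) (Tres lam \<xi>) \<and> (\<forall>x. - lap (Tres lam \<xi>) x + lam * Tres lam \<xi> x = \<xi> x)"
    using Tres_bounds[OF lam beta_pos(1) expo(3), where 'n = 'n] by blast
  obtain C2 where C2: "C2 > 0" "\<And>\<xi> :: real^'n \<Rightarrow> real. \<And>M. periodic \<xi> \<Longrightarrow> hb \<gamma> M \<xi> \<Longrightarrow>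
      c2b \<gamma> (C2 * M) (Tres lam \<xi>) \<and> (\<forall>x. - lap (Tres lam \<xi>) x + lam * Tres lam \<xi> x = \<xi> x)"
    using Tres_bounds[OF lam expo(1) beta_pos(2), where 'n = 'n] by blast
  let ?k = "1 + real CARD('n) + 2 * (real CARD('n))\<^sup>2"
  show ?thesis
  proof (rule that[of "?k * C1 + ?k * C2"])
    have "?k > 0" by (simp add: add_pos_nonneg)
    then show "?k * C1 + ?k * C2 > 0" using C1(1) C2(1) by (simp add: add_pos_pos)
    fix p M assume Y: "Y M p"
    have 1: "c2b \<beta> (C1 * M) (Tres lam (fst p))" "\<And>x. - lap (Tres lam (fst p)) x + lam * Tres lam (fst p) x = fst p x"
      using C1(2) Y by (auto simp: Y_def)
    have 2: "c2b \<gamma> (C2 * M) (Tres lam (snd p))" "\<And>x. - lap (Tres lam (snd p)) x + lam * Tres lam (snd p) x = snd p x"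
      using C2(2) Y by (auto simp: Y_def)
    have "T lam p \<in> X" using 1(1) 2(1) by (simp add: X_def T_def c2b_def)
    moreover have "N (T lam p) \<le> (?k * C1 + ?k * C2) * M"
      using norm2a_le[OF 1(1)] norm2a_le[OF 2(1)] by (simp only: N_def T_def fst_conv snd_conv distrib_right mult.assoc)
    ultimately show "T lam p \<in> X \<and> N (T lam p) \<le> (?k * C1 + ?k * C2) * M" ..
    show "- lap (fst (T lam p)) x + lam * fst (T lam p) x = fst p x"
      "- lap (snd (T lam p)) x + lam * snd (T lam p) x = snd p x" for x
      using 1(2)[of x] 2(2)[of x] by (simp_all add: T_def)
  qed
qed

lemma T_add: "Y M p \<Longrightarrow> Y M' q \<Longrightarrow> T lam (p + q) = T lam p + T lam q"
  unfolding T_def Y_def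
  by (simp add: fun_ops Tres_add[OF lam beta_pos(1) expo(3), of "fst p" M "fst q" M']
      Tres_add[OF lam expo(1) beta_pos(2), of "snd p" M "snd q" M'])

lemma T_scaleR: "Y M p \<Longrightarrow> T lam (c *\<^sub>R p) = c *\<^sub>R T lam p"
  unfolding T_def Y_def
  by (simp add: fun_ops Tres_cmult[OF lam beta_pos(1) expo(3), of "fst p" M]
      Tres_cmult[OF lam expo(1) beta_pos(2), of "snd p" M])

lemma T_diff: "Y M p \<Longrightarrow> Y M' q \<Longrightarrow> T lam (p - q) = T lam p - T lam q"
  using T_add[of M p "\<bar>-1\<bar> * M'" "(-1) *\<^sub>R q"] Y_scaleR[of M' q "-1"] T_scaleR[of M' q "-1"] by simp

section \<open>The derivative dG: linearity, bounds, compactness, and injectivity at the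
  solution\<close>

lemma dG_eq:
  assumes "p \<in> X" "z \<in> X"
  shows "dG f p z = (\<lambda>x. grad_prod (fst p) (fst z) x - deriv f (snd p x) * snd z x,
      \<lambda>x. - div_prod (snd z) (fst p) x - div_prod (snd p) (fst z) x)"
  using X_C2[OF assms(1)] X_C2[OF assms(2)]
  by (simp add: dG_def inner_grad dvg_scaleR_grad)

lemma G_eq:
  assumes "p \<in> X"
  shows "G lam f m0 p = (\<lambda>x. (1/2) * grad_prod (fst p) (fst p) x - f (snd p x),
      \<lambda>x. - div_prod (snd p) (fst p) x - lam * m0 x)"
  using X_C2[OF assms] by (simp add: G_def norm_grad_square dvg_scaleR_grad)

lemma dG_add:
  assumes "p \<in> X" "z \<in> X" "z' \<in> X"
  shows "dG f p (z + z') = dG f p z + dG f p z'"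
  unfolding dG_eq[OF assms(1,2)] dG_eq[OF assms(1,3)] dG_eq[OF assms(1) S_closed(2)[OF assms(2,3)]]
  using X_C2[OF assms(2)] X_C2[OF assms(3)]
  by (simp add: fun_ops grad_prod_add div_prod_add div_prod_add_left algebra_simps)

lemma dG_scaleR:
  assumes "p \<in> X" "z \<in> X"
  shows "dG f p (c *\<^sub>R z) = c *\<^sub>R dG f p z"
  unfolding dG_eq[OF assms] dG_eq[OF assms(1) S_closed(4)[OF assms(2)]]
  using X_C2[OF assms(2)]
  by (simp add: fun_ops grad_prod_cmult div_prod_cmult div_prod_cmult_left algebra_simps)

lemma dG_bound:
  obtains C where "0 \<le> C" "\<And>p z. p \<in> X \<Longrightarrow> N p \<le> R \<Longrightarrow> z \<in> X \<Longrightarrow>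
     periodic (fst (dG f p z)) \<and> periodic (snd (dG f p z)) \<and>
     hb 1 (C * N z) (fst (dG f p z)) \<and> hb \<beta> (C * N z) (snd (dG f p z))"
proof -
  obtain F where F: "0 \<le> F" "\<And>s. \<bar>s\<bar> \<le> R \<Longrightarrow> \<bar>f s\<bar> \<le> F" "\<And>s. \<bar>s\<bar> \<le> R \<Longrightarrow> \<bar>deriv f s\<bar> \<le> F"
    "\<And>s. \<bar>s\<bar> \<le> R \<Longrightarrow> \<bar>deriv (deriv f) s\<bar> \<le> F" using C2R_bounds[OF f, of R] by blast
  let ?c = "emb CARD('n)"
  let ?k = "4 * real CARD('n) * ?c\<^sup>2"
  have c: "?c \<ge> 0" by (simp add: emb_def)
  \<comment> \<open>The absolute value keeps \<open>C\<close> nonnegative also for negative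
    \<open>R\<close>, when the ball is empty.\<close>
  define C where "C = 2 * (?k * \<bar>R\<bar>) + 2 * (?c * (F * (1 + \<bar>R\<bar>))) * ?c"
  have C0: "0 \<le> C" using F(1) c by (simp add: C_def)
  show ?thesis
  proof (rule that[OF C0])
    fix p z assume p: "p \<in> X" "N p \<le> R" and z: "z \<in> X"
    have R: "0 \<le> R" using N_nonneg[OF p(1)] p(2) by simp
    note cp = X_c2b[OF p] and cz = X_c2b[OF z order_refl]
    have Nz: "0 \<le> N z" using N_nonneg[OF z] .
    note perp = X_C2[OF p(1)] and perz = X_C2[OF z]
    have per: "periodic (fst (dG f p z))" "periodic (snd (dG f p z))"
      unfolding dG_eq[OF p(1) z]
      using periodic_grad_prod[OF perp(3,1) perz(3,1)] periodic_div_prod[OF perp(4,2) perz(3,1)]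
        periodic_div_prod[OF perz(4,2) perp(3,1)] perp perz
      by (auto simp: periodic_def)
    have "hb 1 (?k * (R * N z) + 2 * (?c * (F * (1 + R))) * (?c * N z)) (fst (dG f p z))"
      unfolding dG_eq[OF p(1) z] fst_conv
      by (intro hb_diff hb_mult hb_grad_prod[OF cp(1) cz(1)] hb_compose[OF cp(2) C2R_deriv(2)[OF f] F(3,4)]
          hb_c2b[OF cz(2)]) auto
    moreover have "?k * (R * N z) + 2 * (?c * (F * (1 + R))) * (?c * N z) \<le> C * N z"
    proof -
      have "0 \<le> ?k * R * N z" using R Nz by simp
      then show ?thesis using R by (simp add: C_def algebra_simps)
    qed
    ultimately have 1: "hb 1 (C * N z) (fst (dG f p z))" by (rule hb_mono)
    have "hb \<beta> (?k * (N z * R) + ?k * (R * N z)) (snd (dG f p z))"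
      unfolding dG_eq[OF p(1) z] snd_conv using beta_pos expo
      by (intro hb_diff hb_uminus hb_div_prod[OF cp(2) cz(1)] hb_div_prod[OF cz(2) cp(1)]) auto
    moreover have "?k * (N z * R) + ?k * (R * N z) \<le> C * N z"
    proof -
      have "0 \<le> 2 * (?c * (F * (1 + R))) * (?c * N z)" using R Nz F(1) c by simp
      then show ?thesis using R by (simp add: C_def algebra_simps)
    qed
    ultimately have 2: "hb \<beta> (C * N z) (snd (dG f p z))" by (rule hb_mono)
    show "periodic (fst (dG f p z)) \<and> periodic (snd (dG f p z)) \<and>
     hb 1 (C * N z) (fst (dG f p z)) \<and> hb \<beta> (C * N z) (snd (dG f p z))"
      using per 1 2 by blast
  qed
qed

lemma dG_Y:
  assumes p: "p \<in> X"
  obtains C where "0 \<le> C" "\<And>z. z \<in> X \<Longrightarrow> Y (C * N z) (dG f p z)"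
proof -
  obtain C where C: "0 \<le> C" "\<And>q z. q \<in> X \<Longrightarrow> N q \<le> N p \<Longrightarrow> z \<in> X \<Longrightarrow>
     periodic (fst (dG f q z)) \<and> periodic (snd (dG f q z)) \<and>
     hb 1 (C * N z) (fst (dG f q z)) \<and> hb \<beta> (C * N z) (snd (dG f q z))" using dG_bound[of "N p"] by blast
  have "Y (3 * C * N z) (dG f p z)" if "z \<in> X" for z
    using C(2)[OF p order_refl that] beta_pos expo
      hb_exponent_mono[of 1 "C * N z" "fst (dG f p z)" \<beta>] hb_exponent_mono[of \<beta> "C * N z" "snd (dG f p z)" \<gamma>]
    by (simp add: Y_def mult.assoc)
  then show ?thesis using that[of "3 * C"] C(1) by simp
qed

lemma compact_perturbation_dG:
  assumes p: "p \<in> X" and inj: "\<And>z. z \<in> X \<Longrightarrow> z + T lam (dG f p z) = 0 \<Longrightarrow> z = 0"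
  shows "compact_perturbation X N (\<lambda>z. T lam (dG f p z))"
proof unfold_locales
  obtain CT where CT: "CT > 0" "\<And>p M. Y M p \<Longrightarrow> T lam p \<in> X \<and> N (T lam p) \<le> CT * M"
    using T_bound by metis
  obtain C where C: "0 \<le> C" "\<And>z. z \<in> X \<Longrightarrow> Y (C * N z) (dG f p z)" using dG_Y[of p] p by blast
  show "T lam (dG f p z) \<in> X" if "z \<in> X" for z using CT(2)[OF C(2)[OF that]] by blast
  show "T lam (dG f p (z + z')) = T lam (dG f p z) + T lam (dG f p z')" if "z \<in> X" "z' \<in> X" for z z'
    using T_add[OF C(2)[OF that(1)] C(2)[OF that(2)]] dG_add[OF p that] by simp
  show "T lam (dG f p (c *\<^sub>R z)) = c *\<^sub>R T lam (dG f p z)" if "z \<in> X" for z c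
    using T_scaleR[OF C(2)[OF that]] dG_scaleR[OF p that] by simp
  show "\<exists>B. \<forall>z\<in>X. N (T lam (dG f p z)) \<le> B * N z"
    using CT(2)[OF C(2)] by (metis mult.assoc)
  show "z = 0" if "z \<in> X" "z + T lam (dG f p z) = 0" for z using inj that .
  fix Z :: "nat \<Rightarrow> (real^'n \<Rightarrow> real) \<times> (real^'n \<Rightarrow> real)" and B
  assume Z: "\<And>n. Z n \<in> X" "\<And>n. N (Z n) \<le> B"
  \<comment> \<open>\<open>dG_Y\<close> has already given up the better exponents, on which
    compactness rests; the sharper bound is therefore taken up again.\<close>
  obtain C' where C': "0 \<le> C'" "\<And>q z. q \<in> X \<Longrightarrow> N q \<le> N p \<Longrightarrow> z \<in> X \<Longrightarrow>
     periodic (fst (dG f q z)) \<and> periodic (snd (dG f q z)) \<and>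
     hb 1 (C' * N z) (fst (dG f q z)) \<and> hb \<beta> (C' * N z) (snd (dG f q z))" using dG_bound[of "N p"] by blast
  let ?D = "\<lambda>n. dG f p (Z n)"
  have le: "C' * N (Z n) \<le> C' * B" for n using Z(2) C'(1) by (rule mult_left_mono)
  have D: "periodic (fst (?D n))" "periodic (snd (?D n))" "hb 1 (C' * B) (fst (?D n))" "hb \<beta> (C' * B) (snd (?D n))" for n
    using C'(2)[OF p order_refl Z(1), of n] hb_mono[OF _ le[of n]] by blast+
  obtain r1 \<xi> e1 where r1: "strict_mono (r1::nat \<Rightarrow> nat)" "periodic \<xi>" "hb 1 (C' * B) \<xi>" "e1 \<longlonglongrightarrow> 0"
    "\<And>n. hb \<beta> (e1 n) (\<lambda>x. fst (?D (r1 n)) x - \<xi> x)"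
    using hoelder_compact[of "\<lambda>n. fst (?D n)" 1 "C' * B" \<beta>, OF D(1) D(3) beta_pos(1) expo(3)] by blast
  \<comment> \<open>The second extraction runs inside the first, so the first components still
    converge along the composed subsequence.\<close>
  obtain r2 \<zeta> e2 where r2: "strict_mono (r2::nat \<Rightarrow> nat)" "periodic \<zeta>" "hb \<beta> (C' * B) \<zeta>" "e2 \<longlonglongrightarrow> 0"
    "\<And>n. hb \<gamma> (e2 n) (\<lambda>x. snd (?D (r1 (r2 n))) x - \<zeta> x)"
    using hoelder_compact[of "\<lambda>n. snd (?D (r1 n))" \<beta> "C' * B" \<gamma>, OF D(2) D(4) expo(1,2)] by blast
  let ?r = "\<lambda>n. r1 (r2 n)" and ?q = "(\<xi>, \<zeta>)"
  have Yq: "Y (3 * (C' * B)) ?q"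
    using r1 r2 expo beta_pos by (auto simp: Y_def intro: hb_exponent_mono)
  have Yd: "Y (e1 (r2 n) + e2 n) (?D (?r n) - ?q)" for n
  proof -
    have a: "hb \<beta> (e1 (r2 n)) (\<lambda>x. fst (?D (?r n)) x - \<xi> x)" "hb \<gamma> (e2 n) (\<lambda>x. snd (?D (?r n)) x - \<zeta> x)"
      using r1(5)[of "r2 n"] r2(5)[of n] by auto
    then have "hb \<beta> (e1 (r2 n) + e2 n) (\<lambda>x. fst (?D (?r n)) x - \<xi> x)" "hb \<gamma> (e1 (r2 n) + e2 n) (\<lambda>x. snd (?D (?r n)) x - \<zeta> x)"
      using hb_nonneg[OF a(1)] hb_nonneg[OF a(2)] by (auto intro: hb_mono)
    then show ?thesis using D(1,2)[of "?r n"] r1(2) r2(2)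
      by (simp add: Y_def fun_ops) (simp add: periodic_def)
  qed
  have up: "N (T lam (?D (?r n)) - T lam ?q) \<le> CT * (e1 (r2 n) + e2 n)" for n
    using CT(2)[OF Yd[of n]] T_diff[OF C(2)[OF Z(1)] Yq, of "?r n"] by simp
  have lo: "0 \<le> N (T lam (?D (?r n)) - T lam ?q)" for n
    using CT(2)[OF C(2)[OF Z(1)], of "?r n"] CT(2)[OF Yq] by (intro N_nonneg S_closed(3)) auto
  have null: "(\<lambda>n. CT * (e1 (r2 n) + e2 n)) \<longlonglongrightarrow> 0"
    using tendsto_mult_right_zero[OF tendsto_add_zero[OF LIMSEQ_subseq_LIMSEQ[OF r1(4) r2(1), unfolded o_def] r2(4)]] .
  have "(\<lambda>n. N (T lam (?D (?r n)) - T lam ?q)) \<longlonglongrightarrow> 0"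
    by (rule tendsto_sandwich[OF _ _ tendsto_const null]) (simp_all add: up lo always_eventually)
  moreover have "strict_mono ?r" using strict_mono_o[OF r1(1) r2(1)] by (simp add: o_def)
  moreover have "T lam ?q \<in> X" using CT(2)[OF Yq] by blast
  ultimately show "\<exists>r l. strict_mono (r::nat \<Rightarrow> nat) \<and> l \<in> X \<and> (\<lambda>n. N (T lam (dG f p (Z (r n))) - l)) \<longlonglongrightarrow> 0"
    by blast
qed

text \<open>Applying lam - Laplacian to z = - T dG z turns the equation into the linearised system,
  whose only solution is 0 by stability.\<close>

lemma sol_injective:
  assumes z: "z \<in> X" and eq: "z + T lam (dG f sol z) = 0"
  shows "z = 0"
proof -
  obtain CT where CT: "\<And>p M. Y M p \<Longrightarrow> T lam p \<in> X \<and> N (T lam p) \<le> CT * M"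
    "\<And>p M x. Y M p \<Longrightarrow> - lap (fst (T lam p)) x + lam * fst (T lam p) x = fst p x"
    "\<And>p M x. Y M p \<Longrightarrow> - lap (snd (T lam p)) x + lam * snd (T lam p) x = snd p x"
    using T_bound by metis
  obtain C where C: "\<And>z. z \<in> X \<Longrightarrow> Y (C * N z) (dG f sol z)" using dG_Y[of sol] sol_in_X by blast
  let ?t = "T lam (dG f sol z)"
  have tX: "?t \<in> X" using CT(1)[OF C[OF z]] by blast
  note t = X_C2[OF tX]
  have zt: "z = - ?t" using eq by (simp add: eq_neg_iff_add_eq_0)
  have fz: "fst z = (\<lambda>x. - fst ?t x)" "snd z = (\<lambda>x. - snd ?t x)"
    using arg_cong[OF zt, of fst] arg_cong[OF zt, of snd] by (auto simp: fun_ops)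
  have lf: "lap (fst z) x = - lap (fst ?t) x" "lap (snd z) x = - lap (snd ?t) x" for x
    unfolding fz lap_def by (simp_all add: pd_pd_uminus[OF t(1)] pd_pd_uminus[OF t(2)] sum_negf)
  have c: "C2 u" "C2 m" using u m by (auto simp: C2a_def)
  note zc = X_C2[OF z]
  have 1: "- lap (fst z) x + lam * fst z x = - (grad u x \<bullet> grad (fst z) x - deriv f (m x) * snd z x)" for x
  proof -
    have "- lap (fst z) x + lam * fst z x = - (- lap (fst ?t) x + lam * fst ?t x)"
      unfolding lf by (subst fz(1)) simp
    also have "\<dots> = - fst (dG f sol z) x" using CT(2)[OF C[OF z]] by simp
    finally show ?thesis by (simp add: dG_def sol_def)
  qed
  have 2: "- lap (snd z) x + lam * snd z x = - (- dvg (\<lambda>y. snd z y *\<^sub>R grad u y) x - dvg (\<lambda>y. m y *\<^sub>R grad (fst z) y) x)" for x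
  proof -
    have "- lap (snd z) x + lam * snd z x = - (- lap (snd ?t) x + lam * snd ?t x)"
      unfolding lf by (subst fz(2)) simp
    also have "\<dots> = - snd (dG f sol z) x" using CT(3)[OF C[OF z]] by simp
    finally show ?thesis by (simp add: dG_def sol_def)
  qed
  have "fst z = (\<lambda>x. 0) \<and> snd z = (\<lambda>x. 0)"
  proof -
    have e1: "- lap (fst z) x + grad u x \<bullet> grad (fst z) x + lam * fst z x = deriv f (m x) * snd z x" for x
      using 1[of x] by linarith
    have e2: "- lap (snd z) x - dvg (\<lambda>y. snd z y *\<^sub>R grad u y) x + lam * snd z x = dvg (\<lambda>y. m y *\<^sub>R grad (fst z) y) x" for x
      using 2[of x] by linarith
    show ?thesis using st zc e1 e2 unfolding stable_def by blast
  qed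
  then show ?thesis by (simp add: prod_eq_iff fun_ops(4))
qed

text \<open>Needed before \<open>T\<close> may be split over sums that contain G at the
  solution.\<close>

lemma G_sol_Y: "\<exists>M. Y M (G lam f m0 sol)"
proof -
  define R where "R = N sol"
  obtain F where F: "0 \<le> F" "\<And>s. \<bar>s\<bar> \<le> R \<Longrightarrow> \<bar>f s\<bar> \<le> F" "\<And>s. \<bar>s\<bar> \<le> R \<Longrightarrow> \<bar>deriv f s\<bar> \<le> F"
    "\<And>s. \<bar>s\<bar> \<le> R \<Longrightarrow> \<bar>deriv (deriv f) s\<bar> \<le> F" using C2R_bounds[OF f, of R] by blast
  note c = X_c2b[OF sol_in_X, of R, unfolded R_def, OF order_refl, folded R_def]
  note per = X_C2[OF sol_in_X]
  obtain M0 where M0: "hb \<gamma> M0 m0" using m0 by blast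
  have b: "0 \<le> \<beta>" "\<beta> \<le> 1" "0 \<le> \<gamma>" "\<gamma> \<le> \<beta>" using expo by auto
  have "\<exists>M. hb \<beta> M (fst (G lam f m0 sol))"
    unfolding G_eq[OF sol_in_X] fst_conv
    by (rule exI, rule hb_diff[OF hb_cmult[OF hb_grad_prod[OF c(1) c(1) b(1,2)]]
          hb_compose[OF c(2) C2R_deriv(1)[OF f] F(2,3) b(1,2)]])
  moreover have "\<exists>M. hb \<gamma> M (snd (G lam f m0 sol))"
    unfolding G_eq[OF sol_in_X] snd_conv
    by (rule exI, rule hb_diff[OF hb_uminus[OF hb_exponent_mono[OF hb_div_prod[OF c(2) c(1) b(1,2)] b(3,4)]]
          hb_cmult[OF M0]])
  ultimately obtain M1 M2 where M: "hb \<beta> M1 (fst (G lam f m0 sol))" "hb \<gamma> M2 (snd (G lam f m0 sol))" by blast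
  have "periodic (fst (G lam f m0 sol))" "periodic (snd (G lam f m0 sol))"
    unfolding G_eq[OF sol_in_X]
    using periodic_grad_prod[OF per(3,1) per(3,1)] periodic_div_prod[OF per(4,2) per(3,1)] per m0(1)
    by (auto simp: periodic_def)
  then have "Y (M1 + M2) (G lam f m0 sol)"
    unfolding Y_def using M hb_nonneg[OF M(1)] hb_nonneg[OF M(2)] by (auto intro: hb_mono)
  then show ?thesis by blast
qed

text \<open>The system rearranged: with all nonlinear terms moved to the right, -u and -m solve the
  resolvent equations with right-hand side G.\<close>

lemma sol_fixed_point: "T lam (G lam f m0 sol) = - sol"
proof -
  have mfg: "periodic u" "periodic m" "C2 u" "C2 m"
    "\<And>x. - lap u x + (1/2) * (norm (grad u x))\<^sup>2 + lam * u x = f (m x)"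
    "\<And>x. - lap m x - dvg (\<lambda>y. m y *\<^sub>R grad u y) x + lam * m x = lam * m0 x"
    using st by (auto simp: stable_def MFG_sol_def)
  have "Tres lam (fst (G lam f m0 sol)) = (\<lambda>x. - u x)"
  proof (rule Tres_eqI[OF lam])
    show "periodic (\<lambda>x. - u x)" using mfg(1) by (simp add: periodic_def)
    show "C2 (\<lambda>x. - u x)" using C2_uminus[OF mfg(3)] .
    show "- lap (\<lambda>x. - u x) x + lam * (- u x) = fst (G lam f m0 sol) x" for x
      using mfg(5)[of x] by (simp add: lap_def pd_pd_uminus[OF mfg(3)] sum_negf G_def sol_def)
  qed
  moreover have "Tres lam (snd (G lam f m0 sol)) = (\<lambda>x. - m x)"
  proof (rule Tres_eqI[OF lam])
    show "periodic (\<lambda>x. - m x)" using mfg(2) by (simp add: periodic_def)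
    show "C2 (\<lambda>x. - m x)" using C2_uminus[OF mfg(4)] .
    show "- lap (\<lambda>x. - m x) x + lam * (- m x) = snd (G lam f m0 sol) x" for x
      using mfg(6)[of x] by (simp add: lap_def pd_pd_uminus[OF mfg(4)] sum_negf G_def sol_def)
  qed
  ultimately show ?thesis by (simp add: T_def sol_def fun_ops)
qed

section \<open>Estimates near the solution: continuity of dG and the Taylor remainder\<close>

lemma near_sol:
  assumes "p \<in> X" "N (p - sol) \<le> 1"
  shows "c2b \<beta> (N (p - sol)) (\<lambda>x. fst p x - u x)" "c2b \<gamma> (N (p - sol)) (\<lambda>x. snd p x - m x)"
    "c2b \<beta> (N (p - sol)) (\<lambda>x. u x - fst p x)" "c2b \<gamma> (N (p - sol)) (\<lambda>x. m x - snd p x)"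
    "c2b \<gamma> (N sol + 1) (snd p)" "c2b \<gamma> (N sol + 1) m" "0 \<le> N (p - sol)"
proof -
  have d: "p - sol \<in> X" "sol - p \<in> X" using assms(1) sol_in_X S_closed by blast+
  show "c2b \<beta> (N (p - sol)) (\<lambda>x. fst p x - u x)" "c2b \<gamma> (N (p - sol)) (\<lambda>x. snd p x - m x)"
    using X_c2b[OF d(1) order_refl] by (auto simp: sol_def fun_ops)
  show "c2b \<beta> (N (p - sol)) (\<lambda>x. u x - fst p x)" "c2b \<gamma> (N (p - sol)) (\<lambda>x. m x - snd p x)"
    using X_c2b[OF d(2) order_refl] N_minus_commute[OF assms(1) sol_in_X] by (auto simp: sol_def fun_ops)
  have "N p \<le> N (p - sol) + N sol" using N_add[OF d(1) sol_in_X] by simp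
  then have "N p \<le> N sol + 1" using assms(2) by simp
  then show "c2b \<gamma> (N sol + 1) (snd p)" by (rule X_c2b[OF assms(1)])
  show "c2b \<gamma> (N sol + 1) m" using X_c2b(2)[OF sol_in_X, of "N sol + 1"] by (simp add: sol_def)
  show "0 \<le> N (p - sol)" using N_nonneg[OF d(1)] .
qed

text \<open>Only the term with f' is of order 1 - \<beta>. The others are linear in the distance,
  which the power 1 - \<beta> dominates as long as the distance is at most 1.\<close>

lemma dG_difference:
  obtains C where "0 \<le> C" "\<And>p z. p \<in> X \<Longrightarrow> N (p - sol) \<le> 1 \<Longrightarrow> z \<in> X \<Longrightarrow>
    Y (C * N (p - sol) powr (1 - \<beta>) * N z) (dG f p z - dG f sol z)"
proof -
  define R where "R = N sol + 1"
  obtain F where F: "0 \<le> F" "\<And>s. \<bar>s\<bar> \<le> R \<Longrightarrow> \<bar>f s\<bar> \<le> F" "\<And>s. \<bar>s\<bar> \<le> R \<Longrightarrow> \<bar>deriv f s\<bar> \<le> F"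
    "\<And>s. \<bar>s\<bar> \<le> R \<Longrightarrow> \<bar>deriv (deriv f) s\<bar> \<le> F" using C2R_bounds[OF f, of R] by blast
  let ?c = "emb CARD('n)"
  let ?k = "4 * real CARD('n) * ?c\<^sup>2"
  have c: "?c \<ge> 0" by (simp add: emb_def)
  define A where "A = F + (2 * F) powr (1 - \<beta>) * (2 * (F * (real CARD('n) * R))) powr \<beta>"
  have A: "0 \<le> A" using F(1) by (simp add: A_def)
  define C where "C = 6 * ?k + 2 * A * ?c"
  have C0: "0 \<le> C" using A c by (simp add: C_def)
  show ?thesis
  proof (rule that[OF C0])
    fix p z assume p: "p \<in> X" "N (p - sol) \<le> 1" and z: "z \<in> X"
    define d where "d = N (p - sol)"
    note n = near_sol[OF p, folded d_def R_def]
    note cz = X_c2b[OF z order_refl] and zc = X_C2[OF z] and pc = X_C2[OF p(1)] and sc = X_C2[OF sol_in_X]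
    have uc: "C2 u" "C2 m" "periodic u" "periodic m" using sc by (auto simp: sol_def)
    have Nz: "0 \<le> N z" using N_nonneg[OF z] .
    define e where "e = d powr (1 - \<beta>)"
    have e: "d \<le> e" "0 \<le> e" using powr_mono'[of "1 - \<beta>" 1 d] n(7) p(2) beta_pos expo by (auto simp: e_def d_def)
    have eq: "dG f p z - dG f sol z =
        (\<lambda>x. grad_prod (fst z) (\<lambda>x. fst p x - u x) x - (deriv f (snd p x) - deriv f (m x)) * snd z x,
         \<lambda>x. - div_prod (snd z) (\<lambda>x. fst p x - u x) x - div_prod (\<lambda>x. snd p x - m x) (fst z) x)"
      unfolding dG_eq[OF p(1) z] dG_eq[OF sol_in_X z]
      using pc uc
      by (simp add: sol_def fun_ops grad_prod_diff div_prod_diff div_prod_diff_left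
          grad_prod_commute[of _ "fst z"] algebra_simps)
    have "hb \<beta> (?k * (N z * d) + 2 * (A * e) * (?c * N z)) (fst (dG f p z - dG f sol z))"
      unfolding eq fst_conv A_def e_def
      using expo beta_pos p(2) n(2)
      by (intro hb_diff hb_mult hb_grad_prod[OF cz(1) n(1)] hb_c2b[OF cz(2)]
          hb_deriv_difference[OF f n(6) n(5) _ _ F(4)]) (auto simp: c2b_def d_def)
    moreover have "hb \<gamma> (3 * (?k * (N z * d)) + 3 * (?k * (d * N z))) (snd (dG f p z - dG f sol z))"
      unfolding eq snd_conv using expo beta_pos
      by (intro hb_diff hb_uminus hb_exponent_mono[OF hb_div_prod[OF cz(2) n(1)]]
          hb_exponent_mono[OF hb_div_prod[OF n(2) cz(1)]]) auto
    moreover have "?k * (N z * d) + 2 * (A * e) * (?c * N z) \<le> C * e * N z"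
      "3 * (?k * (N z * d)) + 3 * (?k * (d * N z)) \<le> C * e * N z"
    proof -
      have kd: "?k * (N z * d) \<le> ?k * (N z * e)" using e Nz c by (intro mult_left_mono) auto
      have p0: "0 \<le> 2 * (A * e) * (?c * N z)" "0 \<le> ?k * (N z * e)" using A e Nz c by auto
      have Ce: "C * e * N z = 6 * (?k * (N z * e)) + 2 * (A * e) * (?c * N z)"
        by (simp add: C_def algebra_simps)
      show "?k * (N z * d) + 2 * (A * e) * (?c * N z) \<le> C * e * N z" unfolding Ce using kd p0 by linarith
      have "?k * (d * N z) = ?k * (N z * d)" by (simp only: mult.commute)
      then show "3 * (?k * (N z * d)) + 3 * (?k * (d * N z)) \<le> C * e * N z"
        unfolding Ce using kd p0 by linarith
    qed
    moreover have "periodic (fst (dG f p z - dG f sol z))" "periodic (snd (dG f p z - dG f sol z))"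
    proof -
      have "C2 (\<lambda>x. fst p x - u x)" "C2 (\<lambda>x. snd p x - m x)" "periodic (\<lambda>x. fst p x - u x)" "periodic (\<lambda>x. snd p x - m x)"
        using n(1,2) c2b_C2 by blast+
      note q = this
      show "periodic (fst (dG f p z - dG f sol z))" "periodic (snd (dG f p z - dG f sol z))"
        unfolding eq using periodic_grad_prod[OF zc(3,1) q(3,1)] periodic_div_prod[OF zc(4,2) q(3,1)]
          periodic_div_prod[OF q(4,2) zc(3,1)] pc uc zc by (auto simp: periodic_def)
    qed
    ultimately show "Y (C * N (p - sol) powr (1 - \<beta>) * N z) (dG f p z - dG f sol z)"
      unfolding Y_def d_def[symmetric] e_def[symmetric] by (blast intro: hb_mono)
  qed
qed

definition Q where "Q p = G lam f m0 sol - G lam f m0 p - dG f p (sol - p)"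

text \<open>The gradient square and the transport term are quadratic in the unknowns, so their
  remainders are exact products of differences; only f leaves a genuine Taylor remainder.\<close>

lemma Q_eq:
  assumes p: "p \<in> X"
  shows "Q p = (\<lambda>x. (1/2) * grad_prod (\<lambda>x. u x - fst p x) (\<lambda>x. u x - fst p x) x - taylor_rem f m (snd p) x,
     \<lambda>x. - div_prod (\<lambda>x. m x - snd p x) (\<lambda>x. u x - fst p x) x)"
proof -
  have d: "sol - p \<in> X" using p sol_in_X S_closed by blast
  have c: "C2 u" "C2 m" "C2 (fst p)" "C2 (snd p)" using X_C2[OF p] X_C2[OF sol_in_X] by (auto simp: sol_def)
  have d1: "fst (sol - p) = (\<lambda>x. u x - fst p x)" "snd (sol - p) = (\<lambda>x. m x - snd p x)"
    by (auto simp: sol_def fun_ops)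
  have cd: "C2 (\<lambda>x. u x - fst p x)" using c by (intro C2_diff)
  have g: "grad_prod (\<lambda>x. u x - fst p x) (\<lambda>x. u x - fst p x) x =
      grad_prod u u x - 2 * grad_prod (fst p) u x + grad_prod (fst p) (fst p) x" for x
  proof -
    let ?d = "\<lambda>x. u x - fst p x"
    have "grad_prod ?d ?d x = grad_prod ?d u x - grad_prod ?d (fst p) x"
      by (rule grad_prod_diff[OF c(1,3)])
    also have "grad_prod ?d u x = grad_prod u u x - grad_prod u (fst p) x"
      unfolding grad_prod_commute[of ?d u] by (rule grad_prod_diff[OF c(1,3)])
    also have "grad_prod ?d (fst p) x = grad_prod (fst p) u x - grad_prod (fst p) (fst p) x"
      unfolding grad_prod_commute[of ?d "fst p"] by (rule grad_prod_diff[OF c(1,3)])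
    also have "grad_prod u (fst p) x = grad_prod (fst p) u x" by (rule grad_prod_commute)
    finally show ?thesis by simp
  qed
  show ?thesis
    unfolding Q_def G_eq[OF sol_in_X] G_eq[OF p] dG_eq[OF p d] d1 g
    using c cd
    by (simp add: fun_ops taylor_rem_def sol_def grad_prod_diff div_prod_diff div_prod_diff_left fun_eq_iff algebra_simps)
qed

text \<open>The bound for the remainder of f is a hypothesis, so that both regularity classes of f
  share this argument. 12 is the bilinear constant 4 times the 3 for lowering \<beta> to \<gamma> in
  the second component.\<close>

lemma Q_bound_aux:
  assumes p: "p \<in> X" "N (p - sol) \<le> 1" and T: "hb \<beta> M (taylor_rem f m (snd p))"
  shows "Y (12 * real CARD('n) * (emb CARD('n))\<^sup>2 * (N (p - sol))\<^sup>2 + M) (Q p)"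
proof -
  define d where "d = N (p - sol)"
  note n = near_sol[OF p, folded d_def]
  let ?k = "4 * real CARD('n) * (emb CARD('n))\<^sup>2"
  have M: "0 \<le> M" using hb_nonneg[OF T] .
  have k: "0 \<le> ?k * (d * d)" by simp
  have half: "\<bar>1/2 :: real\<bar> = 1/2" by simp
  have "hb \<beta> (\<bar>1/2\<bar> * (?k * (d * d)) + M) (fst (Q p))"
    unfolding Q_eq[OF p(1)] fst_conv using expo beta_pos
    by (intro hb_diff hb_cmult hb_grad_prod[OF n(3) n(3)] T) auto
  moreover have "hb \<gamma> (3 * (?k * (d * d))) (snd (Q p))"
    unfolding Q_eq[OF p(1)] snd_conv using expo beta_pos
    by (intro hb_uminus hb_exponent_mono[OF hb_div_prod[OF n(4) n(3)]]) auto
  moreover have eq: "12 * real CARD('n) * (emb CARD('n))\<^sup>2 * d\<^sup>2 + M = 3 * (?k * (d * d)) + M"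
    by (simp add: power2_eq_square)
  moreover have "\<bar>1/2\<bar> * (?k * (d * d)) + M \<le> 3 * (?k * (d * d)) + M" "3 * (?k * (d * d)) \<le> 3 * (?k * (d * d)) + M"
    unfolding half using k M by linarith+
  moreover have "periodic (fst (Q p))" "periodic (snd (Q p))"
  proof -
    note q = c2b_C2[OF n(3)] c2b_C2[OF n(4)]
    show "periodic (fst (Q p))" "periodic (snd (Q p))"
      unfolding Q_eq[OF p(1)] using periodic_grad_prod[OF q(2,1) q(2,1)] periodic_div_prod[OF q(4,3) q(2,1)]
        X_C2[OF p(1)] c2b_C2(2)[OF n(6)] by (auto simp: periodic_def taylor_rem_def)
  qed
  ultimately show ?thesis
    unfolding Y_def d_def[symmetric] eq by (blast intro: hb_mono)
qed

lemma Q_superlinear: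
  obtains C where "0 \<le> C" "\<And>p. p \<in> X \<Longrightarrow> N (p - sol) \<le> 1 \<Longrightarrow> Y (C * N (p - sol) powr (2 - \<beta>)) (Q p)"
proof -
  define R where "R = N sol + 1"
  obtain F where F: "0 \<le> F" "\<And>s. \<bar>s\<bar> \<le> R \<Longrightarrow> \<bar>f s\<bar> \<le> F" "\<And>s. \<bar>s\<bar> \<le> R \<Longrightarrow> \<bar>deriv f s\<bar> \<le> F"
    "\<And>s. \<bar>s\<bar> \<le> R \<Longrightarrow> \<bar>deriv (deriv f) s\<bar> \<le> F" using C2R_bounds[OF f, of R] by blast
  define A where "A = F + (2 * F) powr (1 - \<beta>) * (real CARD('n) * (F * (3 * R + 1))) powr \<beta>"
  let ?k = "12 * real CARD('n) * (emb CARD('n))\<^sup>2"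
  have A: "0 \<le> A" using F(1) by (simp add: A_def)
  show ?thesis
  proof (rule that[of "?k + A"])
    show "0 \<le> ?k + A" using A by simp
    fix p assume p: "p \<in> X" "N (p - sol) \<le> 1"
    note n = near_sol[OF p]
    have c: "C2 m" "C2 (snd p)" using c2b_C2(1)[OF n(6)] X_C2[OF p(1)] by auto
    have T: "hb \<beta> (A * N (p - sol) powr (2 - \<beta>)) (taylor_rem f m (snd p))"
      unfolding A_def
    proof (rule hb_taylor_rem(1)[OF f n(6)[folded R_def] n(5)[folded R_def] _ _ p(2) F(4) beta_pos(1) expo(3)])
      show "\<bar>m x - snd p x\<bar> \<le> N (p - sol)" for x using n(4) by (simp add: c2b_def)
      show "\<bar>pd i m x - pd i (snd p) x\<bar> \<le> N (p - sol)" for i x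
        using n(4) unfolding c2b_def pd_C2_diff[OF c] by blast
    qed
    have "(N (p - sol))\<^sup>2 \<le> N (p - sol) powr (2 - \<beta>)"
    proof (cases "N (p - sol) = 0")
      case False
      then have "(N (p - sol))\<^sup>2 = N (p - sol) powr 2" using n(7) by simp
      also have "\<dots> \<le> N (p - sol) powr (2 - \<beta>)" using n(7) p(2) beta_pos by (intro powr_mono') auto
      finally show ?thesis .
    qed simp
    then have "?k * (N (p - sol))\<^sup>2 \<le> ?k * N (p - sol) powr (2 - \<beta>)" by (rule mult_left_mono) simp
    then show "Y ((?k + A) * N (p - sol) powr (2 - \<beta>)) (Q p)"
      using Y_mono[OF Q_bound_aux[OF p T]] by (simp add: distrib_right)
  qed
qed

lemma Q_quadratic:
  assumes "C21loc f"
  obtains C where "0 \<le> C" "\<And>p. p \<in> X \<Longrightarrow> N (p - sol) \<le> 1 \<Longrightarrow> Y (C * (N (p - sol))\<^sup>2) (Q p)"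
proof -
  define R where "R = N sol + 1"
  have R: "0 \<le> R" using N_nonneg[OF sol_in_X] by (simp add: R_def)
  obtain F where F: "0 \<le> F" "\<And>s. \<bar>s\<bar> \<le> R \<Longrightarrow> \<bar>f s\<bar> \<le> F" "\<And>s. \<bar>s\<bar> \<le> R \<Longrightarrow> \<bar>deriv f s\<bar> \<le> F"
    "\<And>s. \<bar>s\<bar> \<le> R \<Longrightarrow> \<bar>deriv (deriv f) s\<bar> \<le> F" using C2R_bounds[OF f, of R] by blast
  obtain L where L: "\<And>s t. \<bar>s\<bar> \<le> R \<Longrightarrow> \<bar>t\<bar> \<le> R \<Longrightarrow> \<bar>deriv (deriv f) s - deriv (deriv f) t\<bar> \<le> L * \<bar>s - t\<bar>"
    using assms unfolding C21loc_def by meson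
  have L': "\<bar>deriv (deriv f) s - deriv (deriv f) t\<bar> \<le> \<bar>L\<bar> * \<bar>s - t\<bar>" if "\<bar>s\<bar> \<le> R" "\<bar>t\<bar> \<le> R" for s t
    using L[OF that] mult_right_mono[OF abs_ge_self[of L] abs_ge_zero[of "s - t"]] by linarith
  define A where "A = emb CARD('n) * (F + \<bar>L\<bar> * R)"
  let ?k = "12 * real CARD('n) * (emb CARD('n))\<^sup>2"
  have A: "0 \<le> A" using F(1) R by (simp add: A_def emb_def)
  show ?thesis
  proof (rule that[of "?k + A"])
    show "0 \<le> ?k + A" using A by simp
    fix p assume p: "p \<in> X" "N (p - sol) \<le> 1"
    note n = near_sol[OF p]
    have c: "C2 m" "C2 (snd p)" using c2b_C2(1)[OF n(6)] X_C2[OF p(1)] by auto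
    have "hb \<beta> (emb CARD('n) * ((F + \<bar>L\<bar> * R) * (N (p - sol))\<^sup>2)) (taylor_rem f m (snd p))"
    proof (rule hb_taylor_rem(2)[OF f n(6)[folded R_def] n(5)[folded R_def] _ _ p(2) F(4) beta_pos(1) expo(3) _ L'])
      show "\<bar>m x - snd p x\<bar> \<le> N (p - sol)" for x using n(4) by (simp add: c2b_def)
      show "\<bar>pd i m x - pd i (snd p) x\<bar> \<le> N (p - sol)" for i x
        using n(4) unfolding c2b_def pd_C2_diff[OF c] by blast
    qed auto
    then have T: "hb \<beta> (A * (N (p - sol))\<^sup>2) (taylor_rem f m (snd p))" by (simp add: A_def mult.assoc)
    then show "Y ((?k + A) * (N (p - sol))\<^sup>2) (Q p)"
      using Q_bound_aux[OF p T] by (simp add: distrib_right)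
  qed
qed

text \<open>Adding \<open>dG f p (sol - p)\<close> and G at \<open>p\<close> gives G at the solution
  minus \<open>Q p\<close>, and T of G at the solution is \<open>- sol\<close>; the Newton equation
  thereby becomes a linear equation for the error.\<close>

lemma newton_step_iff:
  assumes p: "p \<in> X" "N (p - sol) \<le> 1" and s: "s \<in> X"
  shows "s + T lam (G lam f m0 p + dG f p (s - p)) = 0 \<longleftrightarrow>
    (s - sol) + T lam (dG f p (s - sol)) = T lam (Q p)"
proof -
  have d: "s - sol \<in> X" "sol - p \<in> X" using p(1) s sol_in_X S_closed by blast+
  obtain C where C: "\<And>z. z \<in> X \<Longrightarrow> Y (C * N z) (dG f p z)" using dG_Y[of p] p by blast
  obtain M where M: "Y M (G lam f m0 sol)" using G_sol_Y by blast
  obtain M' where M': "Y M' (Q p)" using Q_superlinear p by metis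
  have "s - p = (s - sol) + (sol - p)" by simp
  then have "dG f p (s - p) = dG f p (s - sol) + dG f p (sol - p)" using dG_add[OF p(1) d] by metis
  then have "G lam f m0 p + dG f p (s - p) = (G lam f m0 sol - Q p) + dG f p (s - sol)"
    by (simp add: Q_def)
  then have "T lam (G lam f m0 p + dG f p (s - p)) = (- sol - T lam (Q p)) + T lam (dG f p (s - sol))"
    using T_add[OF Y_diff[OF M M'] C[OF d(1)]] T_diff[OF M M'] by (simp add: sol_fixed_point)
  then have "s + T lam (G lam f m0 p + dG f p (s - p)) = ((s - sol) + T lam (dG f p (s - sol))) - T lam (Q p)"
    by simp
  then show ?thesis by (simp only: right_minus_eq)
qed

text \<open>The lower bound at the solution is robust, whereas surjectivity is regained at each p
  from the Riesz theory. Hence neither a Neumann series nor completeness of the space is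
  involved.\<close>

lemma newton_local:
  obtains r c where "0 < r" "r \<le> 1" "0 < c"
    "\<And>p. p \<in> X \<Longrightarrow> N (p - sol) \<le> r \<Longrightarrow> \<exists>s\<in>X. s + T lam (G lam f m0 p + dG f p (s - p)) = 0"
    "\<And>p s. p \<in> X \<Longrightarrow> N (p - sol) \<le> r \<Longrightarrow> s \<in> X \<Longrightarrow> s + T lam (G lam f m0 p + dG f p (s - p)) = 0 \<Longrightarrow>
      c * N (s - sol) \<le> N (T lam (Q p))"
proof -
  interpret S: compact_perturbation X N "\<lambda>z. T lam (dG f sol z)"
    using compact_perturbation_dG[OF sol_in_X sol_injective] .
  obtain c where c: "c > 0" "\<And>z. z \<in> X \<Longrightarrow> c * N z \<le> N (z + T lam (dG f sol z))"
    using S.bounded_below unfolding S.A_def by blast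
  obtain CT where CT: "CT > 0" "\<And>p M. Y M p \<Longrightarrow> T lam p \<in> X \<and> N (T lam p) \<le> CT * M"
    using T_bound by metis
  obtain C where C: "0 \<le> C" "\<And>p z. p \<in> X \<Longrightarrow> N (p - sol) \<le> 1 \<Longrightarrow> z \<in> X \<Longrightarrow>
    Y (C * N (p - sol) powr (1 - \<beta>) * N z) (dG f p z - dG f sol z)" using dG_difference by blast
  obtain r where r: "0 < r" "r \<le> 1" "\<And>t. 0 \<le> t \<Longrightarrow> t \<le> r \<Longrightarrow> (CT * C) * t powr (1 - \<beta>) \<le> c/2"
    using powr_small[of "c/2" "CT * C" "1 - \<beta>"] c CT C expo by auto
  \<comment> \<open>Replacing dG at the solution by dG at p costs at most c/2 by the choice of the
    radius; the other half of the lower bound remains and yields injectivity at p.\<close>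
  have low: "c/2 * N z \<le> N (z + T lam (dG f p z))" if p: "p \<in> X" "N (p - sol) \<le> r" and z: "z \<in> X" for p z
  proof -
    have p1: "N (p - sol) \<le> 1" using p r by simp
    obtain Cp where Cp: "\<And>z. z \<in> X \<Longrightarrow> Y (Cp * N z) (dG f p z)" using dG_Y[of p] p by blast
    obtain Cs where Cs: "\<And>z. z \<in> X \<Longrightarrow> Y (Cs * N z) (dG f sol z)" using dG_Y[of sol] sol_in_X by blast
    have Tp: "T lam (dG f p z) \<in> X" "T lam (dG f sol z) \<in> X" using CT(2)[OF Cp[OF z]] CT(2)[OF Cs[OF z]] by auto
    have "N (T lam (dG f p z) - T lam (dG f sol z)) \<le> CT * (C * N (p - sol) powr (1 - \<beta>) * N z)"
      using CT(2)[OF C(2)[OF p(1) p1 z]] T_diff[OF Cp[OF z] Cs[OF z]] by simp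
    also have "\<dots> = (CT * C) * N (p - sol) powr (1 - \<beta>) * N z" by (simp only: mult.assoc)
    also have "\<dots> \<le> c/2 * N z"
      using r(3)[OF near_sol(7)[OF p(1) p1] p(2)] N_nonneg[OF z] by (intro mult_right_mono)
    finally have 1: "N (T lam (dG f p z) - T lam (dG f sol z)) \<le> c/2 * N z" .
    have "z + T lam (dG f sol z) = (z + T lam (dG f p z)) - (T lam (dG f p z) - T lam (dG f sol z))" by simp
    then have "N (z + T lam (dG f sol z)) \<le> N (z + T lam (dG f p z)) + N (T lam (dG f p z) - T lam (dG f sol z))"
      using N_diff[OF S_closed(2)[OF z Tp(1)] S_closed(3)[OF Tp]] by metis
    then show ?thesis using c(2)[OF z] 1 by linarith
  qed
  show ?thesis
  proof (rule that[OF r(1,2), of "c/2"])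
    show "0 < c/2" using c by simp
    fix p assume p: "p \<in> X" "N (p - sol) \<le> r"
    have p1: "N (p - sol) \<le> 1" using p r by simp
    interpret P: compact_perturbation X N "\<lambda>z. T lam (dG f p z)"
    proof (rule compact_perturbation_dG[OF p(1)])
      fix z assume z: "z \<in> X" "z + T lam (dG f p z) = 0"
      then have "c/2 * N z \<le> 0" using low[OF p z(1)] N_0 by simp
      then have "N z = 0" using N_nonneg[OF z(1)] c(1) by (simp add: mult_le_0_iff)
      then show "z = 0" using N_eq_0[OF z(1)] by blast
    qed
    obtain M' where M': "Y M' (Q p)" using Q_superlinear p p1 by metis
    have "T lam (Q p) \<in> X" using CT(2)[OF M'] by blast
    then have "T lam (Q p) \<in> P.A ` X" using P.surjective by simp
    then obtain z where z: "z \<in> X" "z + T lam (dG f p z) = T lam (Q p)"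
      unfolding P.A_def by auto
    have zs: "z + sol \<in> X" using z(1) sol_in_X S_closed by blast
    then show "\<exists>s\<in>X. s + T lam (G lam f m0 p + dG f p (s - p)) = 0"
      using newton_step_iff[OF p(1) p1 zs] z(2) by (intro bexI[of _ "z + sol"]) auto
    fix s assume s: "s \<in> X" "s + T lam (G lam f m0 p + dG f p (s - p)) = 0"
    have "s - sol \<in> X" using s(1) sol_in_X S_closed by blast
    from low[OF p this] show "c/2 * N (s - sol) \<le> N (T lam (Q p))"
      using newton_step_iff[OF p(1) p1 s(1)] s(2) by simp
  qed
qed

text \<open>Every solution of the step equation obeys the error estimate of
  \<open>newton_local\<close>, so the convergence half covers all Newton sequences in
  \<open>X\<close>, not only a constructed one.\<close>

lemma newton_convergence:
  obtains r where "0 < r"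
    "\<And>p. p \<in> X \<Longrightarrow> N (p - sol) < r \<Longrightarrow> \<exists>s. s 0 = p \<and> (\<forall>k. s k \<in> X) \<and> newton_seq lam f m0 s"
    "\<And>s. N (s 0 - sol) < r \<Longrightarrow> (\<And>k. s k \<in> X) \<Longrightarrow> newton_seq lam f m0 s \<Longrightarrow>
      superlinear (\<lambda>k. N (s k - sol)) \<and> (C21loc f \<longrightarrow> quadratic (\<lambda>k. N (s k - sol)))"
proof -
  obtain r0 c where r0: "0 < r0" "r0 \<le> 1" and c: "0 < c"
    and ex: "\<And>p. p \<in> X \<Longrightarrow> N (p - sol) \<le> r0 \<Longrightarrow> \<exists>s\<in>X. s + T lam (G lam f m0 p + dG f p (s - p)) = 0"
    and est: "\<And>p s. p \<in> X \<Longrightarrow> N (p - sol) \<le> r0 \<Longrightarrow> s \<in> X \<Longrightarrow> s + T lam (G lam f m0 p + dG f p (s - p)) = 0 \<Longrightarrow>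
      c * N (s - sol) \<le> N (T lam (Q p))" using newton_local by blast
  obtain CT where CT: "CT > 0" "\<And>p M. Y M p \<Longrightarrow> T lam p \<in> X \<and> N (T lam p) \<le> CT * M"
    using T_bound by metis
  obtain C where C: "0 \<le> C" "\<And>p. p \<in> X \<Longrightarrow> N (p - sol) \<le> 1 \<Longrightarrow> Y (C * N (p - sol) powr (2 - \<beta>)) (Q p)"
    using Q_superlinear by blast
  define D where "D = CT * C / c"
  have D: "0 \<le> D" using CT C c by (simp add: D_def)
  \<comment> \<open>With this radius the superlinear factor is at most 1/2: each step halves the
    error, the iterates stay in the ball, and the errors tend to 0 geometrically before the sharper
    rate is read off.\<close>
  obtain r1 where r1: "0 < r1" "r1 \<le> 1" "\<And>t. 0 \<le> t \<Longrightarrow> t \<le> r1 \<Longrightarrow> D * t powr (1 - \<beta>) \<le> 1/2"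
    using powr_small[of "1/2" D "1 - \<beta>"] D expo by auto
  define r where "r = min r0 r1"
  have r: "0 < r" "r \<le> r0" "r \<le> r1" using r0 r1 by (auto simp: r_def)
  have nonneg: "0 \<le> N (p - sol)" if "p \<in> X" for p
    by (rule N_nonneg[OF S_closed(3)[OF that sol_in_X]])
  have step: "N (s - sol) \<le> (D * N (p - sol) powr (1 - \<beta>)) * N (p - sol)" "N (s - sol) \<le> N (p - sol) / 2"
    if p: "p \<in> X" "N (p - sol) < r" and s: "s \<in> X" "s + T lam (G lam f m0 p + dG f p (s - p)) = 0" for p s
  proof -
    have le: "N (p - sol) \<le> r0" "N (p - sol) \<le> 1" "N (p - sol) \<le> r1" using p r r0 by auto
    have "c * N (s - sol) \<le> CT * (C * N (p - sol) powr (2 - \<beta>))"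
      using est[OF p(1) le(1) s] CT(2)[OF C(2)[OF p(1) le(2)]] by linarith
    then have "N (s - sol) \<le> D * N (p - sol) powr (2 - \<beta>)"
      using c by (simp add: D_def field_simps)
    also have "N (p - sol) powr (2 - \<beta>) = N (p - sol) powr (1 - \<beta>) * N (p - sol)"
    proof (cases "N (p - sol) = 0")
      case False
      have "N (p - sol) powr (2 - \<beta>) = N (p - sol) powr ((1 - \<beta>) + 1)" by simp
      also have "\<dots> = N (p - sol) powr (1 - \<beta>) * N (p - sol)"
        unfolding powr_add using nonneg[OF p(1)] False by simp
      finally show ?thesis .
    qed simp
    finally show 1: "N (s - sol) \<le> (D * N (p - sol) powr (1 - \<beta>)) * N (p - sol)" by (simp only: mult.assoc)
    have "(D * N (p - sol) powr (1 - \<beta>)) * N (p - sol) \<le> 1/2 * N (p - sol)"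
      using r1(3)[OF nonneg[OF p(1)] le(3)] nonneg[OF p(1)] by (rule mult_right_mono)
    then show "N (s - sol) \<le> N (p - sol) / 2" using 1 by simp
  qed
  show ?thesis
  proof (rule that[OF r(1)])
    fix p assume p: "p \<in> X" "N (p - sol) < r"
    \<comment> \<open>Dependent choice with membership in the ball as invariant; the condition at
      index 0 fixes the starting point.\<close>
    have "\<exists>s. \<forall>n. ((n = 0 \<longrightarrow> s n = p) \<and> s n \<in> X \<and> N (s n - sol) < r) \<and>
        s (Suc n) + T lam (G lam f m0 (s n) + dG f (s n) (s (Suc n) - s n)) = 0"
    proof (rule dependent_nat_choice)
      show "\<exists>x. (0 = 0 \<longrightarrow> x = p) \<and> x \<in> X \<and> N (x - sol) < r" using p by blast
      fix x and n :: nat assume x: "(n = 0 \<longrightarrow> x = p) \<and> x \<in> X \<and> N (x - sol) < r"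
      then obtain y where y: "y \<in> X" "y + T lam (G lam f m0 x + dG f x (y - x)) = 0"
        using ex[of x] r by auto
      have "N (y - sol) \<le> N (x - sol) / 2" using step(2)[of x y] x y by blast
      then have "N (y - sol) < r" using x r(1) by linarith
      then show "\<exists>y. ((Suc n = 0 \<longrightarrow> y = p) \<and> y \<in> X \<and> N (y - sol) < r) \<and> y + T lam (G lam f m0 x + dG f x (y - x)) = 0"
        using y by blast
    qed
    then show "\<exists>s. s 0 = p \<and> (\<forall>k. s k \<in> X) \<and> newton_seq lam f m0 s" unfolding newton_seq_def by blast
  next
    fix s assume s0: "N (s 0 - sol) < r" and sX: "\<And>k. s k \<in> X" and nw: "newton_seq lam f m0 s"
    let ?e = "\<lambda>k. N (s k - sol)"
    have eq: "s (Suc k) + T lam (G lam f m0 (s k) + dG f (s k) (s (Suc k) - s k)) = 0" for k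
      using nw by (simp add: newton_seq_def)
    have e: "?e k < r \<and> ?e k \<le> ?e 0 * (1/2) ^ k" for k
    proof (induction k)
      case (Suc k)
      have "?e (Suc k) \<le> ?e k / 2" using step(2)[OF sX _ sX eq, of k] Suc by blast
      then show ?case using Suc nonneg[OF sX, of k] r(1) by auto
    qed (use s0 in simp)
    have null: "(\<lambda>k. ?e 0 * (1/2) ^ k) \<longlonglongrightarrow> 0"
      by (intro tendsto_mult_right_zero LIMSEQ_realpow_zero) auto
    have e0: "?e \<longlonglongrightarrow> 0"
      by (rule tendsto_sandwich[OF _ _ tendsto_const null])
        (simp_all only: conjunct2[OF e] nonneg[OF sX] always_eventually simp_thms)
    have "(\<lambda>k. ?e k powr (1 - \<beta>)) \<longlonglongrightarrow> 0 powr (1 - \<beta>)"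
      by (rule tendsto_powr'[OF e0 tendsto_const]) (use nonneg[OF sX] expo in auto)
    then have "(\<lambda>k. D * ?e k powr (1 - \<beta>)) \<longlonglongrightarrow> 0" by (intro tendsto_mult_right_zero) simp
    moreover have "?e (Suc k) \<le> (D * ?e k powr (1 - \<beta>)) * ?e k" for k
      using step(1)[OF sX _ sX eq, of k] e by blast
    ultimately have "superlinear ?e" unfolding superlinear_def using e0 by blast
    moreover have "quadratic ?e" if q: "C21loc f"
    proof -
      obtain C' where C': "0 \<le> C'" "\<And>p. p \<in> X \<Longrightarrow> N (p - sol) \<le> 1 \<Longrightarrow> Y (C' * (N (p - sol))\<^sup>2) (Q p)"
        using Q_quadratic[OF q] by blast
      have "?e (Suc k) \<le> (CT * C' / c) * (?e k)\<^sup>2" for k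
      proof -
        have le: "?e k \<le> r0" "?e k \<le> 1" using e[of k] r r0 by auto
        have "c * ?e (Suc k) \<le> CT * (C' * (?e k)\<^sup>2)"
          using est[OF sX le(1) sX eq] CT(2)[OF C'(2)[OF sX le(2)]] by linarith
        then show ?thesis using c by (simp add: field_simps)
      qed
      then show ?thesis unfolding quadratic_def using e0 by blast
    qed
    ultimately show "superlinear ?e \<and> (C21loc f \<longrightarrow> quadratic ?e)" by blast
  qed
qed

end

text \<open>\<open>newton_seq\<close> is a relation between iterates rather than a function.
  Well-posedness and convergence on the ball are therefore two claims: a sequence in the spaces
  exists, and each such sequence converges at the stated rate.\<close>

theorem theorem5p8:
  fixes lam \<alpha> \<beta> \<gamma> :: real and f :: "real \<Rightarrow> real"
    and m0 u m :: "real^'n::finite \<Rightarrow> real"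
  assumes "lam > 0" and "0 < \<gamma>" and "\<gamma> < \<beta>" and "\<beta> < \<alpha>" and "\<alpha> < 1"
    and "C0a \<alpha> m0" and "prob_density m0"
    and "C1b f" and "C2R f"
    and "C2a \<alpha> u" and "C2a \<alpha> m"
    and "stable lam f m0 u m"
  shows "\<exists>r>0. \<forall>u0 m00. C2a \<beta> u0 \<and> C2a \<gamma> m00 \<and> norm2a \<beta> (u0 - u) + norm2a \<gamma> (m00 - m) < r \<longrightarrow>
     (\<exists>s. s 0 = (u0, m00) \<and> (\<forall>k. C2a \<beta> (fst (s k)) \<and> C2a \<gamma> (snd (s k))) \<and> newton_seq lam f m0 s) \<and>
     (\<forall>s. s 0 = (u0, m00) \<and> (\<forall>k. C2a \<beta> (fst (s k)) \<and> C2a \<gamma> (snd (s k))) \<and> newton_seq lam f m0 s \<longrightarrow>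
        superlinear (\<lambda>k. norm2a \<beta> (fst (s k) - u) + norm2a \<gamma> (snd (s k) - m)) \<and>
        (C21loc f \<longrightarrow> quadratic (\<lambda>k. norm2a \<beta> (fst (s k) - u) + norm2a \<gamma> (snd (s k) - m))))"
proof -
  have "\<exists>M. hb \<gamma> M m0"
  proof -
    have m0: "periodic m0" "continuous_on UNIV m0" "holder_bdd \<alpha> m0" using assms(6) by (auto simp: C0a_def)
    obtain B where B: "\<And>x. \<bar>m0 x\<bar> \<le> B" using periodic_bounded[OF m0(1,2)] by blast
    obtain K where K: "\<And>x y. \<bar>m0 x - m0 y\<bar> \<le> K * dist x y powr \<alpha>" using m0(3) by (auto simp: holder_bdd_def)
    have "hb \<alpha> (B + \<bar>K\<bar>) m0" unfolding hb_def
    proof (intro conjI allI)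
      fix x y
      have B0: "0 \<le> B" using B[of x] by linarith
      show "\<bar>m0 x\<bar> \<le> B + \<bar>K\<bar>" using B[of x] by linarith
      have "K * dist x y powr \<alpha> \<le> (B + \<bar>K\<bar>) * dist x y powr \<alpha>" using B0 by (intro mult_right_mono) auto
      then show "\<bar>m0 x - m0 y\<bar> \<le> (B + \<bar>K\<bar>) * dist x y powr \<alpha>" using K[of x y] by linarith
    qed
    then show ?thesis using hb_exponent_mono[of \<alpha> _ m0 \<gamma>] assms by auto
  qed
  then interpret mfg_newton lam \<beta> \<gamma> f m0 u m
    using assms by unfold_locales (auto intro: C2a_exponent_mono simp: C0a_def)
  obtain r where r: "0 < r"
    "\<And>p. p \<in> X \<Longrightarrow> N (p - sol) < r \<Longrightarrow> \<exists>s. s 0 = p \<and> (\<forall>k. s k \<in> X) \<and> newton_seq lam f m0 s"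
    "\<And>s. N (s 0 - sol) < r \<Longrightarrow> (\<And>k. s k \<in> X) \<Longrightarrow> newton_seq lam f m0 s \<Longrightarrow>
      superlinear (\<lambda>k. N (s k - sol)) \<and> (C21loc f \<longrightarrow> quadratic (\<lambda>k. N (s k - sol)))"
    using newton_convergence by blast
  have N: "N (p - sol) = norm2a \<beta> (fst p - u) + norm2a \<gamma> (snd p - m)" for p
    by (simp add: N_def sol_def)
  show ?thesis
  proof (intro exI[of _ r] conjI allI impI)
    fix u0 m00 assume h: "C2a \<beta> u0 \<and> C2a \<gamma> m00 \<and> norm2a \<beta> (u0 - u) + norm2a \<gamma> (m00 - m) < r"
    show "\<exists>s. s 0 = (u0, m00) \<and> (\<forall>k. C2a \<beta> (fst (s k)) \<and> C2a \<gamma> (snd (s k))) \<and> newton_seq lam f m0 s"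
      using r(2)[of "(u0, m00)"] h by (simp add: N X_def)
    fix s assume s: "s 0 = (u0, m00) \<and> (\<forall>k. C2a \<beta> (fst (s k)) \<and> C2a \<gamma> (snd (s k))) \<and> newton_seq lam f m0 s"
    have "superlinear (\<lambda>k. N (s k - sol)) \<and> (C21loc f \<longrightarrow> quadratic (\<lambda>k. N (s k - sol)))"
      by (rule r(3)) (use s h in \<open>auto simp: N X_def\<close>)
    then show "superlinear (\<lambda>k. norm2a \<beta> (fst (s k) - u) + norm2a \<gamma> (snd (s k) - m))"
      "C21loc f \<Longrightarrow> quadratic (\<lambda>k. norm2a \<beta> (fst (s k) - u) + norm2a \<gamma> (snd (s k) - m))"
      by (auto simp: N)
  qed (rule r(1))
qed

end
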